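(* Let $r\in\mathbb{R}$ and $\delta=(c_{00},c_{10},c_{01},c_{02},c_{11},c_{20})\in\mathbb{R}^6$, and consider the near-Hamiltonian system $$\dot u=H_v(u,v)+\varepsilon p(u,v,\delta),\qquad \dot v=-H_u(u,v)+\varepsilon q(u,v,\delta),$$ where $$H(u,v)=\tfrac12(u^2+v^2)-\tfrac12u^3+v^3+\tfrac18u^4-uv^3+rv^4,$$ and $p,q$ are polynomials of degree at most $3$ in $(u,v)$, depending linearly on $\delta$, with $$p_u+q_v=c_{00}+c_{10}u+c_{01}v+c_{20}u^2+c_{11}uv+c_{02}v^2 .$$ Let $\sigma=(r)$, and let $\delta_0=(c_{00}^*,c_{10}^*,c_{01}^*,c_{02}^*,c_{11}^*,c_{20}^* )$, $\sigma_0=(r^* )$ satisfy $$f(r^* )=0,\quad c_{00}^*=0,\quad c_{02}^*=-\tfrac32c_{10}^*+3c_{01}^*-c_{20}^*,\quad c_{01}^*\neq0,$$ $$c_{11}^*=\big(12r^*-\tfrac{191}{4}\big)c_{10}^*+(40r^*+3)c_{01}^*+\big(8r^*-\tfrac{47}{2}\big)c_{20}^*,$$ $$c_{10}^*=\frac{2}{17680r^*-43347}\Big[\big(1792(r^* )^2-17328r^*-696\big)c_{01}^*+\big(11107-5680r^*\big)c_{20}^*\Big],$$ $$c_{20}^*=\frac{6544683+11682846r^*+30378720(r^* )^2-40278528(r^* )^3-21471232(r^* )^4}{2\big(2770317-11417834r^*+11442688(r^* )^2+442880(r^* )^3\big)}\,c_{01}^*,$$ where $$f(r)=780900831-459924741r-2093583104r^2-1597844992r^3-108363776r^4+1381957632r^5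 .$$ Then for some $(\varepsilon,\delta,\sigma)$ near $(0,\delta_0,\sigma_0)$ (with $\varepsilon\neq0$) the system has $6$ limit cycles near the origin.
   Context: "For some $(\varepsilon,\delta,\sigma)$ near $(0,\delta_0,\sigma_0)$ the system has $N$ limit cycles near the origin" means: for every neighborhood $V$ of the origin and every $\eta>0$ there exist $\varepsilon,\delta,\sigma$ with $0<|\varepsilon|<\eta$, $|\delta-\delta_0|<\eta$, $|\sigma-\sigma_0|<\eta$ for which the system has $N$ limit cycles in $V$. *)

theory Defs
  imports "HOL-Analysis.Analysis"
begin

type_synonym param = "real ^ 6"

definition c00 :: "param \<Rightarrow> real" where "c00 d = d $ 1"
definition c10 :: "param \<Rightarrow> real" where "c10 d = d $ 2"
definition c01 :: "param \<Rightarrow> real" where "c01 d = d $ 3"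
definition c02 :: "param \<Rightarrow> real" where "c02 d = d $ 4"
definition c11 :: "param \<Rightarrow> real" where "c11 d = d $ 5"
definition c20 :: "param \<Rightarrow> real" where "c20 d = d $ 6"

definition Ham :: "real \<Rightarrow> real \<Rightarrow> real \<Rightarrow> real" where
  "Ham r u v = (u^2 + v^2) / 2 - u^3 / 2 + v^3 + u^4 / 8 - u * v^3 + r * v^4"

definition fpoly :: "real \<Rightarrow> real" where
  "fpoly r = 780900831 - 459924741 * r - 2093583104 * r^2 - 1597844992 * r^3
             - 108363776 * r^4 + 1381957632 * r^5"

definition field ::
  "(real \<Rightarrow> real \<Rightarrow> param \<Rightarrow> real) \<Rightarrow> (real \<Rightarrow> real \<Rightarrow> param \<Rightarrow> real) \<Rightarrow>
   real \<Rightarrow> param \<Rightarrow> real \<Rightarrow> real \<times> real \<Rightarrow> real \<times> real" where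
  "field p q eps d r z =
     (deriv (\<lambda>v. Ham r (fst z) v) (snd z) + eps * p (fst z) (snd z) d,
      - deriv (\<lambda>u. Ham r u (snd z)) (fst z) + eps * q (fst z) (snd z) d)"

definition periodic_orbit :: "(real \<times> real \<Rightarrow> real \<times> real) \<Rightarrow> (real \<times> real) set \<Rightarrow> bool" where
  "periodic_orbit F \<Gamma> \<longleftrightarrow>
     (\<exists>x T. T > 0 \<and> (\<forall>t. (x has_vector_derivative F (x t)) (at t)) \<and>
            (\<forall>t. x (t + T) = x t) \<and> (\<exists>s t. x s \<noteq> x t) \<and> \<Gamma> = range x)"

definition limit_cycle :: "(real \<times> real \<Rightarrow> real \<times> real) \<Rightarrow> (real \<times> real) set \<Rightarrow> bool" where
  "limit_cycle F \<Gamma> \<longleftrightarrow> periodic_orbit F \<Gamma> \<and>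
     (\<exists>U. open U \<and> \<Gamma> \<subseteq> U \<and> (\<forall>\<Gamma>'. periodic_orbit F \<Gamma>' \<and> \<Gamma>' \<subseteq> U \<longrightarrow> \<Gamma>' = \<Gamma>))"

definition has_limit_cycles_in :: "(real \<times> real \<Rightarrow> real \<times> real) \<Rightarrow> nat \<Rightarrow> (real \<times> real) set \<Rightarrow> bool" where
  "has_limit_cycles_in F N V \<longleftrightarrow>
     (\<exists>L. card L = N \<and> (\<forall>\<Gamma>\<in>L. limit_cycle F \<Gamma> \<and> \<Gamma> \<subseteq> V))"

end

(* Write K for H(2X, 2Y)/2. Splitting off the divergence-free part (A_v, -A_u) of (p, q) leaves
   (0, Dhat) with Dhat the v-primitive of the divergence, and the function
   V = H/2 + eps (A/2 - 2 W) satisfies, for a suitable polynomial W,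
     dV/dt = eps (sum_{j <= 6} B_j (X^2 + Y^2)^(j+1) + terms of degree >= 15) + O(eps^2),
   where the focal values B_j are linear in delta and polynomial in r. At (delta_0, sigma_0) one has
   B_0 = ... = B_5 = 0 and B_6 <> 0, and B_0, ..., B_5 can be perturbed independently: c00, c02,
   c11, c10, c20 enter triangularly, and B_5 contains the factor f(r), which has only simple zeros.
   On the scale (u, v) = 2 l (x sin t, x cos t) with eps = l^15 they are tuned so that
     dV/dt = l^29 (tau x^2 (x^2 - 1) ... (x^2 - 6) + o(1)),   tau <> 0.
   Near x = sqrt k the sign change yields a periodic orbit (contraction in the space of periodic
   functions, then the intermediate value theorem), and the strict monotonicity of dV/dt in x
   yields its uniqueness in a whole annulus: the difference of V along two closed orbits at equal
   polar angle is periodic in time, and it vanishes wherever its derivative does. *)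

theory Submission
  imports Defs
begin

section \<open>Periodic solutions of scalar equations\<close>

text \<open>A limit cycle must be isolated, so a sign change of dV/dt is not enough: every error
  term is estimated together with its Lipschitz constant in x, which lets the strict monotonicity of
  the limiting polynomial near its zeros survive. The correction W makes the leading part of dV/dt
  radial at every angle, not only on average, so signs and monotonicity hold pointwise. Neither a
  flow nor a return map has to be built: closed orbits are 2 pi-periodic solutions of the scalar
  equation for the radius as a function of the angle. The exponent in eps = l^15 comes from
  comparing the radial terms, of size eps l^14, with the terms in eps^2; these are then smaller by
  one factor l, like the remainder of degree 15. All seven terms B_j (l x)^(2 j + 2) have size l^14
  once B_j has size l^(12 - 2 j); so r moves by a multiple of l^2, and the deviations from the other
  relations are of higher order. Doubling the variables makes the gradient of K integral, and common
  denominators turn the equations for W into integer arithmetic that is settled by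
  evaluation.\<close>

lemma continuous_has_antiderivative:
  fixes f :: "real \<Rightarrow> real"
  assumes "continuous_on UNIV f"
  obtains F where "F 0 = 0" "\<And>t. (F has_real_derivative f t) (at t)"
proof -
  have "isCont f x" for x
    using assms continuous_on_eq_continuous_at open_UNIV by blast
  then obtain F where F: "\<forall>x::real. (F has_vector_derivative f x) (at x)"
    using einterval_antiderivative[of "-\<infinity>" "\<infinity>" f] by auto
  show ?thesis
    by (rule that[of "\<lambda>t. F t - F 0"])
      (use F in \<open>auto simp: has_real_derivative_iff_has_vector_derivative intro!: derivative_eq_intros\<close>)
qed

text \<open>An antiderivative on the whole line normalised at 0. Choosing one avoids oriented
  integrals at negative arguments, which the periodicity arguments need.\<close>

definition prim :: "(real \<Rightarrow> real) \<Rightarrow> real \<Rightarrow> real" where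
  "prim f = (SOME F. F 0 = 0 \<and> (\<forall>t. (F has_real_derivative f t) (at t)))"

lemma prim:
  assumes "continuous_on UNIV f"
  shows "prim f 0 = 0" "(prim f has_real_derivative f t) (at t)"
proof -
  have "\<exists>F. F 0 = 0 \<and> (\<forall>t. (F has_real_derivative f t) (at t))"
    using continuous_has_antiderivative[OF assms] by metis
  from someI_ex[OF this] show "prim f 0 = 0" "(prim f has_real_derivative f t) (at t)"
    unfolding prim_def by auto
qed

lemma prim_add_period:
  assumes "continuous_on UNIV f" "\<And>t. f (t + T) = f t"
  shows "prim f (t + T) = prim f t + prim f T"
proof -
  have "((\<lambda>t. prim f (t + T) - prim f t) has_real_derivative 0) (at t)" for t
    using assms(2)[of t]
    by (auto intro!: derivative_eq_intros DERIV_chain2[OF prim(2)[OF assms(1)]] prim(2)[OF assms(1)])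
  then have "prim f (t + T) - prim f t = prim f (0 + T) - prim f 0"
    by (intro DERIV_isconst_all) auto
  then show ?thesis by (simp add: prim(1)[OF assms(1)])
qed

lemma prim_diff_le:
  assumes "continuous_on UNIV f" "continuous_on UNIV g" "\<And>t. \<bar>f t - g t\<bar> \<le> B" "0 \<le> t"
  shows "\<bar>prim f t - prim g t\<bar> \<le> B * t"
proof (cases "t = 0")
  case False
  then have "0 < t" using assms by simp
  have "((\<lambda>t. prim f t - prim g t) has_real_derivative (f s - g s)) (at s)" for s
    by (auto intro!: derivative_eq_intros prim(2) assms)
  from MVT2[OF \<open>0 < t\<close> this] obtain z where
    "prim f t - prim g t - (prim f 0 - prim g 0) = (t - 0) * (f z - g z)" by auto
  then have "\<bar>prim f t - prim g t\<bar> = t * \<bar>f z - g z\<bar>"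
    using \<open>0 < t\<close> by (simp add: prim(1) assms abs_mult)
  also have "\<dots> \<le> t * B" using assms(3)[of z] \<open>0 < t\<close> by (intro mult_left_mono) auto
  finally show ?thesis by (simp add: mult.commute)
qed (use assms in \<open>simp add: prim(1)\<close>)

lemma periodic_add_int:
  fixes f :: "real \<Rightarrow> 'a"
  assumes "\<And>t. f (t + T) = f t"
  shows "f (t + of_int k * T) = f t"
proof -
  have nat: "f (t + real n * T) = f t" for n t
  proof (induction n)
    case (Suc n)
    show ?case using assms[of "t + real n * T"] Suc by (simp add: algebra_simps)
  qed simp
  show ?thesis
  proof (cases k)
    case (nonneg n) then show ?thesis using nat by simp
  next
    case (neg n)
    then have k: "of_int k * T + real (Suc n) * T = 0"
      by (simp add: distrib_right[symmetric] del: of_nat_Suc)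
    have "f (t + of_int k * T) = f (t + of_int k * T + real (Suc n) * T)"
      by (rule nat[symmetric])
    also have "t + of_int k * T + real (Suc n) * T = t"
      using k by linarith
    finally show ?thesis .
  qed
qed

lemma reduce_to_period:
  fixes t T :: real
  assumes "T > 0"
  obtains k :: int where "0 \<le> t + of_int k * T" "t + of_int k * T \<le> T"
proof (rule that[of "- \<lfloor>t / T\<rfloor>"])
  have "of_int \<lfloor>t / T\<rfloor> * T \<le> t" "t \<le> (of_int \<lfloor>t / T\<rfloor> + 1) * T"
    using assms floor_divide_lower[of T t] floor_divide_upper[of T t] by auto
  then show "0 \<le> t + of_int (- \<lfloor>t / T\<rfloor>) * T" "t + of_int (- \<lfloor>t / T\<rfloor>) * T \<le> T"
    by (auto simp: algebra_simps)
qed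

text \<open>The linear term has the mean of f over a period as its slope, and subtracting it makes
  the antiderivative of a T-periodic f again T-periodic. This inverts d/dt after projection to mean
  zero.\<close>

definition centred_prim :: "real \<Rightarrow> (real \<Rightarrow> real) \<Rightarrow> real \<Rightarrow> real" where
  "centred_prim T f t = prim f t - t / T * prim f T"

lemma centred_prim_deriv:
  assumes "continuous_on UNIV f" "T > 0"
  shows "(centred_prim T f has_real_derivative f t - prim f T / T) (at t)"
  unfolding centred_prim_def using assms
  by (auto intro!: derivative_eq_intros prim(2))

lemma centred_prim_periodic:
  assumes "continuous_on UNIV f" "\<And>t. f (t + T) = f t" "T > 0"
  shows "centred_prim T f (t + T) = centred_prim T f t"
  using assms(3) prim_add_period[OF assms(1,2), of t]
  by (simp add: centred_prim_def add_divide_distrib distrib_right)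

text \<open>The bound for primitives grows with t, so periodicity first moves t into [0, T]; there
  the primitive and the linear correction contribute at most T * B each.\<close>

lemma centred_prim_diff_le:
  assumes "continuous_on UNIV f" "\<And>t. f (t + T) = f t"
    "continuous_on UNIV g" "\<And>t. g (t + T) = g t"
    "\<And>t. \<bar>f t - g t\<bar> \<le> B" "T > 0"
  shows "\<bar>centred_prim T f t - centred_prim T g t\<bar> \<le> 2 * T * B"
proof -
  obtain k where k: "0 \<le> t + of_int k * T" "t + of_int k * T \<le> T"
    using reduce_to_period[OF assms(6)] .
  define s where "s = t + of_int k * T"
  have s: "0 \<le> s" "s \<le> T" using k by (auto simp: s_def)
  have B: "0 \<le> B" using assms(5)[of 0] by linarith
  have "centred_prim T f t = centred_prim T f s" "centred_prim T g t = centred_prim T g s"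
    unfolding s_def using periodic_add_int[of "centred_prim T _" T] centred_prim_periodic assms by metis+
  then have "\<bar>centred_prim T f t - centred_prim T g t\<bar>
      = \<bar>(prim f s - prim g s) - s / T * (prim f T - prim g T)\<bar>"
    by (simp only: centred_prim_def) (simp add: algebra_simps)
  also have "\<dots> \<le> \<bar>prim f s - prim g s\<bar> + s / T * \<bar>prim f T - prim g T\<bar>"
    using s assms(6) abs_triangle_ineq4[of "prim f s - prim g s" "s / T * (prim f T - prim g T)"]
    by (simp add: abs_mult)
  also have "\<dots> \<le> B * s + s / T * (B * T)"
    using s assms by (intro add_mono mult_left_mono prim_diff_le) auto
  also have "\<dots> = 2 * s * B" using assms(6) by simp
  also have "\<dots> \<le> 2 * T * B" using s B by (intro mult_right_mono) auto
  finally show ?thesis .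
qed

lemma centred_prim_le:
  assumes "continuous_on UNIV f" "\<And>t. f (t + T) = f t" "\<And>t. \<bar>f t\<bar> \<le> B" "T > 0"
  shows "\<bar>centred_prim T f t\<bar> \<le> 2 * T * B"
proof -
  have c: "continuous_on UNIV (\<lambda>t::real. 0::real)" by simp
  have "prim (\<lambda>t. 0) t = prim (\<lambda>t. 0) 0" for t
    using prim(2)[OF c] by (intro DERIV_isconst_all) auto
  then have "centred_prim T (\<lambda>t. 0) t = 0"
    by (simp add: centred_prim_def prim(1)[OF c])
  then show ?thesis
    using centred_prim_diff_le[OF assms(1,2) c, of B t] assms by auto
qed

text \<open>Lyapunov-Schmidt reduction: with the drift m subtracted, the periodic problem is a
  contraction, and its solutions depend continuously on the mean value parameter a.\<close>

lemma periodic_solution_family: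
  fixes g :: "real \<Rightarrow> real \<Rightarrow> real"
  assumes cont: "continuous_on UNIV (\<lambda>(t, x). g t x)"
    and per: "\<And>t x. g (t + T) x = g t x"
    and bound: "\<And>t x. \<bar>g t x\<bar> \<le> B"
    and lip: "\<And>t x y. \<bar>g t x - g t y\<bar> \<le> L * \<bar>x - y\<bar>"
    and T: "T > 0" and L: "2 * T * L \<le> 1 / 2"
  obtains \<phi> m where "continuous_on UNIV m"
    "\<And>a t. \<phi> a (t + T) = \<phi> a t"
    "\<And>a t. (\<phi> a has_real_derivative g t (\<phi> a t) - m a) (at t)"
    "\<And>a t. \<bar>\<phi> a t - a\<bar> \<le> 2 * T * B"
proof -
  define S where "S = {\<phi> :: real \<Rightarrow>\<^sub>C real. \<forall>t. \<phi> (t + T) = \<phi> t}"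
  have evc: "(\<lambda>n. apply_bcontfun (X n) t) \<longlonglongrightarrow> apply_bcontfun x t"
    if "X \<longlonglongrightarrow> x" for X and x :: "real \<Rightarrow>\<^sub>C real" and t
  proof (rule metric_tendsto_imp_tendsto[OF that])
    show "\<forall>\<^sub>F n in sequentially. dist (apply_bcontfun (X n) t) (apply_bcontfun x t) \<le> dist (X n) x"
      by (intro always_eventually allI dist_bounded)
  qed
  have "closed S"
    unfolding closed_sequential_limits
  proof (intro allI impI)
    fix X x assume "(\<forall>n. X n \<in> S) \<and> X \<longlonglongrightarrow> x"
    then have X: "\<And>n. X n \<in> S" "X \<longlonglongrightarrow> x" by auto
    have "apply_bcontfun x (t + T) = apply_bcontfun x t" for t
    proof (rule LIMSEQ_unique[OF evc[OF X(2)]])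
      show "(\<lambda>n. apply_bcontfun (X n) (t + T)) \<longlonglongrightarrow> apply_bcontfun x t"
        using X(1) evc[OF X(2), of t] by (auto simp: S_def)
    qed
    then show "x \<in> S" by (simp add: S_def)
  qed
  then have complete: "complete S" by (simp add: complete_eq_closed)
  define h where "h = (\<lambda>(\<phi> :: real \<Rightarrow>\<^sub>C real) t. g t (\<phi> t))"
  have h_cont: "continuous_on UNIV (h \<phi>)" for \<phi>
  proof -
    have "continuous_on UNIV (\<lambda>t. (\<lambda>(t, x). g t x) (t, \<phi> t))"
      by (intro continuous_on_compose2[OF cont] continuous_intros) auto
    then show ?thesis by (simp add: h_def)
  qed
  have h_per: "h \<phi> (t + T) = h \<phi> t" if "\<phi> \<in> S" for \<phi> t
    using that per by (simp add: h_def S_def)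
  have h_le: "\<bar>h \<phi> t\<bar> \<le> B" for \<phi> t
    using bound by (simp add: h_def)
  have L0: "0 \<le> L" using lip[of 0 0 1] by simp
  have h_diff: "\<bar>h \<phi> t - h \<psi> t\<bar> \<le> L * dist \<phi> \<psi>" for \<phi> \<psi> t
  proof -
    have "\<bar>h \<phi> t - h \<psi> t\<bar> \<le> L * \<bar>\<phi> t - \<psi> t\<bar>" using lip by (simp add: h_def)
    also have "\<dots> \<le> L * dist \<phi> \<psi>"
      using dist_bounded[of \<phi> t \<psi>] L0 by (intro mult_left_mono) (auto simp: dist_real_def)
    finally show ?thesis .
  qed
  \<comment> \<open>A fixed point solves the equation up to a constant drift, whatever the mean of
    \<open>h \<phi>\<close> is; \<open>a\<close> is its value at time 0.\<close>
  define \<Theta> where "\<Theta> = (\<lambda>a \<phi>. Bcontfun (\<lambda>t. a + centred_prim T (h \<phi>) t))"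
  have app: "apply_bcontfun (\<Theta> a \<phi>) t = a + centred_prim T (h \<phi>) t" if "\<phi> \<in> S" for a \<phi> t
  proof -
    have "continuous_on UNIV (\<lambda>t. a + centred_prim T (h \<phi>) t)"
      by (intro continuous_intros continuous_at_imp_continuous_on)
        (use centred_prim_deriv[OF h_cont T] in \<open>auto intro: DERIV_isCont\<close>)
    moreover have "norm (a + centred_prim T (h \<phi>) t) \<le> \<bar>a\<bar> + 2 * T * B" for t
      using centred_prim_le[OF h_cont h_per[OF that] h_le T, of t] by auto
    ultimately have "(\<lambda>t. a + centred_prim T (h \<phi>) t) \<in> bcontfun"
      by (rule bcontfun_normI)
    then show ?thesis by (simp add: \<Theta>_def Bcontfun_inverse)
  qed
  have maps: "\<Theta> a ` S \<subseteq> S" for a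
    using centred_prim_periodic[OF h_cont h_per T] by (auto simp: S_def[symmetric] app)
      (auto simp: S_def app[unfolded S_def])
  \<comment> \<open>One estimate serves twice: with equal parameters it is the contraction property,
    and at fixed points it gives Lipschitz dependence on the parameter with constant 2.\<close>
  have dist_\<Theta>: "dist (\<Theta> a \<phi>) (\<Theta> b \<psi>) \<le> \<bar>a - b\<bar> + 1 / 2 * dist \<phi> \<psi>"
    if "\<phi> \<in> S" "\<psi> \<in> S" for a b \<phi> \<psi>
  proof (rule dist_bound)
    fix t
    have "\<bar>centred_prim T (h \<phi>) t - centred_prim T (h \<psi>) t\<bar> \<le> 2 * T * (L * dist \<phi> \<psi>)"
      by (rule centred_prim_diff_le[OF h_cont h_per[OF that(1)] h_cont h_per[OF that(2)] h_diff T])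
    also have "\<dots> \<le> 1 / 2 * dist \<phi> \<psi>"
      using mult_right_mono[OF L, of "dist \<phi> \<psi>"] by (simp add: algebra_simps)
    finally show "dist (apply_bcontfun (\<Theta> a \<phi>) t) (apply_bcontfun (\<Theta> b \<psi>) t) \<le> \<bar>a - b\<bar> + 1 / 2 * dist \<phi> \<psi>"
      unfolding app[OF that(1)] app[OF that(2)] dist_real_def by linarith
  qed
  have "\<exists>!\<phi>. \<phi> \<in> S \<and> \<Theta> a \<phi> = \<phi>" for a
  proof (rule Banach_fix[OF complete _ _ _ maps])
    show "S \<noteq> {}" by (auto simp: S_def intro!: exI[of _ "const_bcontfun 0"])
    show "dist (\<Theta> a \<phi>) (\<Theta> a \<psi>) \<le> (1/2) * dist \<phi> \<psi>" if "\<phi> \<in> S" "\<psi> \<in> S" for \<phi> \<psi>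
      using dist_\<Theta>[OF that, of a a] by simp
  qed auto
  then obtain \<Phi> where \<Phi>: "\<And>a. \<Phi> a \<in> S" "\<And>a. \<Theta> a (\<Phi> a) = \<Phi> a" by metis
  have \<Phi>_eq: "apply_bcontfun (\<Phi> a) t = a + centred_prim T (h (\<Phi> a)) t" for a t
    using app[OF \<Phi>(1), of a a t] \<Phi>(2) by simp
  have \<Phi>_dist: "dist (\<Phi> a) (\<Phi> b) \<le> 2 * \<bar>a - b\<bar>" for a b
    using dist_\<Theta>[OF \<Phi>(1) \<Phi>(1), of a a b b] \<Phi>(2) by simp
  \<comment> \<open>The mean of the right-hand side along the fixed point, which is exactly the
    slope that the centring removes.\<close>
  define m where "m a = prim (h (\<Phi> a)) T / T" for a
  have "\<bar>m a - m b\<bar> \<le> (2 * L) * \<bar>a - b\<bar>" for a b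
  proof -
    have "\<bar>prim (h (\<Phi> a)) T - prim (h (\<Phi> b)) T\<bar> \<le> L * dist (\<Phi> a) (\<Phi> b) * T"
      using T by (intro prim_diff_le h_cont h_diff) auto
    also have "\<dots> \<le> L * (2 * \<bar>a - b\<bar>) * T"
      using \<Phi>_dist L0 T by (intro mult_right_mono mult_left_mono) auto
    finally have "\<bar>prim (h (\<Phi> a)) T - prim (h (\<Phi> b)) T\<bar> / T \<le> (2 * L) * \<bar>a - b\<bar>"
      using T by (simp add: field_simps)
    then show ?thesis using T by (simp add: m_def diff_divide_distrib[symmetric])
  qed
  then have "(2 * L)-lipschitz_on UNIV m"
    using L0 by (intro lipschitz_onI) (auto simp: dist_real_def)
  then have "continuous_on UNIV m" by (rule lipschitz_on_continuous_on)
  moreover have "apply_bcontfun (\<Phi> a) (t + T) = apply_bcontfun (\<Phi> a) t" for a t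
    using \<Phi>(1) by (simp add: S_def)
  moreover have "(apply_bcontfun (\<Phi> a) has_real_derivative g t (apply_bcontfun (\<Phi> a) t) - m a) (at t)" for a t
  proof -
    have "((\<lambda>t. a + centred_prim T (h (\<Phi> a)) t) has_real_derivative h (\<Phi> a) t - m a) (at t)"
      unfolding m_def by (auto intro!: derivative_eq_intros centred_prim_deriv h_cont T)
    moreover have "(\<lambda>t. a + centred_prim T (h (\<Phi> a)) t) = apply_bcontfun (\<Phi> a)"
      using \<Phi>_eq by auto
    ultimately show ?thesis by (simp only: h_def)
  qed
  moreover have "\<bar>apply_bcontfun (\<Phi> a) t - a\<bar> \<le> 2 * T * B" for a t
    using centred_prim_le[OF h_cont h_per[OF \<Phi>(1)] h_le T] by (simp add: \<Phi>_eq)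
  ultimately show ?thesis by (rule that)
qed

section \<open>Limit cycles in an annulus\<close>

lemma periodic_extremum:
  fixes f f' :: "real \<Rightarrow> real"
  assumes deriv: "\<And>t. (f has_real_derivative f' t) (at t)"
    and per: "\<And>t. f (t + T) = f t" and T: "T > 0"
  obtains s where "f' s = 0" "\<And>t. f t \<le> f s"
proof -
  have "continuous_on {0..T} f"
    using deriv by (intro continuous_at_imp_continuous_on) (auto intro: DERIV_isCont)
  then obtain s where s: "s \<in> {0..T}" "\<And>t. t \<in> {0..T} \<Longrightarrow> f t \<le> f s"
    using continuous_attains_sup[of "{0..T}" f] T by auto
  have max: "f t \<le> f s" for t
  proof -
    obtain k where "0 \<le> t + of_int k * T" "t + of_int k * T \<le> T"
      using reduce_to_period[OF T] .
    then have "f (t + of_int k * T) \<le> f s" by (intro s(2)) auto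
    then show ?thesis using periodic_add_int[of f T, OF per] by simp
  qed
  have "f' s = 0" using DERIV_local_max[OF deriv, of 1 s] max by auto
  then show ?thesis using that max by blast
qed

text \<open>Passes between time and angle as parameters of a closed orbit. Surjectivity is the
  intermediate value theorem on one period, after a shift of the target by a multiple of c.\<close>

lemma periodic_monotone_inverse:
  fixes f f' :: "real \<Rightarrow> real"
  assumes deriv: "\<And>t. (f has_real_derivative f' t) (at t)"
    and pos: "\<And>t. f' t > 0"
    and per: "\<And>t. f (t + T) = f t + c" and T: "T > 0"
  obtains h where "\<And>y. f (h y) = y" "\<And>t. h (f t) = t"
    "\<And>y. (h has_real_derivative 1 / f' (h y)) (at y)" "\<And>y. h (y + c) = h y + T"
proof -
  have mono: "f s < f t" if "s < t" for s t
    using that by (rule DERIV_pos_imp_increasing) (use deriv pos in blast)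
  have c: "c > 0" using mono[of 0 T] per[of 0] T by simp
  have inj: "s = t" if "f s = f t" for s t
    using mono[of s t] mono[of t s] that by (cases s t rule: linorder_cases) auto
  have shift: "f (t + of_int k * T) = f t + of_int k * c" for t k
    using periodic_add_int[of "\<lambda>t. f t - t / T * c" T t k] per T
    by (simp add: add_divide_distrib algebra_simps)
  have cont: "isCont f t" for t using deriv by (auto intro: DERIV_isCont)
  have "\<exists>t. f t = y" for y
  proof -
    obtain k where k: "0 \<le> (y - f 0) + of_int k * c" "(y - f 0) + of_int k * c \<le> c"
      using reduce_to_period[OF c] .
    have "\<exists>t\<ge>of_int (- k) * T. t \<le> of_int (- k) * T + T \<and> f t = y"
      using k shift[of 0 "- k"] per[of "of_int (- k) * T"] T cont
      by (intro IVT) auto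
    then show ?thesis by blast
  qed
  then obtain h where h: "\<And>y. f (h y) = y" by metis
  have hf: "h (f t) = t" for t using inj h by blast
  have hc: "isCont h y" for y
    using isCont_inverse_function[of 1 "h y" h f] hf cont h by auto
  have hd: "(h has_real_derivative 1 / f' (h y)) (at y)" for y
    using DERIV_inverse_function[of f "f' (h y)" h y "y - 1" "y + 1"] deriv pos[of "h y"] h hc
    by (auto simp: inverse_eq_divide)
  have "h (y + c) = h y + T" for y
    by (rule inj) (simp add: h per)
  with h hf hd show ?thesis by (rule that)
qed

text \<open>The angle is measured from the second axis, so that the unperturbed rotation increases
  it. Then \<open>om\<close> is the angular velocity, \<open>rad\<close> the time derivative of
  \<rho>, \<open>g\<close> the slope d\<rho>/d\<theta> of an orbit, \<open>psi\<close> the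
  derivative of V with respect to the angle along an orbit, and \<kappa> * \<open>Vr\<close> the
  radial derivative of V. The sign \<sigma> treats growing and decreasing \<open>psi\<close> alike.
  The periodic curves of the reduction stay within 4 * pi * B < e of their starting radius, so a
  curve that starts at distance e from a boundary circle stays in the strip of width 2 * e on which
  the sign of \<open>psi\<close> is known.\<close>

locale annulus =
  fixes F :: "real \<times> real \<Rightarrow> real \<times> real" and V Vx Vy :: "real \<Rightarrow> real \<Rightarrow> real"
    and \<kappa> a b e B L \<sigma> :: real
    and pt :: "real \<Rightarrow> real \<Rightarrow> real \<times> real" and om rad g psi Vr :: "real \<Rightarrow> real \<Rightarrow> real"
  defines "pt \<theta> \<rho> \<equiv> (\<kappa> * \<rho> * sin \<theta>, \<kappa> * \<rho> * cos \<theta>)"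
    and "om \<theta> \<rho> \<equiv> (fst (F (pt \<theta> \<rho>)) * cos \<theta> - snd (F (pt \<theta> \<rho>)) * sin \<theta>) / (\<kappa> * \<rho>)"
    and "rad \<theta> \<rho> \<equiv> (fst (F (pt \<theta> \<rho>)) * sin \<theta> + snd (F (pt \<theta> \<rho>)) * cos \<theta>) / \<kappa>"
    and "g \<theta> \<rho> \<equiv> rad \<theta> \<rho> / om \<theta> \<rho>"
    and "psi \<theta> \<rho> \<equiv> (Vx (fst (pt \<theta> \<rho>)) (snd (pt \<theta> \<rho>)) * fst (F (pt \<theta> \<rho>))
                     + Vy (fst (pt \<theta> \<rho>)) (snd (pt \<theta> \<rho>)) * snd (F (pt \<theta> \<rho>))) / om \<theta> \<rho>"
    and "Vr \<theta> \<rho> \<equiv> Vx (fst (pt \<theta> \<rho>)) (snd (pt \<theta> \<rho>)) * sin \<theta> + Vy (fst (pt \<theta> \<rho>)) (snd (pt \<theta> \<rho>)) * cos \<theta>"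
  assumes kappa: "\<kappa> > 0" and a: "a > 0" and e: "e > 0" "a + 4 * e < b"
    and F_cont: "continuous_on UNIV F"
    and V_deriv: "\<And>x y x' y' t. (x has_real_derivative x') (at t) \<Longrightarrow> (y has_real_derivative y') (at t) \<Longrightarrow>
      ((\<lambda>t. V (x t) (y t)) has_real_derivative Vx (x t) (y t) * x' + Vy (x t) (y t) * y') (at t)"
    and om_pos: "\<And>\<theta> \<rho>. a \<le> \<rho> \<Longrightarrow> \<rho> \<le> b \<Longrightarrow> om \<theta> \<rho> > 0"
    and g_lip: "\<And>\<theta> \<rho> \<rho>'. a \<le> \<rho> \<Longrightarrow> \<rho> \<le> b \<Longrightarrow> a \<le> \<rho>' \<Longrightarrow> \<rho>' \<le> b \<Longrightarrow>
      \<bar>g \<theta> \<rho> - g \<theta> \<rho>'\<bar> \<le> L * \<bar>\<rho> - \<rho>'\<bar>"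
    and L: "4 * pi * L \<le> 1 / 2"
    and g_small: "\<And>\<theta> \<rho>. a \<le> \<rho> \<Longrightarrow> \<rho> \<le> b \<Longrightarrow> \<bar>g \<theta> \<rho>\<bar> \<le> B"
    and B: "4 * pi * B < e"
    and psi_mono: "\<And>\<theta> \<rho> \<rho>'. a \<le> \<rho> \<Longrightarrow> \<rho> < \<rho>' \<Longrightarrow> \<rho>' \<le> b \<Longrightarrow> \<sigma> * psi \<theta> \<rho> < \<sigma> * psi \<theta> \<rho>'"
    and psi_low: "\<And>\<theta> \<rho>. a \<le> \<rho> \<Longrightarrow> \<rho> \<le> a + 2 * e \<Longrightarrow> \<sigma> * psi \<theta> \<rho> < 0"
    and psi_high: "\<And>\<theta> \<rho>. b - 2 * e \<le> \<rho> \<Longrightarrow> \<rho> \<le> b \<Longrightarrow> \<sigma> * psi \<theta> \<rho> > 0"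
    and Vr_pos: "\<And>\<theta> \<rho>. a \<le> \<rho> \<Longrightarrow> \<rho> \<le> b \<Longrightarrow> Vr \<theta> \<rho> > 0"
begin

definition W :: "real \<Rightarrow> real \<Rightarrow> real" where
  "W \<theta> \<rho> = V (fst (pt \<theta> \<rho>)) (snd (pt \<theta> \<rho>))"

lemma pt_periodic [simp]:
  "pt (\<theta> + 2 * pi) \<rho> = pt \<theta> \<rho>" "g (\<theta> + 2 * pi) \<rho> = g \<theta> \<rho>"
  "om (\<theta> + 2 * pi) \<rho> = om \<theta> \<rho>" "W (\<theta> + 2 * pi) \<rho> = W \<theta> \<rho>"
  by (simp_all add: pt_def g_def om_def rad_def W_def)

lemma F_polar:
  assumes "a \<le> \<rho>"
  shows "fst (F (pt \<theta> \<rho>)) = \<kappa> * (rad \<theta> \<rho> * sin \<theta> + \<rho> * om \<theta> \<rho> * cos \<theta>)"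
    "snd (F (pt \<theta> \<rho>)) = \<kappa> * (rad \<theta> \<rho> * cos \<theta> - \<rho> * om \<theta> \<rho> * sin \<theta>)"
proof -
  define F1 F2 where "F1 = fst (F (pt \<theta> \<rho>))" and "F2 = snd (F (pt \<theta> \<rho>))"
  have \<rho>: "\<rho> > 0" using assms a by simp
  have 1: "\<kappa> * rad \<theta> \<rho> = F1 * sin \<theta> + F2 * cos \<theta>"
    and 2: "\<kappa> * (\<rho> * om \<theta> \<rho>) = F1 * cos \<theta> - F2 * sin \<theta>"
    using \<rho> kappa by (simp_all add: rad_def om_def F1_def F2_def)
  have "F1 = F1 * ((sin \<theta>)\<^sup>2 + (cos \<theta>)\<^sup>2)" "F2 = F2 * ((sin \<theta>)\<^sup>2 + (cos \<theta>)\<^sup>2)" by simp_all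
  note this[unfolded power2_eq_square distrib_left]
  then have "F1 = (\<kappa> * rad \<theta> \<rho>) * sin \<theta> + (\<kappa> * (\<rho> * om \<theta> \<rho>)) * cos \<theta>"
     "F2 = (\<kappa> * rad \<theta> \<rho>) * cos \<theta> - (\<kappa> * (\<rho> * om \<theta> \<rho>)) * sin \<theta>"
    unfolding 1 2 by (simp_all only: algebra_simps)
  then show "fst (F (pt \<theta> \<rho>)) = \<kappa> * (rad \<theta> \<rho> * sin \<theta> + \<rho> * om \<theta> \<rho> * cos \<theta>)"
    "snd (F (pt \<theta> \<rho>)) = \<kappa> * (rad \<theta> \<rho> * cos \<theta> - \<rho> * om \<theta> \<rho> * sin \<theta>)"
    by (simp_all add: F1_def F2_def algebra_simps)
qed

lemma pt_deriv:
  assumes "(\<theta> has_real_derivative \<theta>') (at t)" "(\<rho> has_real_derivative \<rho>') (at t)"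
  shows "((\<lambda>t. fst (pt (\<theta> t) (\<rho> t))) has_real_derivative
            \<kappa> * (\<rho>' * sin (\<theta> t) + \<rho> t * \<theta>' * cos (\<theta> t))) (at t)"
    "((\<lambda>t. snd (pt (\<theta> t) (\<rho> t))) has_real_derivative
            \<kappa> * (\<rho>' * cos (\<theta> t) - \<rho> t * \<theta>' * sin (\<theta> t))) (at t)"
  unfolding pt_def fst_conv snd_conv using assms
  by (auto intro!: derivative_eq_intros simp: algebra_simps)

text \<open>The curve need not be an orbit: its velocity is \<theta>' times the orbit direction plus
  a radial defect. The first part changes V at the rate \<open>psi\<close> per unit of angle; the
  second, which vanishes where the slope is \<open>g\<close>, changes V at the rate \<kappa> *
  \<open>Vr\<close>.\<close>

lemma W_deriv:
  assumes "(\<theta> has_real_derivative \<theta>') (at t)" "(\<rho> has_real_derivative \<rho>') (at t)"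
    and \<rho>: "a \<le> \<rho> t" "\<rho> t \<le> b"
  shows "((\<lambda>t. W (\<theta> t) (\<rho> t)) has_real_derivative
      \<theta>' * psi (\<theta> t) (\<rho> t) + \<kappa> * (\<rho>' - \<theta>' * g (\<theta> t) (\<rho> t)) * Vr (\<theta> t) (\<rho> t)) (at t)"
proof -
  define vx vy where "vx = Vx (fst (pt (\<theta> t) (\<rho> t))) (snd (pt (\<theta> t) (\<rho> t)))"
    and "vy = Vy (fst (pt (\<theta> t) (\<rho> t))) (snd (pt (\<theta> t) (\<rho> t)))"
  define s c where "s = sin (\<theta> t)" and "c = cos (\<theta> t)"
  have om: "om (\<theta> t) (\<rho> t) \<noteq> 0" using om_pos[OF \<rho>, of "\<theta> t"] by simp
  have "psi (\<theta> t) (\<rho> t) = vx * \<kappa> * (g (\<theta> t) (\<rho> t) * s + \<rho> t * c) + vy * \<kappa> * (g (\<theta> t) (\<rho> t) * c - \<rho> t * s)"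
    using om by (simp add: psi_def F_polar[OF \<rho>(1)] g_def vx_def vy_def s_def c_def field_simps)
  then have "\<theta>' * psi (\<theta> t) (\<rho> t)
      = \<theta>' * (vx * \<kappa> * (g (\<theta> t) (\<rho> t) * s + \<rho> t * c) + vy * \<kappa> * (g (\<theta> t) (\<rho> t) * c - \<rho> t * s))"
    by simp
  then have "vx * (\<kappa> * (\<rho>' * s + \<rho> t * \<theta>' * c)) + vy * (\<kappa> * (\<rho>' * c - \<rho> t * \<theta>' * s))
     = \<theta>' * psi (\<theta> t) (\<rho> t) + \<kappa> * (\<rho>' - \<theta>' * g (\<theta> t) (\<rho> t)) * Vr (\<theta> t) (\<rho> t)"
    by (simp add: Vr_def vx_def[symmetric] vy_def[symmetric] s_def[symmetric] c_def[symmetric] algebra_simps)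
  then show ?thesis
    using V_deriv[OF pt_deriv[OF assms(1,2)]]
    by (simp add: W_def vx_def vy_def s_def c_def)
qed

lemma W_mono:
  assumes "a \<le> \<rho>" "\<rho> < \<rho>'" "\<rho>' \<le> b"
  shows "W \<theta> \<rho> < W \<theta> \<rho>'"
proof (rule DERIV_pos_imp_increasing[OF assms(2)])
  fix x assume x: "\<rho> \<le> x" "x \<le> \<rho>'"
  have "((\<lambda>t. W \<theta> t) has_real_derivative
      0 * psi \<theta> x + \<kappa> * (1 - 0 * g \<theta> x) * Vr \<theta> x) (at x)"
    by (rule W_deriv) (use x assms in auto)
  then show "\<exists>y. ((\<lambda>t. W \<theta> t) has_real_derivative y) (at x) \<and> 0 < y"
    using Vr_pos[of x \<theta>] kappa x assms by auto
qed

lemma W_inj: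
  assumes "a \<le> \<rho>" "\<rho> \<le> b" "a \<le> \<rho>'" "\<rho>' \<le> b" "W \<theta> \<rho> = W \<theta> \<rho>'"
  shows "\<rho> = \<rho>'"
proof (rule ccontr)
  assume "\<rho> \<noteq> \<rho>'"
  then consider "\<rho> < \<rho>'" | "\<rho>' < \<rho>" by linarith
  then show False using W_mono[of \<rho> \<rho>' \<theta>] W_mono[of \<rho>' \<rho> \<theta>] assms by cases simp_all
qed

lemma psi_inj:
  assumes "a \<le> \<rho>" "\<rho> \<le> b" "a \<le> \<rho>'" "\<rho>' \<le> b" "psi \<theta> \<rho> = psi \<theta> \<rho>'"
  shows "\<rho> = \<rho>'"
proof (rule ccontr)
  assume "\<rho> \<noteq> \<rho>'"
  then consider "\<rho> < \<rho>'" | "\<rho>' < \<rho>" by linarith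
  then show False using psi_mono[of \<rho> \<rho>' \<theta>] psi_mono[of \<rho>' \<rho> \<theta>] assms by cases simp_all
qed

lemma om_cont: "continuous_on (UNIV \<times> {a..b}) (\<lambda>(\<theta>, \<rho>). om \<theta> \<rho>)"
  and g_cont: "continuous_on (UNIV \<times> {a..b}) (\<lambda>(\<theta>, \<rho>). g \<theta> \<rho>)"
proof -
  have pt: "continuous_on (UNIV \<times> {a..b}) (\<lambda>z. F (pt (fst z) (snd z)))"
    unfolding pt_def by (intro continuous_on_compose2[OF F_cont] continuous_intros) auto
  have om: "continuous_on (UNIV \<times> {a..b}) (\<lambda>z. om (fst z) (snd z))"
    unfolding om_def by (intro continuous_intros pt) (use kappa a in auto)
  have rad: "continuous_on (UNIV \<times> {a..b}) (\<lambda>z. rad (fst z) (snd z))"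
    unfolding rad_def by (intro continuous_intros pt) (use kappa in auto)
  have "continuous_on (UNIV \<times> {a..b}) (\<lambda>z. g (fst z) (snd z))"
    unfolding g_def using om_pos by (intro continuous_intros om rad) (force dest: less_imp_neq)
  with om show "continuous_on (UNIV \<times> {a..b}) (\<lambda>(\<theta>, \<rho>). om \<theta> \<rho>)"
     "continuous_on (UNIV \<times> {a..b}) (\<lambda>(\<theta>, \<rho>). g \<theta> \<rho>)"
    by (simp_all add: case_prod_unfold)
qed

text \<open>The drift m of the reduced equation has to vanish for some starting radius. Its sign is
  read off from V: along a periodic curve V has a critical point, where the drift balances
  \<open>psi\<close>, so m takes the sign of \<open>psi\<close> there because \<open>Vr\<close> is
  positive.\<close>

lemma periodic_radius:
  obtains R where "\<And>\<theta>. R (\<theta> + 2 * pi) = R \<theta>"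
    "\<And>\<theta>. (R has_real_derivative g \<theta> (R \<theta>)) (at \<theta>)" "\<And>\<theta>. a < R \<theta>" "\<And>\<theta>. R \<theta> < b"
proof -
  \<comment> \<open>Clamping the radius extends \<open>g\<close> to the whole line without enlarging
    its bounds, as the contraction requires. The curves used below stay in [a, b], where nothing is
    changed.\<close>
  define cl where "cl x = max a (min b x)" for x
  have ab: "a < b" using e by linarith
  have cl: "a \<le> cl x" "cl x \<le> b" for x using ab by (auto simp: cl_def)
  have cl_lip: "\<bar>cl x - cl y\<bar> \<le> \<bar>x - y\<bar>" for x y
    unfolding cl_def max_def min_def by auto
  have L0: "0 \<le> L" using g_lip[of a b 0] ab
    by (smt (verit) mult_nonneg_nonpos2 zero_le_mult_iff abs_ge_zero)
  define G where "G \<theta> x = g \<theta> (cl x)" for \<theta> x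
  have "continuous_on UNIV (\<lambda>(\<theta>, x). G \<theta> x)"
  proof -
    have "continuous_on UNIV (\<lambda>z :: real \<times> real. (\<lambda>(\<theta>, \<rho>). g \<theta> \<rho>) (fst z, cl (snd z)))"
      unfolding cl_def by (intro continuous_on_compose2[OF g_cont] continuous_intros) (use ab in auto)
    then show ?thesis by (simp add: G_def case_prod_unfold)
  qed
  moreover have "\<bar>G \<theta> x - G \<theta> y\<bar> \<le> L * \<bar>x - y\<bar>" for \<theta> x y
  proof -
    have "\<bar>G \<theta> x - G \<theta> y\<bar> \<le> L * \<bar>cl x - cl y\<bar>"
      unfolding G_def by (rule g_lip) (use cl in auto)
    also have "\<dots> \<le> L * \<bar>x - y\<bar>" by (rule mult_left_mono[OF cl_lip L0])
    finally show ?thesis .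
  qed
  moreover have "\<bar>G \<theta> x\<bar> \<le> B" for \<theta> x unfolding G_def by (rule g_small[OF cl])
  ultimately obtain \<phi> m where \<phi>: "continuous_on UNIV m"
    "\<And>a t. \<phi> a (t + 2 * pi) = \<phi> a t"
    "\<And>a t. (\<phi> a has_real_derivative G t (\<phi> a t) - m a) (at t)"
    "\<And>a t. \<bar>\<phi> a t - a\<bar> \<le> 2 * (2 * pi) * B"
    using L by (elim periodic_solution_family[of G "2 * pi" B L]) (auto simp: G_def)
  have range: "c - e < \<phi> c t" "\<phi> c t < c + e" for c t
    using \<phi>(4)[of c t] B by auto
  have bal: "\<exists>t. psi t (\<phi> c t) = \<kappa> * m c * Vr t (\<phi> c t)"
    if c: "a + e \<le> c" "c \<le> b - e" for c
  proof -
    have in_ab: "a \<le> \<phi> c t" "\<phi> c t \<le> b" for t using range[of c t] c by auto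
    then have "G t (\<phi> c t) = g t (\<phi> c t)" for t by (simp add: G_def cl_def)
    \<comment> \<open>Since \<rho>' - \<open>g\<close> = - m on this curve, the derivative of V is
      \<open>psi\<close> - \<kappa> * m * \<open>Vr\<close>.\<close>
    then have d: "((\<lambda>t. W t (\<phi> c t)) has_real_derivative
        1 * psi t (\<phi> c t) + \<kappa> * ((g t (\<phi> c t) - m c) - 1 * g t (\<phi> c t)) * Vr t (\<phi> c t)) (at t)" for t
      using \<phi>(3)[of c t] in_ab[of t] by (intro W_deriv) auto
    show ?thesis
      by (rule periodic_extremum[OF d, of "2 * pi"]) (auto simp: \<phi>(2))
  qed
  have lo: "\<sigma> * m (a + e) < 0"
  proof (rule ccontr)
    assume *: "\<not> \<sigma> * m (a + e) < 0"
    obtain t where t: "psi t (\<phi> (a + e) t) = \<kappa> * m (a + e) * Vr t (\<phi> (a + e) t)"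
      using bal[of "a + e"] e by auto
    have "0 \<le> \<kappa> * (\<sigma> * m (a + e)) * Vr t (\<phi> (a + e) t)"
      using * range[of "a + e" t] kappa e
      by (intro mult_nonneg_nonneg[OF mult_nonneg_nonneg] less_imp_le[OF Vr_pos]) auto
    moreover have "\<sigma> * psi t (\<phi> (a + e) t) < 0"
      using range[of "a + e" t] by (intro psi_low) auto
    ultimately show False unfolding t by (simp add: algebra_simps)
  qed
  have hi: "\<sigma> * m (b - e) > 0"
  proof (rule ccontr)
    assume *: "\<not> \<sigma> * m (b - e) > 0"
    obtain t where t: "psi t (\<phi> (b - e) t) = \<kappa> * m (b - e) * Vr t (\<phi> (b - e) t)"
      using bal[of "b - e"] e by auto
    have "0 \<le> \<kappa> * (- (\<sigma> * m (b - e))) * Vr t (\<phi> (b - e) t)"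
      using * range[of "b - e" t] kappa e
      by (intro mult_nonneg_nonneg[OF mult_nonneg_nonneg] less_imp_le[OF Vr_pos]) auto
    moreover have "\<sigma> * psi t (\<phi> (b - e) t) > 0"
      using range[of "b - e" t] by (intro psi_high) auto
    ultimately show False unfolding t by (simp add: algebra_simps)
  qed
  have "\<exists>c\<ge>a + e. c \<le> b - e \<and> \<sigma> * m c = 0"
    using lo hi e \<phi>(1)
    by (intro IVT') (auto intro!: continuous_intros intro: continuous_on_subset)
  then obtain c where c: "a + e \<le> c" "c \<le> b - e" "\<sigma> * m c = 0" by blast
  then have m0: "m c = 0" using lo by auto
  have in_ab: "a < \<phi> c t" "\<phi> c t < b" for t using range[of c t] c by auto
  then have "G t (\<phi> c t) = g t (\<phi> c t)" for t using less_imp_le[OF in_ab(1)[of t]] less_imp_le[OF in_ab(2)[of t]]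
    by (simp add: G_def cl_def)
  then have "(\<phi> c has_real_derivative g t (\<phi> c t)) (at t)" for t
    using \<phi>(3)[of c t] m0 by simp
  then show ?thesis by (rule that[of "\<phi> c", OF \<phi>(2) _ in_ab])
qed

end

text \<open>The angle is obtained by integrating its velocity from a suitable initial value. It is
  the right one because the components of (x, y) / n in the frame turned by it, \<open>P\<close> and
  \<open>Q\<close> in the proof, have derivative zero and start at 0 and 1. This takes the place of
  a covering argument.\<close>

lemma polar_lift:
  fixes x y x' y' :: "real \<Rightarrow> real"
  assumes dx: "\<And>t. (x has_real_derivative x' t) (at t)"
    and dy: "\<And>t. (y has_real_derivative y' t) (at t)"
    and cont: "continuous_on UNIV x'" "continuous_on UNIV y'"
    and nz: "\<And>t. x t ^ 2 + y t ^ 2 > 0"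
  obtains \<theta> where
    "\<And>t. (\<theta> has_real_derivative (x' t * y t - y' t * x t) / (x t ^ 2 + y t ^ 2)) (at t)"
    "\<And>t. x t = sqrt (x t ^ 2 + y t ^ 2) * sin (\<theta> t)"
    "\<And>t. y t = sqrt (x t ^ 2 + y t ^ 2) * cos (\<theta> t)"
proof -
  have nz': "x t ^ 2 + y t ^ 2 \<noteq> 0" for t using nz[of t] by linarith
  define n where "n t = sqrt (x t ^ 2 + y t ^ 2)" for t
  have n: "n t > 0" "n t ^ 2 = x t ^ 2 + y t ^ 2" for t
    using nz[of t] by (auto simp: n_def)
  define w where "w t = (x' t * y t - y' t * x t) / (x t ^ 2 + y t ^ 2)" for t
  have "continuous_on UNIV x" "continuous_on UNIV y"
    using dx dy by (auto intro!: continuous_at_imp_continuous_on intro: DERIV_isCont)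
  then have w_cont: "continuous_on UNIV w"
    unfolding w_def using nz by (intro continuous_intros cont ballI nz')
  have "(x 0 / n 0)\<^sup>2 + (y 0 / n 0)\<^sup>2 = 1"
    unfolding power_divide add_divide_distrib[symmetric] n(2) using nz'[of 0] by (rule divide_self)
  then obtain t0 where t0: "x 0 / n 0 = sin t0" "y 0 / n 0 = cos t0"
    using sincos_total_2pi[of "y 0 / n 0" "x 0 / n 0"] by (metis add.commute)
  define \<theta> where "\<theta> t = t0 + prim w t" for t
  have d\<theta>: "(\<theta> has_real_derivative w t) (at t)" for t
    unfolding \<theta>_def by (auto intro!: derivative_eq_intros prim(2) w_cont)
  have w: "w t * n t ^ 2 = x' t * y t - y' t * x t" for t
    using n[of t] nz[of t] by (simp add: w_def)
  have dn: "(n has_real_derivative (x t * x' t + y t * y' t) / n t) (at t)" for t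
  proof -
    have "(n has_real_derivative (2 * (x t * x' t + y t * y' t)) / (2 * n t)) (at t)"
      unfolding n_def using nz[of t]
      by (auto intro!: derivative_eq_intros dx dy simp: inverse_eq_divide algebra_simps)
    then show ?thesis by (simp only: mult_divide_mult_cancel_left_if) simp
  qed
  define P where "P t = (x t * cos (\<theta> t) - y t * sin (\<theta> t)) / n t" for t
  define Q where "Q t = (x t * sin (\<theta> t) + y t * cos (\<theta> t)) / n t" for t
  have dP: "(P has_real_derivative 0) (at t)" for t
  proof -
    define s c where "s = sin (\<theta> t)" and "c = cos (\<theta> t)"
    have "(P has_real_derivative ((x' t * c - x t * (s * w t) - (y' t * s + y t * (c * w t))) * n t
       - (x t * c - y t * s) * ((x t * x' t + y t * y' t) / n t)) / (n t * n t)) (at t)"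
      unfolding P_def s_def c_def using n(1)[of t]
      by (auto intro!: derivative_eq_intros dx dy dn d\<theta> simp: algebra_simps)
    moreover have "(x' t * c - x t * (s * w t) - (y' t * s + y t * (c * w t))) * n t
       - (x t * c - y t * s) * ((x t * x' t + y t * y' t) / n t)
       = ((x' t * c - y' t * s) * (n t ^ 2) - (x t * s + y t * c) * (w t * n t ^ 2)
         - (x t * c - y t * s) * (x t * x' t + y t * y' t)) / n t"
      using n(1)[of t] by (simp add: field_simps power2_eq_square)
    moreover have "\<dots> = 0" unfolding w unfolding n(2) by (simp add: algebra_simps power2_eq_square)
    ultimately show ?thesis by simp
  qed
  have dQ: "(Q has_real_derivative 0) (at t)" for t
  proof -
    define s c where "s = sin (\<theta> t)" and "c = cos (\<theta> t)"
    have "(Q has_real_derivative ((x' t * s + x t * (c * w t) + (y' t * c - y t * (s * w t))) * n t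
       - (x t * s + y t * c) * ((x t * x' t + y t * y' t) / n t)) / (n t * n t)) (at t)"
      unfolding Q_def s_def c_def using n(1)[of t]
      by (auto intro!: derivative_eq_intros dx dy dn d\<theta> simp: algebra_simps)
    moreover have "(x' t * s + x t * (c * w t) + (y' t * c - y t * (s * w t))) * n t
       - (x t * s + y t * c) * ((x t * x' t + y t * y' t) / n t)
       = ((x' t * s + y' t * c) * (n t ^ 2) + (x t * c - y t * s) * (w t * n t ^ 2)
         - (x t * s + y t * c) * (x t * x' t + y t * y' t)) / n t"
      using n(1)[of t] by (simp add: field_simps power2_eq_square)
    moreover have "\<dots> = 0" unfolding w unfolding n(2) by (simp add: algebra_simps power2_eq_square)
    ultimately show ?thesis by simp
  qed
  have \<theta>0: "\<theta> 0 = t0" by (simp add: \<theta>_def prim(1)[OF w_cont])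
  have xy0: "x 0 = n 0 * sin t0" "y 0 = n 0 * cos t0"
    using t0 n(1)[of 0] by (simp_all add: field_simps)
  have "P t = 0" for t
  proof -
    have "P t = P 0" using dP by (intro DERIV_isconst_all) auto
    also have "\<dots> = 0" by (simp add: P_def \<theta>0 xy0)
    finally show ?thesis .
  qed
  then have P: "x t * cos (\<theta> t) = y t * sin (\<theta> t)" for t
    using n(1)[of t] unfolding P_def by (metis divide_eq_0_iff eq_iff_diff_eq_0 less_irrefl)
  have "Q t = 1" for t
  proof -
    have "Q t = Q 0" using dQ by (intro DERIV_isconst_all) auto
    also have "\<dots> = (sin t0)\<^sup>2 + (cos t0)\<^sup>2"
    proof -
      have "x 0 * sin t0 + y 0 * cos t0 = ((sin t0)\<^sup>2 + (cos t0)\<^sup>2) * n 0"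
        unfolding xy0 by (simp only: power2_eq_square algebra_simps)
      then show ?thesis unfolding Q_def \<theta>0 using n(1)[of 0] by simp
    qed
    finally show ?thesis by simp
  qed
  then have Q: "x t * sin (\<theta> t) + y t * cos (\<theta> t) = n t" for t
    using n(1)[of t] by (simp add: Q_def)
  have x: "x t = n t * sin (\<theta> t)" for t
  proof -
    have "n t * sin (\<theta> t) = x t * (sin (\<theta> t))\<^sup>2 + (y t * sin (\<theta> t)) * cos (\<theta> t)"
      unfolding Q[symmetric] by (simp add: algebra_simps power2_eq_square)
    also have "\<dots> = x t * ((sin (\<theta> t))\<^sup>2 + (cos (\<theta> t))\<^sup>2)"
      unfolding P[symmetric] by (simp only: algebra_simps power2_eq_square)
    finally show ?thesis by simp
  qed
  have y: "y t = n t * cos (\<theta> t)" for t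
  proof -
    have "n t * cos (\<theta> t) = (x t * cos (\<theta> t)) * sin (\<theta> t) + y t * (cos (\<theta> t))\<^sup>2"
      unfolding Q[symmetric] by (simp add: algebra_simps power2_eq_square)
    also have "\<dots> = y t * ((sin (\<theta> t))\<^sup>2 + (cos (\<theta> t))\<^sup>2)"
      unfolding P by (simp only: algebra_simps power2_eq_square)
    finally show ?thesis by simp
  qed
  show ?thesis
    using that[of \<theta>] d\<theta> x y unfolding w_def n_def by blast
qed

section \<open>The closed orbit over the periodic radius and its isolation in the ring\<close>

context annulus
begin

definition ring :: "(real \<times> real) set" where
  "ring = {z. \<kappa> * a < norm z \<and> norm z < \<kappa> * b}"

lemma norm_pt: "\<rho> > 0 \<Longrightarrow> norm (pt \<theta> \<rho>) = \<kappa> * \<rho>"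
proof -
  assume "\<rho> > 0"
  have "(\<kappa> * \<rho> * sin \<theta>)\<^sup>2 + (\<kappa> * \<rho> * cos \<theta>)\<^sup>2 = (\<kappa> * \<rho>)\<^sup>2 * ((sin \<theta>)\<^sup>2 + (cos \<theta>)\<^sup>2)"
    by (simp only: power_mult_distrib distrib_left)
  then show ?thesis using kappa \<open>\<rho> > 0\<close> by (simp add: pt_def norm_Pair)
qed

lemma pt_in_ring: "a < \<rho> \<Longrightarrow> \<rho> < b \<Longrightarrow> pt \<theta> \<rho> \<in> ring"
  using norm_pt[of \<rho> \<theta>] a kappa by (simp add: ring_def)

lemma open_ring: "open ring"
  unfolding ring_def by (intro open_Collect_conj open_Collect_less continuous_intros)

lemma orbit_of_radius:
  assumes per: "\<And>\<theta>. R (\<theta> + 2 * pi) = R \<theta>"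
    and deriv: "\<And>\<theta>. (R has_real_derivative g \<theta> (R \<theta>)) (at \<theta>)"
    and range: "\<And>\<theta>. a < R \<theta>" "\<And>\<theta>. R \<theta> < b"
  shows "periodic_orbit F (range (\<lambda>\<theta>. pt \<theta> (R \<theta>)))"
proof -
  have ab: "a \<le> R t" "R t \<le> b" for t using range[of t] by simp_all
  \<comment> \<open>Time per unit of angle. Its primitive is the time at which the orbit passes a
    given angle, and the inverse of the primitive is the angle as a function of time.\<close>
  define w where "w t = 1 / om t (R t)" for t
  have om: "om t (R t) > 0" for t by (rule om_pos[OF ab])
  then have w_pos: "w t > 0" for t by (simp add: w_def)
  have R_cont: "continuous_on UNIV R"
    using deriv by (auto intro!: continuous_at_imp_continuous_on intro: DERIV_isCont)
  have "continuous_on UNIV (\<lambda>t. (\<lambda>(\<theta>, \<rho>). om \<theta> \<rho>) (t, R t))"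
    by (intro continuous_on_compose2[OF om_cont] continuous_intros R_cont) (use ab in auto)
  then have w_cont: "continuous_on UNIV w"
    unfolding w_def using om by (intro continuous_intros) (auto simp: less_imp_neq[THEN not_sym])
  have w_per: "w (t + 2 * pi) = w t" for t by (simp add: w_def per)
  define T where "T = prim w (2 * pi)"
  obtain \<Theta> where \<Theta>: "\<And>t. prim w (\<Theta> t) = t" "\<And>\<theta>. \<Theta> (prim w \<theta>) = \<theta>"
      "\<And>t. (\<Theta> has_real_derivative 1 / w (\<Theta> t)) (at t)" "\<And>t. \<Theta> (t + T) = \<Theta> t + 2 * pi"
    using periodic_monotone_inverse[OF prim(2)[OF w_cont] w_pos
        prim_add_period[OF w_cont w_per], folded T_def] by auto
  have "prim w 0 < prim w (2 * pi)"
    by (rule DERIV_pos_imp_increasing) (use prim(2)[OF w_cont] w_pos in auto)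
  then have T: "T > 0" by (simp add: T_def prim(1)[OF w_cont])
  define z where "z t = pt (\<Theta> t) (R (\<Theta> t))" for t
  have dz: "(z has_vector_derivative F (z t)) (at t)" for t
  proof -
    define \<theta> \<rho> where "\<theta> = \<Theta> t" and "\<rho> = R (\<Theta> t)"
    have d\<Theta>: "(\<Theta> has_real_derivative om \<theta> \<rho>) (at t)"
      using \<Theta>(3)[of t] by (simp add: w_def \<theta>_def \<rho>_def)
    have dR: "((\<lambda>t. R (\<Theta> t)) has_real_derivative g \<theta> \<rho> * om \<theta> \<rho>) (at t)"
      using DERIV_chain2[OF deriv[of "\<Theta> t"] d\<Theta>] by (simp add: \<theta>_def \<rho>_def)
    have g: "g \<theta> \<rho> * om \<theta> \<rho> = rad \<theta> \<rho>" using om[of "\<Theta> t"] by (simp add: g_def \<theta>_def \<rho>_def)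
    have "a \<le> \<rho>" using ab by (simp add: \<rho>_def)
    have "((\<lambda>t. fst (z t)) has_real_derivative fst (F (z t))) (at t)"
      "((\<lambda>t. snd (z t)) has_real_derivative snd (F (z t))) (at t)"
      using pt_deriv[OF d\<Theta> dR] F_polar[OF \<open>a \<le> \<rho>\<close>, of \<theta>]
      unfolding z_def g by (simp_all add: \<theta>_def \<rho>_def)
    then have "((\<lambda>t. (fst (z t), snd (z t))) has_vector_derivative (fst (F (z t)), snd (F (z t)))) (at t)"
      unfolding has_real_derivative_iff_has_vector_derivative by (rule has_vector_derivative_Pair)
    then show ?thesis by simp
  qed
  have per_z: "z (t + T) = z t" for t by (simp add: z_def \<Theta>(4) per)
  have ne: "z (prim w 0) \<noteq> z (prim w pi)"
  proof -
    have "snd (z (prim w 0)) > 0" "snd (z (prim w pi)) < 0"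
      using kappa a range(1)[of 0] range(1)[of pi]
      by (simp_all add: z_def \<Theta>(2) pt_def zero_less_mult_iff)
    then show ?thesis by auto
  qed
  have "range (\<lambda>\<theta>. pt \<theta> (R \<theta>)) = range z"
  proof (intro set_eqI iffI; elim imageE)
    fix y \<theta> assume "y = pt \<theta> (R \<theta>)"
    then have "y = z (prim w \<theta>)" by (simp add: z_def \<Theta>(2))
    then show "y \<in> range z" by simp
  qed (auto simp: z_def)
  with T dz per_z ne show ?thesis unfolding periodic_orbit_def by blast
qed

text \<open>The competing orbit may have any period T and any winding number. It is compared with
  the known orbit at its own angle, and all that enters of its winding is that the angle advances by
  a multiple of 2 pi in time T; so the difference of the two values of V is T-periodic. Since
  \<open>psi\<close> is injective in the radius, the difference vanishes at its critical points,
  hence its maximum and its minimum are both 0.\<close>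

lemma orbit_unique:
  assumes per: "\<And>\<theta>. R (\<theta> + 2 * pi) = R \<theta>"
    and deriv: "\<And>\<theta>. (R has_real_derivative g \<theta> (R \<theta>)) (at \<theta>)"
    and range: "\<And>\<theta>. a < R \<theta>" "\<And>\<theta>. R \<theta> < b"
    and orbit: "periodic_orbit F \<Gamma>" "\<Gamma> \<subseteq> ring"
  shows "\<Gamma> = range (\<lambda>\<theta>. pt \<theta> (R \<theta>))"
proof -
  obtain z T where T: "T > 0" and dz: "\<And>t. (z has_vector_derivative F (z t)) (at t)"
    and per_z: "\<And>t. z (t + T) = z t" and \<Gamma>: "\<Gamma> = z ` UNIV"
    using orbit(1) unfolding periodic_orbit_def by blast
  define x y where "x t = fst (z t)" and "y t = snd (z t)" for t
  define F1 F2 where "F1 t = fst (F (z t))" and "F2 t = snd (F (z t))" for t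
  have dx: "(x has_real_derivative F1 t) (at t)" and dy: "(y has_real_derivative F2 t) (at t)" for t
    unfolding has_real_derivative_iff_has_vector_derivative x_def y_def F1_def F2_def
    by (rule bounded_linear.has_vector_derivative[OF bounded_linear_fst dz]
        bounded_linear.has_vector_derivative[OF bounded_linear_snd dz])+
  define n where "n t = sqrt (x t ^ 2 + y t ^ 2)" for t
  have n_norm: "n t = norm (z t)" for t
    by (simp add: n_def x_def y_def norm_prod_def)
  have n: "\<kappa> * a < n t" "n t < \<kappa> * b" for t
    using orbit(2) by (auto simp: \<Gamma> ring_def n_norm)
  have n_pos: "n t > 0" for t using n(1)[of t] kappa a by (smt (verit) mult_pos_pos)
  have n2: "x t ^ 2 + y t ^ 2 = n t ^ 2" for t by (simp add: n_def)
  have z_cont: "continuous_on UNIV z"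
    using dz by (auto intro!: continuous_at_imp_continuous_on has_vector_derivative_continuous)
  have F_cont': "continuous_on UNIV F1" "continuous_on UNIV F2"
    unfolding F1_def F2_def by (intro continuous_intros continuous_on_compose2[OF F_cont z_cont]; simp)+
  obtain \<theta> where d\<theta>': "\<And>t. (\<theta> has_real_derivative (F1 t * y t - F2 t * x t) / (x t ^ 2 + y t ^ 2)) (at t)"
    and xy: "\<And>t. x t = n t * sin (\<theta> t)" "\<And>t. y t = n t * cos (\<theta> t)"
    using polar_lift[OF dx dy F_cont'] n_pos n2 unfolding n_def by (metis zero_less_power)
  define \<rho> where "\<rho> t = n t / \<kappa>" for t
  have \<rho>: "a \<le> \<rho> t" "\<rho> t \<le> b" for t
    using n[of t] kappa by (auto simp: \<rho>_def field_simps)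
  have zpt: "z t = pt (\<theta> t) (\<rho> t)" for t
    using kappa by (simp add: pt_def \<rho>_def xy[symmetric] x_def y_def)
  have d\<theta>: "(\<theta> has_real_derivative om (\<theta> t) (\<rho> t)) (at t)" for t
  proof -
    have "(F1 t * y t - F2 t * x t) / (x t ^ 2 + y t ^ 2) = om (\<theta> t) (\<rho> t)"
    proof -
      have "om (\<theta> t) (\<rho> t) = (F1 t * cos (\<theta> t) - F2 t * sin (\<theta> t)) / n t"
        using kappa by (simp add: om_def zpt[symmetric] F1_def F2_def) (simp add: \<rho>_def)
      moreover have "(F1 t * y t - F2 t * x t) = n t * (F1 t * cos (\<theta> t) - F2 t * sin (\<theta> t))"
        by (subst xy, subst xy) (simp add: algebra_simps)
      ultimately show ?thesis unfolding n2 using n_pos[of t] by (simp add: power2_eq_square)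
    qed
    then show ?thesis using d\<theta>'[of t] by simp
  qed
  have om: "om (\<theta> t) (\<rho> t) > 0" for t by (rule om_pos[OF \<rho>])
  define c where "c = \<theta> T - \<theta> 0"
  have shift: "\<theta> (t + T) = \<theta> t + c" for t
  proof -
    have "((\<lambda>t. \<theta> (t + T) - \<theta> t) has_real_derivative 0) (at t)" for t
      using per_z[of t]
      by (auto intro!: derivative_eq_intros DERIV_chain2[OF d\<theta>'] d\<theta>' simp: F1_def F2_def x_def y_def)
    then have "\<theta> (t + T) - \<theta> t = \<theta> (0 + T) - \<theta> 0"
      by (intro DERIV_isconst_all) auto
    then show ?thesis by (simp add: c_def)
  qed
  have per_n: "n (t + T) = n t" for t by (simp add: n_norm per_z)
  obtain k :: int where k: "c = of_int k * (2 * pi)"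
  proof -
    have "x (0 + T) = x 0" "y (0 + T) = y 0" by (simp_all only: x_def y_def per_z)
    then have "sin (\<theta> 0 + c) = sin (\<theta> 0)" "cos (\<theta> 0 + c) = cos (\<theta> 0)"
      unfolding xy per_n shift using n_pos[of 0] by auto
    then obtain k :: int where "\<theta> 0 + c = \<theta> 0 + 2 * pi * of_int k"
      using sin_cos_eq_iff[of "\<theta> 0 + c" "\<theta> 0"] by auto
    then show ?thesis by (intro that[of k]) simp
  qed
  have per_R: "R (\<theta> (t + T)) = R (\<theta> t)" for t
    unfolding shift k by (rule periodic_add_int) (rule per)
  have ab: "a \<le> R t" "R t \<le> b" for t using range[of t] by simp_all
  define D where "D t = W (\<theta> t) (\<rho> t) - W (\<theta> t) (R (\<theta> t))" for t
  \<comment> \<open>The angular velocity of the competing orbit multiplies both rates, because both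
    values of V are taken at its angle.\<close>
  define D' where "D' t = om (\<theta> t) (\<rho> t) * (psi (\<theta> t) (\<rho> t) - psi (\<theta> t) (R (\<theta> t)))" for t
  have dD: "(D has_real_derivative D' t) (at t)" for t
  proof -
    have "((\<lambda>t. V (x t) (y t)) has_real_derivative Vx (x t) (y t) * F1 t + Vy (x t) (y t) * F2 t) (at t)"
      by (rule V_deriv[OF dx dy])
    moreover have "V (x t) (y t) = W (\<theta> t) (\<rho> t)" for t
      by (simp add: W_def zpt[symmetric] x_def y_def)
    moreover have "Vx (x t) (y t) * F1 t + Vy (x t) (y t) * F2 t = om (\<theta> t) (\<rho> t) * psi (\<theta> t) (\<rho> t)"
      using om[of t] by (simp add: psi_def zpt[symmetric] x_def y_def F1_def F2_def)
    ultimately have 1: "((\<lambda>t. W (\<theta> t) (\<rho> t)) has_real_derivative om (\<theta> t) (\<rho> t) * psi (\<theta> t) (\<rho> t)) (at t)"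
      by simp
    have "((\<lambda>t. R (\<theta> t)) has_real_derivative g (\<theta> t) (R (\<theta> t)) * om (\<theta> t) (\<rho> t)) (at t)"
      by (rule DERIV_chain2[OF deriv d\<theta>])
    from W_deriv[OF d\<theta> this ab]
    have 2: "((\<lambda>t. W (\<theta> t) (R (\<theta> t))) has_real_derivative
        om (\<theta> t) (\<rho> t) * psi (\<theta> t) (R (\<theta> t))) (at t)" by simp
    show ?thesis unfolding D_def D'_def
      using DERIV_diff[OF 1 2] by (simp add: algebra_simps)
  qed
  have per_D: "D (t + T) = D t" for t
    using per_z[of t] by (simp add: D_def W_def zpt[symmetric] per_R) (simp add: shift k periodic_add_int[where f = sin] periodic_add_int[where f = cos] pt_def)
  have zero: "D s = 0" if "D' s = 0" for s
  proof -
    have "psi (\<theta> s) (\<rho> s) = psi (\<theta> s) (R (\<theta> s))"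
      using that om[of s] by (simp add: D'_def)
    then have "\<rho> s = R (\<theta> s)" by (rule psi_inj[OF \<rho> ab])
    then show ?thesis by (simp add: D_def)
  qed
  have "D t \<le> 0" for t
    using periodic_extremum[OF dD per_D T] zero by metis
  moreover have "- D t \<le> 0" for t
    using periodic_extremum[OF DERIV_minus[OF dD], of T] per_D T zero
    by (metis minus_zero neg_equal_0_iff_equal)
  ultimately have "D t = 0" for t by (metis neg_le_0_iff_le order_antisym)
  then have \<rho>R: "\<rho> t = R (\<theta> t)" for t
    using W_inj[OF \<rho> ab] unfolding D_def by (metis eq_iff_diff_eq_0)
  \<comment> \<open>The angle along the orbit takes every real value, so the orbit covers the whole
    curve and not only an arc of it.\<close>
  obtain h where h: "\<And>s. \<theta> (h s) = s"
    using periodic_monotone_inverse[OF d\<theta> om shift T] by metis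
  show ?thesis
  proof (intro set_eqI iffI)
    fix p assume "p \<in> \<Gamma>"
    then show "p \<in> (\<lambda>\<theta>. pt \<theta> (R \<theta>)) ` UNIV" by (auto simp: \<Gamma> zpt \<rho>R)
  next
    fix p assume "p \<in> (\<lambda>\<theta>. pt \<theta> (R \<theta>)) ` UNIV"
    then obtain s where "p = pt s (R s)" by auto
    then have "p = z (h s)" by (simp add: zpt \<rho>R h)
    then show "p \<in> \<Gamma>" by (simp add: \<Gamma>)
  qed
qed

text \<open>The ring itself is the isolating neighbourhood of the cycle.\<close>

lemma limit_cycle_in_ring: "\<exists>\<Gamma>. limit_cycle F \<Gamma> \<and> \<Gamma> \<subseteq> ring"
proof -
  obtain R where R: "\<And>\<theta>. R (\<theta> + 2 * pi) = R \<theta>"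
    "\<And>\<theta>. (R has_real_derivative g \<theta> (R \<theta>)) (at \<theta>)" "\<And>\<theta>. a < R \<theta>" "\<And>\<theta>. R \<theta> < b"
    using periodic_radius by blast
  define \<Gamma> where "\<Gamma> = range (\<lambda>\<theta>. pt \<theta> (R \<theta>))"
  have "\<Gamma> \<subseteq> ring" using pt_in_ring[OF R(3,4)] by (auto simp: \<Gamma>_def)
  moreover have "limit_cycle F \<Gamma>"
    unfolding limit_cycle_def \<Gamma>_def
    using orbit_of_radius[OF R] orbit_unique[OF R] open_ring \<open>\<Gamma> \<subseteq> ring\<close>
    unfolding \<Gamma>_def by blast
  ultimately show ?thesis by blast
qed

end

section \<open>Integer polynomials in three variables\<close>

text \<open>Dense coefficient lists, constant term first. The coefficient operations are arguments,
  so that the same functions serve integers, polynomials in r and polynomials in r and X as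
  coefficients; evaluating them on literals decides the large identities below.\<close>

fun ladd :: "('a \<Rightarrow> 'a \<Rightarrow> 'a) \<Rightarrow> 'a list \<Rightarrow> 'a list \<Rightarrow> 'a list" where
  "ladd f [] q = q"
| "ladd f (a # p) [] = a # p"
| "ladd f (a # p) (b # q) = f a b # ladd f p q"

fun lmul :: "('a \<Rightarrow> 'a \<Rightarrow> 'a) \<Rightarrow> ('a \<Rightarrow> 'a \<Rightarrow> 'a) \<Rightarrow> 'a \<Rightarrow> 'a list \<Rightarrow> 'a list \<Rightarrow> 'a list" where
  "lmul f g z [] q = []"
| "lmul f g z (a # p) q = ladd f (map (g a) q) (z # lmul f g z p q)"

fun lder :: "('a \<Rightarrow> 'a \<Rightarrow> 'a) \<Rightarrow> 'a \<Rightarrow> 'a list \<Rightarrow> 'a list" where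
  "lder f z [] = []"
| "lder f z (a # p) = ladd f p (z # lder f z p)"

fun lev :: "('a \<Rightarrow> real) \<Rightarrow> real \<Rightarrow> 'a list \<Rightarrow> real" where
  "lev e x [] = 0"
| "lev e x (a # p) = e a + x * lev e x p"

lemma lev_ladd:
  assumes "\<And>a b. e (f a b) = e a + e b"
  shows "lev e x (ladd f p q) = lev e x p + lev e x q"
proof (induction p arbitrary: q)
  case (Cons a p)
  then show ?case by (cases q) (auto simp: assms algebra_simps)
qed simp

lemma lev_map:
  assumes "\<And>a. e (h a) = c * e a"
  shows "lev e x (map h p) = c * lev e x p"
  by (induction p) (auto simp: assms algebra_simps)

lemma lev_lmul:
  assumes "\<And>a b. e (f a b) = e a + e b" "\<And>a b. e (g a b) = e a * e b" "e z = 0"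
  shows "lev e x (lmul f g z p q) = lev e x p * lev e x q"
  by (induction p) (auto simp: assms lev_ladd lev_map algebra_simps)

lemma lev_lder:
  assumes "\<And>a b. e (f a b) = e a + e b" "e z = 0"
  shows "((\<lambda>x. lev e x p) has_real_derivative lev e x (lder f z p)) (at x)"
  by (induction p) (auto intro!: derivative_eq_intros simp: assms lev_ladd)

type_synonym poly1 = "int list"
type_synonym poly2 = "int list list"
type_synonym poly3 = "int list list list"

definition add1 :: "poly1 \<Rightarrow> poly1 \<Rightarrow> poly1" where "add1 = ladd (+)"
definition mul1 :: "poly1 \<Rightarrow> poly1 \<Rightarrow> poly1" where "mul1 = lmul (+) (*) 0"
definition add2 :: "poly2 \<Rightarrow> poly2 \<Rightarrow> poly2" where "add2 = ladd add1"
definition mul2 :: "poly2 \<Rightarrow> poly2 \<Rightarrow> poly2" where "mul2 = lmul add1 mul1 []"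
definition add3 :: "poly3 \<Rightarrow> poly3 \<Rightarrow> poly3" where "add3 = ladd add2"
definition mul3 :: "poly3 \<Rightarrow> poly3 \<Rightarrow> poly3" where "mul3 = lmul add2 mul2 []"
definition derx :: "poly3 \<Rightarrow> poly3" where "derx = map (lder add1 [])"
definition dery :: "poly3 \<Rightarrow> poly3" where "dery = lder add2 []"

definition ev1 :: "real \<Rightarrow> poly1 \<Rightarrow> real" where "ev1 r = lev of_int r"
definition ev2 :: "real \<Rightarrow> real \<Rightarrow> poly2 \<Rightarrow> real" where "ev2 r x = lev (ev1 r) x"
definition ev3 :: "real \<Rightarrow> real \<Rightarrow> real \<Rightarrow> poly3 \<Rightarrow> real" where "ev3 r x y = lev (ev2 r x) y"

lemma ev1_add [simp]: "ev1 r (add1 p q) = ev1 r p + ev1 r q"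
  unfolding ev1_def add1_def by (rule lev_ladd) simp

lemma ev1_mul [simp]: "ev1 r (mul1 p q) = ev1 r p * ev1 r q"
  unfolding ev1_def mul1_def by (rule lev_lmul) simp_all

lemma ev1_Nil [simp]: "ev1 r [] = 0" by (simp add: ev1_def)
lemma ev1_Cons [simp]: "ev1 r (a # p) = of_int a + r * ev1 r p" by (simp add: ev1_def)
lemma ev2_Nil [simp]: "ev2 r x [] = 0" by (simp add: ev2_def)
lemma ev2_Cons [simp]: "ev2 r x (a # p) = ev1 r a + x * ev2 r x p" by (simp add: ev2_def)
lemma ev3_Nil [simp]: "ev3 r x y [] = 0" by (simp add: ev3_def)
lemma ev3_Cons [simp]: "ev3 r x y (a # p) = ev2 r x a + y * ev3 r x y p" by (simp add: ev3_def)

lemma ev2_add [simp]: "ev2 r x (add2 p q) = ev2 r x p + ev2 r x q"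
  unfolding ev2_def add2_def by (rule lev_ladd) simp

lemma ev2_mul [simp]: "ev2 r x (mul2 p q) = ev2 r x p * ev2 r x q"
  unfolding ev2_def mul2_def by (rule lev_lmul) simp_all

lemma ev3_add [simp]: "ev3 r x y (add3 p q) = ev3 r x y p + ev3 r x y q"
  unfolding ev3_def add3_def by (rule lev_ladd) simp

lemma ev3_mul [simp]: "ev3 r x y (mul3 p q) = ev3 r x y p * ev3 r x y q"
  unfolding ev3_def mul3_def by (rule lev_lmul) simp_all

lemma ev2_lder: "((\<lambda>x. ev2 r x p) has_real_derivative ev2 r x (lder add1 [] p)) (at x)"
  unfolding ev2_def by (rule lev_lder) simp_all

text \<open>Together with \<open>low3\<close>, vanishing to order n at the origin in X and Y
  jointly: passing to the cofactor of X or Y lowers the required order by one. The zero test is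
  entrywise because the list operations leave explicit zeros behind.\<close>

fun low2 :: "nat \<Rightarrow> poly2 \<Rightarrow> bool" where
  "low2 0 p = True"
| "low2 (Suc n) [] = True"
| "low2 (Suc n) (a # p) = (list_all (\<lambda>c. c = 0) a \<and> low2 n p)"

fun low3 :: "nat \<Rightarrow> poly3 \<Rightarrow> bool" where
  "low3 0 p = True"
| "low3 (Suc n) [] = True"
| "low3 (Suc n) (a # p) = (low2 (Suc n) a \<and> low3 n p)"

section \<open>The homological equation and its data\<close>

definition KX :: poly3 where "KX = [[[], [2], [-6], [4]], [], [], [[-8]]]"
definition KY :: poly3 where "KY = [[], [[2]], [[12], [-24]], [[0, 32]]]"
definition RR :: poly3 where "RR = [[[], [], [1]], [], [[1]]]"

fun radial :: "poly1 list \<Rightarrow> poly3" where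
  "radial [] = []"
| "radial (b # bs) = mul3 RR (add3 [[b]] (radial bs))"

definition neg3 :: "poly3 \<Rightarrow> poly3" where "neg3 = mul3 [[[-1]]]"

text \<open>One coefficient family contributes K_Y G - (W_X K_Y - W_Y K_X) to the first-order part
  of dV/dt. This is what remains of the contribution when its radial part is taken away.\<close>

definition resid :: "poly3 \<Rightarrow> poly3 \<Rightarrow> poly1 list \<Rightarrow> poly3" where
  "resid G W bs = add3 (add3 (mul3 KY G) (mul3 KX (dery W))) (neg3 (add3 (mul3 KY (derx W)) (radial bs)))"

text \<open>The data below are S G and S W for a common denominator S of W. They solve the
  homological equation {W, K} = K_Y G - (radial part) degree by degree, for the perturbation
  (0, 2 G) that belongs to each single coefficient of the divergence; in the families c10, c01
  and c20 the coefficients c02 and c11 are eliminated by the two linear relations of the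
  theorem. A polynomial is stored as the list of its Y-coefficients, these as lists of
  X-coefficients, these as lists of r-coefficients.\<close>

definition G_c10 :: poly3 where "G_c10 =
  [[],
   [[],[738017280]],
   [[],[-35240325120,8856207360]],
   [[-738017280]]]"

definition W_c10 :: poly3 where "W_c10 =
  [[[],[],[],[],[-7703055360,2214051840],[18880942080,-5313724416],[113962168320,-3198074880,
   -11808276480],[-579350593536,23068311552,54655451136],[-5203833643008,-2683012620288,
   1114110885888,141699317760],[48695338605056,15229770276864,-8022055714816,-960856326144],
   [535810375406592,329599958138880,-30175713165312,-43828273741824,-2267189084160],
   [-6605142781389568,-3399216231131136,581045591113728,407731192201216,20159334973440],
   [-83965225046139008,-64509960184310784,-1655302928547840,7026154223435776,1467429137940480,
   42320862904320],[1269051623167473152,914875501317487872,-32519953811160576,-95641830334029824,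
   -16750267261255680,-464557084508160],[19456878685684427520,16611248901307067904,
   1916980092253903872,-1590974520742723584,-488072898272034816,-46916249069813760,
   -870600608317440]],
   [[],[],[],[],[],[],[],[-1249641993600,509693184000],[-3748925980800,1529079552000],
    [43837076162880,30359747658240,-16812402647040],[139009080450240,88021083870720,
    -50437207941120],[-1660839999698880,-4707520398060480,679501141038720,437066102753280],
    [-5260538159997120,-14298603361922880,2139377838998400,1311198308259840],[292138853792340555,
    133705288718181180,326224972490376960,-119260942216416000,-9911099554836480]],
   [[],[],[-15406110720,4428103680],[984023040],[375650795520,-18450432000,-35424829440],
    [-902742736896,25387794432,85019590656],[-24274864373760,-10618986233856,4782351974400,
    566797271040],[148109916075264,36626231955456,-21922233974784,-2623461654528],
    [3171931354006272,1779116459028480,-226209971699712,-228145348214784,-11335945420800],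
    [-27108711067774336,-13431592358046720,2560965303975936,1563332435771392,76868506091520],
    [-591461346188169600,-430912771098061824,-1796501715959808,47303213344358400,9057852236759040,
    253925177425920],[6528668934159615360,4680815629985579136,-221891135528375040,
    -482888922009661440,-81856917500067840,-2257845517025280],[156967080294646177920,
    131183014741302336384,12756780242624121600,-12680094837916766208,-3680196744877965312,
    -335695130394624000,-6094204258222080]],
   [[-246005760],[-738017280],[-63346483200,17712414720],[123494891520,-35424829440],
    [1487104819200,-73801728000,-141699317760],[-11213696317824,2118029641728,623476998144],
    [-113651956209792,-32994876794880,18449251172352,2267189084160],[943662474158976,
    392503981089792,-204405630713856,-15028224786432],[12484830254747136,7580632742572032,
    -1132959678529536,-891593699622912,-45343781683200],[-141248523233920960,-93092501579837760,
    15085843859898240,10555200444405760,398161587732480],[-2194296501577440832,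
    -1750306713926037696,-9212314001404800,189381110871107584,35616460898304000,1015700709703680],
    [32701946085374815860,22787996370946883856,1339155622143815424,-3079121754139591680,
    -465964484926586880,-11062783487508480]],
   [[],[2952069120],[384507002880,-141699317760],[19188449280,-15744368640],[-37123745218560,
    -12957221781504,7096774164480,566797271040],[134661499644672,14385691127808,-16427674238976,
    -1360313450496],[6802100425486080,3468936849371136,-601752918294528,-425853682974720,
    -18137512673280],[-40179595799566080,-17715323686275072,4311072821772288,1953863552729088,
    83950772944896],[-1611850981493575680,-1115402394667511808,22510032687267840,
    123764302858420224,21179626986405888,544125380198400],[13167210692729258880,
    9190613465448967552,-688183736597111040,-927781757352333312,-143795371255005184,
    -3689688292392960],[513585032118223877760,419214624399597586560,33081056128448310528,
    -41140997477833863168,-11177080199646806016,-948806108200304640,-16251211355258880]],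
   [[-20024868864,4723310592],[-17712414720],[2974209638400,-157050077184,-283398635520],
    [-12176875751040,2558441453568,566797271040],[-344251893009024,-108325161584640,
    57955020963840,6801567252480],[1972736235550080,688588388167680,-381004963282944,
    -29926895910912],[54781711174379904,30838254651629568,-4870913752793088,-3680252467347456,
    -181375126732800],[-448418331397662912,-266272647480537984,48209433012119808,
    29744806736646144,1202257982914560],[-12398773352599178688,-9258980995038348288,
    65984846551962624,1010115067649605632,182359302718095360,5078503548518400],
    [136351276989090629895,94972126589978885676,1342148507072191104,-11726765279638066944,
    -1790097567067729920,-44594097826037760]],
   [[],[506771865600,-141699317760],[-17774408171520,-5209811582976,3967580897280],
    [-7109962379520,-4361571422208,2519098982400],[6224117187974400,2862960430387200,
    -666326871834624,-335732916879360,-9068756336640],[-20447466729600768,-6228078130999296,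
    2093923881713664,735224229003264,21765015207936],[-2134370584208115968,-1388010465090822144,
    68971476904771584,156117985369522176,23093084191457280,483667004620800],[11942574887256993408,
    8039774520921851136,-1000273208299402752,-755846845288144896,-104719088646881280,
    -2238687278530560],[876388530716528668800,693800495479942346496,40171827097652030976,
    -69471084447151595520,-17377597387639357440,-1337327176101396480,-20314014194073600]],
   [[1510615941120,-577368489984],[-1790989200000,623901358080],[-332445803234688,-89657040844800,
    56774193315840,4534378168320],[1237291956590976,252633506171904,-204482201763840,
    -9068756336640],[85468306959015552,43561171211830272,-8346034717802496,-5119312952033280,
    -217650152079360],[-495668638602865728,-269070278624484480,62818497121146624,
    27513286375550976,957660669149184],[-26490345589457280960,-18724113552736116096,
    531651615166653696,2056167844739813376,339831692451643392,8706006083174400],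
    [218348858568581659776,148049540285046985728,-2680382664618227712,-17836680081298231296,
    -2467725662657249280,-57708383179898880]],
   [[],[-31551311151360,4314559721472,2267189084160],[2009002733008128,817341564948480,
    -257288174567424,-90687563366400],[1913086624171008,2858806261149696,-955450750205952,
    -112855634411520],[-1362402664642631040,-817111704067236864,70989986898395136,
    93298760607596544,11393380877598720,145100101386240],[3648441496702434432,2416855585380268032,
    -623612263967447040,-140807100625551360,-22604177460953088,-348240243326976],
    [819253367071507465344,623471965149934627584,20322805632487527936,-63897210795242692608,
    -14403430083597434880,-969317043960545280,-11608008110899200]],
   [[-96900360237824,-16484167118848,17348194992128],[136723296790080,-24023426499072,
    -6773153587200],[55197010599290560,24513781708196352,-6314907331239936,-2758413385728000,
    -72550050693120],[-198126737433996800,-94938258117193920,32174039583244416,7697686868551680,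
    145100101386240],[-26820697096386152960,-17759376001571290944,1060037938566262656,
    1968963081735936000,280164112426598400,5804004055449600],[158060928949754823993,
    102052912190647389972,-6069402748602226176,-12217144911231346944,-1359377811020156928,
    -25537617843978240]],
   [[],[2668073187821184,1242391553694720,-652929053736960,-36275025346560],[-332822743157224320,
    -178938452859319296,24893256791310336,20667091107446784,1886301318021120],
    [-837526157222726400,-388785261129133440,-80497567751268096,101200149144686592,
    3546891367219200],[395925982779033707520,286238958705642433920,290430321596483328,
    -30099772308979077120,-5916127740460793856,-328554996238909440,-2321601622179840]],
   [[12170093433786496,4389426153335808,-1685541298421760,-435300304158720],[-14018246038203264,
    -4731057916453440,3504761186838912,-111045493278720],[-12792586259842586496,
    -7767485524562073024,808035202555950720,871567262503421952,96951051076239360,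
    1160800811089920],[46009632879626907660,27588953897569954032,-3489482194342460160,
    -3234709437739772928,-224090360732958720,-2321601622179840]],
   [[],[-451374634857386240,-207437574253193856,33256985150408448,30266351202447360,
    580400405544960],[76979809495666771200,52005773964551282304,-2041272148576018176,
    -5625918955789037568,-912379764176584704,-37145625954877440]],
   [[-2269564568331759360,-1221626244673479040,206226806751174912,137542067922063360,
    9866806894264320],[2403649020871383285,1301731324122586500,-445010825494654848,
    -115353881268417792,8205425014026240]]]"

definition b_c10 :: "int list list" where "b_c10 =
  [[],
   [],
   [],
   [-2499283987200,1019386368000],
   [105169140236160,53583790740480,-33624805294080],
   [-3980386177447680,-9821728308712320,1594375919136000,874132205506560],
   [609197576545868310,334372116015657720,642331682510918400,-244640809871377920,
    -19822199109672960]]"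

definition G_c01 :: poly3 where "G_c01 =
  [[],
   [],
   [[23063040],[138378240,1845043200]],
   [[92252160]]]"

definition W_c01 :: poly3 where "W_c01 =
  [[[],[],[],[15375360],[0,461260800],[-64576512,-1205428224],[-322882560,-6519152640,
   -2460057600],[1876672512,35663806464,12736069632],[14760345600,309155438592,269277904896,
   29520691200],[-142939230720,-2924429054976,-2025759031296,-224169820160],[-1500240208896,
   -31839317452800,-30923612848128,-9188525998080,-472331059200],[18777441386496,394021540423680,
   347797573373952,89545853829120,4688413982720],[236056204640256,5031965260827648,
   5600088871483392,2085409172520960,296629903032320,8816846438400],[-3595830239317536,
   -76194044659461696,-81482371797193728,-27248460547384320,-3573948194406400,-107606043525120],
   [-54742334423604672,-1171309622611140480,-1399153024344631296,-608920227631233024,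
   -115388104548188160,-9375811601694720,-181375126732800]],
   [[],[],[],[],[],[],[],[2508105600,62443180800,-6457651200],[7524316800,187329542400,
    -19372953600],[-97124227200,-2307353368320,-2240297579520,139485265920],[-306421315200,
    -7296719189760,-6682146831360,418455797760],[3976762509720,95570354159280,266154757989120,
    48599717886720,-2217557422080],[12543130159560,301304500857360,811828567630080,
    144962242064640,-6652672266240],[-627902119799955,-15262684290543690,-12265405909356600,
    -20455350770574720,-285680608012800,25061959802880]],
   [[],[23063040],[69189120,922521600],[0,-246005760],[-1107025920,-22140518400,-7380172800],
    [3247276032,58893778944,22435725312],[70997262336,1457584128000,1159179141120,118082764800],
    [-436729303296,-8904965921280,-5683249668096,-654515896320],[-8953383479040,-188826653283840,
    -173986171527168,-48142343208960,-2361655296000],[77289235795200,1618448444321280,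
    1402294638311424,349384198225920,18701311016960],[1666111702185216,35424790204497408,
    38155389486888960,13656892316221440,1840606661836800,52901078630400],[-18529139920598736,
    -392223816561651360,-417973837497715200,-136843085005785600,-17746245900165120,
    -540736047022080],[-442115984131399344,-9446688388371932256,-11124303461879342592,
    -4700284633068430848,-864636682861486080,-67358691510190080,-1269625887129600]],
   [[],[92252160],[92252160,3690086400],[-553512960,-8364195840],[-4428103680,-86594027520,
    -29520691200],[31041698688,641657592576,125106229248],[305664847488,6545606715648,
    4334535389184,472331059200],[-2672833692672,-55675344890880,-42706544584704,-2911794462720],
    [-34510227028992,-735946548480000,-704607459139584,-183985599283200,-9446621184000],
    [398913323694600,8421673873675920,8399423825844480,2064862222874880,81132327710720],
    [6155074436140344,131372351202638832,148953840353480448,53252209407471360,7148506993971200,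
    211604314521600],[-91410145202027652,-1948720152928716024,-2043493376314659360,
    -790089652884480000,-87745949355816960,-2419073085112320]],
   [[],[],[-1107025920,-22140518400],[738017280,5904138240,3936092160],[110923997184,
    2240620462080,1594117324800,118082764800],[-406645214976,-8165437023744,-4240425885696,
    -434544574464],[-19308420907776,-405159436611072,-354092203745280,-89207592714240,
    -3778648473600],[115304571892224,2401757901683712,1966289291366400,448316482977792,
    22671890841600],[4547738723134464,96468098880890880,100679968835297280,34431301131042816,
    4309548584140800,113359454208000],[-37468024956476400,-791399991584099040,-829398441651985920,
    -257828359983287808,-32015446383697920,-940655551447040],[-1447748984767335120,
    -30893505410124807840,-35814835353783163392,-14673343186201250304,-2598524630886113280,
    -190886524747776000,-3385669032345600]],
   [[73801728,1476034560],[],[-9003810816,-177124147200,-59041382400],[35379856512,715703788800,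
    133888634880],[968353626240,20238198140160,13833949409280,1416993177600],[-5714319042432,
    -117553816283904,-84123342471168,-6700606488576],[-153610223614848,-3247840089711360,
    -2986496076275712,-770026565468160,-37786484736000],[1275050579712624,26788932869748192,
    25313370088241664,6119077491850752,273582531256320],[34890076768966848,742325889279401856,
    809406069186604032,283082899552966656,36919978858414080,1058021572608000],
    [-383649566915926311,-8151611151254812098,-8546173308322996632,-3091391915005350528,
    -357732304473223680,-10443393841520640]],
   [[],[-1476034560,-29520691200],[54022864896,1080457297920,708496588800],[7926766848,
    267031564800,179707207680,-62977474560],[-17807030841600,-371242920761856,-306642366750720,
    -68015672524800,-1889324236800],[59318570158848,1224452298161664,865200462077952,
    187921635213312,8564936540160],[6033213591085824,127629500813827584,128296161491976192,
    41459549505454080,4672928612352000,100763959296000],[-34147670710117536,-718707131330101056,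
    -736637497401940992,-207925105013683200,-24773849208176640,-659859984875520],
    [-2472256282742459616,-52677149703720125376,-59858088377053824000,-23645305039561620480,
    -3980171041863843840,-269126428325314560,-4232086290432000]],
   [[-4470276096,-88140349440],[6348101760,114680966400,6457651200],[959532013440,19709781062400,
    12587069214720,944662118400],[-3629432911104,-73870485511680,-43603075676160,-2725251809280],
    [-241217663461632,-5073053476068864,-4420460338145280,-1066693275648000,-45343781683200],
    [1418384905196688,29648987562164256,26683779094562304,5780769726251520,250887129292800],
    [74676356038730160,1584998643087741024,1671746290469798400,561860035030255104,
    69004251468472320,1813751267328000],[-616372527012473088,-13064194231098506496,
    -13472507610565166592,-4614267443767787520,-508532461471457280,-14743671470161920]],
   [[],[87079120128,1803460538880,433585152000],[-5807976894720,-120040499943936,-92861393264640,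
    -17003918131200],[-5341916676096,-114172691263488,-184236788736000,-6051741696000,
    1007639592960],[3857825986020864,81360476163293184,77974604669085696,23429791783157760,
    2267189084160000,30229187788800],[-10602568082950272,-221191843885638912,-224333494559336448,
    -46974608467218432,-6919214882291712,-169283451617280],[-2312639582987252064,
    -49191038495415051456,-54489619033562059776,-20572664169781840896,-3235231033681920000,
    -194393830273843200,-2418335023104000]],
   [[283291776768,5749186606592,3112013864960],[-407793754368,-8177877227520,-2241312353280,
    -242807685120],[-156493799844096,-3274173532591104,-2651633515914240,-557730728755200,
    -15114593894400],[572376081416568,11874266090619504,10000229841888000,1678221900875520,
    64369067642880],[75709933286799240,1602818592406306704,1624881700033363200,513954037180995840,
    56670008707952640,1209167511552000],[-447505990165595361,-9457249477813163598,
    -9467586893851480680,-3007654751754626688,-291079635462680064,-7954506088488960]],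
   [[],[-7751741437440,-159296720394240,-127439993640960,-5480516321280],[943856324116992,
    19836103352592384,17857344842827776,4835080356986880,362750253465600],[2283378456264048,
    48798599755647456,40348043581367808,17426197296668160,-24634647797760,-16122233487360],
    [-1118325277028993904,-23738862299295907296,-25450300218677368320,-9065149257385188864,
    -1296313882934353920,-65295045623808000,-483667004620800]],
   [[-34631067274752,-720187166300160,-525292641269760,-83338387292160],[41808670623720,
    849459217443408,613765394161920,21120774554880,6102480384000],[36144590371729944,
    762983711789273520,734435412090302208,212525120629635840,19365595864043520,241833502310400],
    [-130844514115445052,-2753273613122764680,-2638026221771177952,-737406893572577280,
    -54866452173711360,-1523356720005120]],
   [[],[1272914936346768,26715507875545632,21979031377205760,5579204291781120,51073378836480],
    [-217536480960359184,-4606595319400607520,-4733810372489882112,-1561206173655937536,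
    -193652500582195200,-7255005069312000]],
   [[6415262144047344,134964042618738912,121139776109975040,30620421428989440,1941293188423680],
    [-6979911632821413,-144986528898456102,-131296953646060488,-22502433996282240,
    -374214959838720,-122701645946880]]]"

definition b_c01 :: "int list list" where "b_c01 =
  [[],
   [],
   [],
   [5016211200,124886361600,-12915302400],
   [-229361932800,-5488911267840,-4390188042240,278970531840],
   [9403556001840,225691609983840,563441206648320,95246642050560,-4435114844160],
   [-1315155970518390,-31950914169594420,-28337164192537200,-41586076121990400,-540315412116480,
    50123919605760]]"

definition G_c20 :: poly3 where "G_c20 =
  [[],
   [[],[],[738017280]],
   [[],[-8671703040,2952069120]],
   [[-246005760]]]"

definition W_c20 :: poly3 where "W_c20 =
  [[[],[],[],[],[-2167925760,738017280],[5793435648,-1771241472],[31550238720,738017280,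
   -3936092160],[-170629595136,-6958448640,18218483712],[-1462504243200,-791326728192,
   302488682496,47233105920],[13887258491392,5041455783936,-2094975680512,-320285442048],
   [150066448536576,95967599050752,-6989206388736,-12751589081088,-755729694720],
   [-1861314947771136,-1022884680050688,131935576621056,117111030546432,6719778324480],
   [-23545036638085248,-18625294584179712,-737407516065792,2009459167592448,440356495687680,
   14106954301440],[356908285244335104,266894697245511936,-3435139003842048,-26742447786762240,
   -4997382521487360,-154852361502720],[5457767998616104704,4788005464697734656,
   612046076043697152,-450516916353613824,-144287460992483328,-14344940452577280,
   -290200202772480]],
   [[],[],[],[],[],[],[],[-320201481600,163747584000],[-960604444800,491242752000],
    [11294480957760,6386547847680,-5425534033920],[35804651762880,18177158039040,-16276602101760],
    [-426685719620160,-1157974109772480,318979515254400,142508092446720],[-1351666462386240,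
    -3510276645395520,989491749966720,427524277340160],[74946658237365915,26364330212760540,
    76198071636086400,-41002852777286400,-3263294881566720]],
   [[],[],[-4335851520,1476034560],[1476034560],[107750522880,-738017280,-11808276480],
    [-276904083456,-26568622080,28339863552],[-6896230268928,-3243536744448,1318590873600,
    188932423680],[42357780571392,13009078038528,-5528297668608,-874487218176],[891198044934912,
    525352302858240,-54168106696704,-66759271907328,-3778648473600],[-7648353639079296,
    -4075826987781120,574197946662912,445581826719744,25622835363840],[-165997676835619200,
    -125029953074138112,-2593515043012608,13527019029528576,2726564777164800,84641725808640],
    [1837207530859479168,1367877326848975488,-31257344547336960,-134136017178808320,
    -24354537728901120,-752615172341760],[44047993936562408832,37869730139579345280,
    4195737528749894400,-3583080504070778880,-1088528969688416256,-102841712136683520,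
    -2031401419407360]],
   [[],[-246005760],[-18081423360,5904138240],[38868910080,-11808276480],[415503728640,
    -2952069120,-47233105920],[-3151318794624,500037457920,207825666048],[-31469014921344,
    -9650393905152,5047644585984,755729694720],[265109643207552,114010904257536,-57981076488192,
    -5009408262144],[3479003463716352,2159783600173056,-302658862252032,-260041189883904,
    -15114593894400],[-39632331418954560,-26736207976695360,4273644570349440,3123947339335680,
    132720529244160],[-614444688645957312,-500569441810097088,-6118727321486208,54676156185311232,
    10701276425748480,338566903234560],[9152822625341757492,6579970617704269968,
    421727748628103424,-909657092648199168,-140985968343367680,-3687594495836160]],
   [[],[],[109964574720,-35424829440],[-16236380160,-23616552960],[-10612983693312,-4108099387392,
    1995598725120,188932423680],[38957522123520,7430542479360,-3882561306624,-453437816832],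
    [1915371399921408,1037032257490944,-149297550065664,-125577084272640,-6045837557760],
    [-11366027137251072,-5499513916655616,960065551171584,551315608436736,27983590981632],
    [-452679603029102592,-325038223882285056,430622961500160,35443080312127488,6402390827728896,
    181375126732800],[3708935305775905920,2696015436924830592,-125857702182600960,
    -255490888625516544,-42670888109211648,-1229896097464320],[144165470879778042240,
    121191021610544605824,11322367600749513984,-11618860721450471424,-3309950315003904000,
    -291440463162900480,-5417070451752960]],
   [[-7232569344,2361655296],[],[855804837888,-10627448832,-94466211840],[-3491574742656,
    511144617984,188932423680],[-96722207277696,-33102934824960,16012022906880,2267189084160],
    [559118915042688,213385814433792,-104014088994816,-9975631970304],[15348869668319616,
    8983069720694784,-1251728377675776,-1078123982487552,-60458375577600],[-126231662411135424,
    -78141785236175232,12554907111901440,8667200338587648,400752660971520],[-3477287153107804608,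
    -2671227527047732224,-14093746944076800,290401901904052224,54932048204267520,
    1692834516172800],[38254521811691912727,27605401364318577228,775390824950556672,
    -3386148592458348288,-537418993742991360,-14864699275345920]],
   [[],[144651386880,-47233105920],[-5134829027328,-1695668502528,1133594542080],[-1478804431104,
    25424695296,1133594542080],[1757601105511680,868257521184768,-171437281247232,-99945252126720,
    -3022918778880],[-5814146416396032,-2126119015747584,389989585649664,197547742199808,
    7255005069312],[-599879733507774720,-406576807690420224,11569025082261504,44874171250900992,
    7019217404559360,161222334873600],[3369995019710706816,2374121640816896256,
    -209979279700489728,-203472061237665792,-30863137041285120,-746229092843520],
    [246075199742021440128,200916034749315515136,14753839110332395008,-19637314392022179840,
    -5157601961029140480,-412201174129704960,-6771338064691200]],
   [[433026367488,-146422628352],[-547706839680,119651051520],[-94119988989312,-28482709432320,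
    15964789800960,1511459389440],[352920393910656,88827165453312,-54199743037440,-3022918778880],
    [24008780793089664,12878248385553408,-2143198406688768,-1509947930050560,-72550050693120],
    [-139891754022546240,-80164088788088448,16032540277847808,7935381465403392,319220223049728],
    [-7435411155786144960,-5430873844998695808,69396556210046208,590862222323822592,
    102757473466712064,2902002027724800],[61333944480106556544,43230523853521585152,
    16567753890834432,-5094984275187535872,-737731316016414720,-19236127726632960]],
   [[],[-8838497251584,1067505094656,755729694720],[569101588653312,252096312619008,
    -68658042765312,-27206269009920],[526363907097600,730961840074752,-335531585765376,
    -42320862904320],[-383194592654620032,-240902571402814464,15139169975255040,26989828025352192,
    3485425352048640,48366700462080],[1035625255966274688,725428092230240256,-140586994681436160,
    -31032402400935936,-6333619425509376,-116080081108992],[230094595075871760000,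
    180929019639949231872,8916186465661343232,-18104427479176077312,-4290098117077893120,
    -300050887433256960,-3869336036966400]],
   [[-27569123296000,-5610498150400,5021403971584],[39495092180544,-2882035892736,-1023260958720],
    [15533100785112768,7353757965126144,-1659721406373888,-823745367244800,-24183350231040],
    [-56117271143666304,-28900591926258624,8178673710100608,2175266110617600,48366700462080],
    [-7532621133890835840,-5176073333278106688,214655387090272128,567436161955153920,
    85246309564416000,1934668018483200],[44448462186554127273,29964557726860732404,
    -1086278317371671424,-3460768874317936896,-404444725396647936,-8512539281326080]],
   [[],[755517885572736,360686104796160,-191711058739200,-12091675115520],[-93672545816843136,
    -53193588778497024,5937066567843840,6041000887713792,580400405544960],[-232408868892355584,
    -110350026896503680,-16723809998767872,32576941754413056,1257534212014080],
    [111227048982521701632,83279282681288962944,1583052435903833856,-8564234243551653888,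
    -1771749624646729728,-102198838076375040,-773867207393280]],
   [[3428968244457600,1340198375992320,-458151948533760,-133008426270720],[-4021596600443136,
    -1596305615471424,839420673227136,-53585866414080],[-3594310018554118656,-2275861761178629312,
    189571988715447936,252878450694445056,29818070834872320,386933603696640],
    [12959958237913418316,8173325116092295536,-774157110309383424,-901808300520950784,
    -65245577555558400,-773867207393280]],
   [[],[-126745023153475584,-61479181019997312,9351184019384064,9241262894223360,193466801848320],
    [21630205656931802112,15179472189988808832,-299765242608369408,-1611406395389546496,
    -275564439212654592,-11608008110899200]],
   [[-637810468162639872,-360222165510870912,52333932421873920,40369173856481280,
    3095468829573120],[682321852735569189,398641419797671908,-104433769685456640,
    -26877898712560896,2959867933102080]]]"

definition b_c20 :: "int list list" where "b_c20 =
  [[],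
   [],
   [],
   [-640402963200,327495168000],
   [27071782657920,10480629519360,-10851068067840],
   [-1023021425986560,-2399464976388480,713916506983680,285016184893440],
   [156296572370568630,69158423858804280,147735110833390080,-84000818848826880,-6526589763133440]]"

definition G_c00 :: poly3 where "G_c00 =
  [[],
   [[2]]]"

definition W_c00 :: poly3 where "W_c00 =
  [[],
   [[],[1]]]"

definition b_c00 :: "int list list" where "b_c00 =
  [[2]]"

definition G_c02 :: poly3 where "G_c02 =
  [[],
   [],
   [],
   [[8]]]"

definition W_c02 :: poly3 where "W_c02 =
  [[],
   [[],[],[],[3]],
   [],
   [[],[5]]]"

definition b_c02 :: "int list list" where "b_c02 =
  [[],
   [6]]"

definition G_c11 :: poly3 where "G_c11 =
  [[],
   [],
   [[],[60]]]"

definition W_c11 :: poly3 where "W_c11 =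
  [[[],[],[],[],[15],[-36],[-220,-80]],
   [[],[],[],[],[],[-15]],
   [[],[],[30],[],[-720,-240]],
   [[],[],[120],[-280]],
   [[],[],[-720]],
   [[48],[15]]]"

definition b_c11 :: "int list list" where "b_c11 =
  [[],
   [],
   [-30]]"

section \<open>Estimates uniform in a small parameter\<close>

text \<open>The interval contains sqrt 1, ..., sqrt 6 with room to spare and stays away from 0,
  where the factor 1 / x of the angular velocity is singular. Lipschitz constants pass through sums,
  products and quotients without any derivatives to carry along.\<close>

abbreviation controlled :: "(real \<Rightarrow> real \<Rightarrow> real \<Rightarrow> real) \<Rightarrow> real \<Rightarrow> real \<Rightarrow> real \<Rightarrow> bool" where
  "controlled f C D l \<equiv> \<forall>t. \<forall>x\<in>{1/2..3}. \<bar>f l t x\<bar> \<le> C \<and>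
     (\<forall>y\<in>{1/2..3}. \<bar>f l t x - f l t y\<bar> \<le> D * \<bar>x - y\<bar>)"

text \<open>The class O(1) as l tends to 0 from above, in the Lipschitz norm in x and uniformly in
  the angle.\<close>

definition tame :: "(real \<Rightarrow> real \<Rightarrow> real \<Rightarrow> real) \<Rightarrow> bool" where
  "tame f \<longleftrightarrow> (\<exists>C. \<forall>\<^sub>F l in at_right 0. controlled f C C l)"

lemma tameI:
  assumes "\<forall>\<^sub>F l in at_right 0. controlled f C D l"
  shows "tame f"
  unfolding tame_def
proof (intro exI, rule eventually_mono[OF assms], intro allI ballI conjI)
  fix l t x y :: real
  assume *: "controlled f C D l" and "x \<in> {1/2..3}"
  then show "\<bar>f l t x\<bar> \<le> max C D" by (meson max.coboundedI1)
  assume "y \<in> {1/2..3}"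
  then have "\<bar>f l t x - f l t y\<bar> \<le> D * \<bar>x - y\<bar>" using * \<open>x \<in> _\<close> by blast
  also have "\<dots> \<le> max C D * \<bar>x - y\<bar>" by (intro mult_right_mono) auto
  finally show "\<bar>f l t x - f l t y\<bar> \<le> max C D * \<bar>x - y\<bar>" .
qed

lemma tameE:
  assumes "tame f"
  obtains C where "C > 0" "\<forall>\<^sub>F l in at_right 0. controlled f C C l"
proof -
  obtain C where C: "\<forall>\<^sub>F l in at_right 0. controlled f C C l"
    using assms unfolding tame_def by blast
  have "\<forall>\<^sub>F l in at_right 0. controlled f (max C 1) (max C 1) l"
  proof (rule eventually_mono[OF C], intro allI ballI conjI)
    fix l t x y :: real
    assume *: "controlled f C C l" and "x \<in> {1/2..3}"
    then show "\<bar>f l t x\<bar> \<le> max C 1" by (meson max.coboundedI1)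
    assume "y \<in> {1/2..3}"
    then have "\<bar>f l t x - f l t y\<bar> \<le> C * \<bar>x - y\<bar>" using * \<open>x \<in> _\<close> by blast
    also have "\<dots> \<le> max C 1 * \<bar>x - y\<bar>" by (intro mult_right_mono) auto
    finally show "\<bar>f l t x - f l t y\<bar> \<le> max C 1 * \<bar>x - y\<bar>" .
  qed
  then show ?thesis by (intro that[of "max C 1"]) auto
qed

named_theorems tame_intros

lemma tame_param:
  assumes "Bfun h (at_right 0)"
  shows "tame (\<lambda>l t x. h l)"
proof -
  obtain C where "\<forall>\<^sub>F l in at_right 0. norm (h l) \<le> C"
    using assms by (rule BfunE)
  then show ?thesis by (intro tameI[of _ C 0]) (auto elim: eventually_mono)
qed

lemma tame_const [tame_intros]: "tame (\<lambda>l t x. c)"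
  by (rule tame_param) (intro Bfun_const)

lemma tame_tendsto: "(h \<longlongrightarrow> c) (at_right 0) \<Longrightarrow> tame (\<lambda>l t x. h l)"
  by (intro tame_param Bfun_metric_def[THEN iffD2] exI[of _ c] exI[of _ 1] conjI)
    (auto dest!: tendstoD[of _ _ _ 1] elim: eventually_mono)

lemma tame_l [tame_intros]: "tame (\<lambda>l t x. l)"
  by (rule tame_tendsto) (rule tendsto_ident_at)

lemma tame_sin [tame_intros]: "tame (\<lambda>l t x. sin t)"
  by (rule tameI[of _ 1 0]) auto

lemma tame_cos [tame_intros]: "tame (\<lambda>l t x. cos t)"
  by (rule tameI[of _ 1 0]) auto

lemma tame_x [tame_intros]: "tame (\<lambda>l t x. x)"
  by (rule tameI[of _ 3 1]) auto

lemma tame_add [tame_intros]: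
  assumes "tame f" "tame g"
  shows "tame (\<lambda>l t x. f l t x + g l t x)"
proof -
  obtain C D where
    C: "\<forall>\<^sub>F l in at_right 0. controlled f C C l" and
    D: "\<forall>\<^sub>F l in at_right 0. controlled g D D l"
    using assms by (auto elim!: tameE)
  show ?thesis
  proof (rule tameI[of _ "C + D" "C + D"], rule eventually_elim2[OF C D], intro allI ballI conjI)
    fix l t x y :: real
    assume f: "controlled f C C l"
      and g: "controlled g D D l"
      and x: "x \<in> {1/2..3}"
    have "\<bar>f l t x\<bar> \<le> C" "\<bar>g l t x\<bar> \<le> D" using f g x by blast+
    then show "\<bar>f l t x + g l t x\<bar> \<le> C + D" by linarith
    assume y: "y \<in> {1/2..3}"
    have "\<bar>f l t x - f l t y\<bar> \<le> C * \<bar>x - y\<bar>" "\<bar>g l t x - g l t y\<bar> \<le> D * \<bar>x - y\<bar>"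
      using f g x y by blast+
    then show "\<bar>f l t x + g l t x - (f l t y + g l t y)\<bar> \<le> (C + D) * \<bar>x - y\<bar>"
      unfolding distrib_right by linarith
  qed
qed

lemma tame_mult [tame_intros]:
  assumes "tame f" "tame g"
  shows "tame (\<lambda>l t x. f l t x * g l t x)"
proof -
  obtain C D where C0: "C > 0" and D0: "D > 0" and
    C: "\<forall>\<^sub>F l in at_right 0. controlled f C C l" and
    D: "\<forall>\<^sub>F l in at_right 0. controlled g D D l"
    using assms by (auto elim!: tameE)
  show ?thesis
  proof (rule tameI[of _ "C * D" "2 * C * D"], rule eventually_elim2[OF C D], intro allI ballI conjI)
    fix l t x y :: real
    assume f: "controlled f C C l"
      and g: "controlled g D D l"
      and x: "x \<in> {1/2..3}"
    have fg: "\<bar>f l t x\<bar> \<le> C" "\<bar>g l t x\<bar> \<le> D" using f g x by blast+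
    then show "\<bar>f l t x * g l t x\<bar> \<le> C * D"
      using C0 unfolding abs_mult by (intro mult_mono) auto
    assume y: "y \<in> {1/2..3}"
    have gy: "\<bar>f l t y\<bar> \<le> C" using f y by blast
    have d: "\<bar>f l t x - f l t y\<bar> \<le> C * \<bar>x - y\<bar>" "\<bar>g l t x - g l t y\<bar> \<le> D * \<bar>x - y\<bar>"
      using f g x y by blast+
    have "\<bar>f l t x * g l t x - f l t y * g l t y\<bar>
        = \<bar>(f l t x - f l t y) * g l t x + f l t y * (g l t x - g l t y)\<bar>"
      by (simp add: algebra_simps)
    also have "\<dots> \<le> \<bar>f l t x - f l t y\<bar> * \<bar>g l t x\<bar> + \<bar>f l t y\<bar> * \<bar>g l t x - g l t y\<bar>"
      unfolding abs_mult[symmetric] by (rule abs_triangle_ineq)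
    also have "\<dots> \<le> (C * \<bar>x - y\<bar>) * D + C * (D * \<bar>x - y\<bar>)"
      using C0 D0 d fg gy by (intro add_mono mult_mono) auto
    finally show "\<bar>f l t x * g l t x - f l t y * g l t y\<bar> \<le> 2 * C * D * \<bar>x - y\<bar>"
      by (simp add: algebra_simps)
  qed
qed

lemma tame_minus [tame_intros]: "tame f \<Longrightarrow> tame (\<lambda>l t x. - f l t x)"
  using tame_mult[OF tame_const[of "-1"]] by simp

lemma tame_diff [tame_intros]: "tame f \<Longrightarrow> tame g \<Longrightarrow> tame (\<lambda>l t x. f l t x - g l t x)"
  using tame_add[OF _ tame_minus, of f g] by simp

lemma tame_power [tame_intros]: "tame f \<Longrightarrow> tame (\<lambda>l t x. f l t x ^ n)"
  by (induction n) (simp_all add: tame_intros)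

lemma tame_sum [tame_intros]:
  "(\<And>i. i \<in> A \<Longrightarrow> tame (f i)) \<Longrightarrow> tame (\<lambda>l t x. \<Sum>i\<in>A. f i l t x)"
  by (induction A rule: infinite_finite_induct) (simp_all add: tame_intros)

lemma tame_inverse:
  assumes "tame g" "c > 0" "\<forall>\<^sub>F l in at_right 0. \<forall>t. \<forall>x\<in>{1/2..3}. c \<le> g l t x"
  shows "tame (\<lambda>l t x. 1 / g l t x)"
proof -
  obtain D where D0: "D > 0" and
    D: "\<forall>\<^sub>F l in at_right 0. controlled g D D l"
    using assms by (auto elim!: tameE)
  show ?thesis
  proof (rule tameI[of _ "1 / c" "D / (c * c)"], rule eventually_elim2[OF D assms(3)], intro allI ballI conjI)
    fix l t x y :: real
    assume g: "controlled g D D l"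
      and c: "\<forall>t. \<forall>x\<in>{1/2..3}. c \<le> g l t x"
      and x: "x \<in> {1/2..3}"
    have gx: "c \<le> g l t x" using c x by blast
    then show "\<bar>1 / g l t x\<bar> \<le> 1 / c"
      using assms(2) by (simp add: frac_le)
    assume y: "y \<in> {1/2..3}"
    have gy: "c \<le> g l t y" using c y by blast
    have d: "\<bar>g l t y - g l t x\<bar> \<le> D * \<bar>x - y\<bar>"
      using g x y by (metis abs_minus_commute)
    have "\<bar>1 / g l t x - 1 / g l t y\<bar> = \<bar>g l t y - g l t x\<bar> / (g l t x * g l t y)"
      using gx gy assms(2) by (simp add: divide_simps abs_mult)
    also have "\<dots> \<le> (D * \<bar>x - y\<bar>) / (c * c)"
      using gx gy assms(2) d D0 by (intro frac_le mult_mono) auto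
    finally show "\<bar>1 / g l t x - 1 / g l t y\<bar> \<le> D / (c * c) * \<bar>x - y\<bar>" by simp
  qed
qed

lemma tame_inverse_x [tame_intros]: "tame (\<lambda>l t x. 1 / x)"
  by (rule tame_inverse[of _ "1/2"]) (auto intro: tame_intros)

lemma tame_small:
  assumes "tame f" "\<delta> > 0"
  shows "\<forall>\<^sub>F l in at_right 0. controlled (\<lambda>l t x. l * f l t x) \<delta> \<delta> l"
proof -
  obtain C where C0: "C > 0" and C: "\<forall>\<^sub>F l in at_right 0. controlled f C C l"
    using assms(1) by (rule tameE)
  have "\<forall>\<^sub>F l in at_right 0. 0 < l \<and> l < \<delta> / C"
    using assms(2) C0 by (intro eventually_conj eventually_at_right_less eventually_at_rightI[of 0 "\<delta> / C"]) auto
  then show ?thesis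
  proof (rule eventually_elim2[OF C], intro allI ballI conjI)
    fix l t x y :: real
    assume f: "controlled f C C l"
      and l: "0 < l \<and> l < \<delta> / C" and x: "x \<in> {1/2..3}"
    have lC: "l * C \<le> \<delta>" using l C0 by (simp add: field_simps)
    have "\<bar>l * f l t x\<bar> \<le> l * C" using f x l by (simp add: abs_mult)
    with lC show "\<bar>l * f l t x\<bar> \<le> \<delta>" by linarith
    assume y: "y \<in> {1/2..3}"
    have "\<bar>l * f l t x - l * f l t y\<bar> = l * \<bar>f l t x - f l t y\<bar>"
      using l by (simp add: abs_mult right_diff_distrib[symmetric])
    also have "\<dots> \<le> l * (C * \<bar>x - y\<bar>)" using f x y l by (intro mult_left_mono) auto
    also have "\<dots> \<le> \<delta> * \<bar>x - y\<bar>"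
      using mult_right_mono[OF lC, of "\<bar>x - y\<bar>"] by (simp add: mult.assoc)
    finally show "\<bar>l * f l t x - l * f l t y\<bar> \<le> \<delta> * \<bar>x - y\<bar>" .
  qed
qed

text \<open>Made for division by the angular velocity, which is 1 plus l times a tame term and hence
  at least 1/2 for small l.\<close>

lemma tame_divide_near:
  assumes "tame f" "tame h"
  shows "tame (\<lambda>l t x. f l t x / (1 + l * h l t x))"
proof -
  have "\<forall>\<^sub>F l in at_right 0. \<forall>t. \<forall>x\<in>{1/2..3}. 1/2 \<le> 1 + l * h l t x"
  proof (rule eventually_mono[OF tame_small[OF assms(2), of "1/2"]], simp, intro allI ballI)
    fix l t x :: real
    assume "controlled (\<lambda>l t x. l * h l t x) (1/2) (1/2) l"
      "x \<in> {1/2..3}"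
    then have "\<bar>l * h l t x\<bar> \<le> 1/2" by blast
    then show "1/2 \<le> 1 + l * h l t x" by linarith
  qed
  then have "tame (\<lambda>l t x. 1 / (1 + l * h l t x))"
    by (intro tame_inverse[of _ "1/2"] tame_intros assms) auto
  from tame_mult[OF assms(1) this] show ?thesis by simp
qed

lemma tame_ev1: "Bfun r (at_right 0) \<Longrightarrow> tame (\<lambda>l t x. ev1 (r l) p)"
  by (induction p) (simp_all add: tame_intros tame_param)

lemma tame_ev2: "Bfun r (at_right 0) \<Longrightarrow> tame u \<Longrightarrow> tame (\<lambda>l t x. ev2 (r l) (u l t x) p)"
  by (induction p) (simp_all add: tame_intros tame_ev1)

lemma tame_ev3: "Bfun r (at_right 0) \<Longrightarrow> tame u \<Longrightarrow> tame v \<Longrightarrow>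
    tame (\<lambda>l t x. ev3 (r l) (u l t x) (v l t x) p)"
  by (induction p) (simp_all add: tame_intros tame_ev2)

lemma ev1_zero: "list_all (\<lambda>c. c = 0) p \<Longrightarrow> ev1 r p = 0"
  by (induction p) simp_all

text \<open>Every step down the coefficient list peels off one factor l, and the required order
  drops with it; at order 0 the evaluation at scaled arguments is itself tame.\<close>

lemma low2_scale:
  assumes "low2 n p" "Bfun r (at_right 0)" "tame u"
  shows "\<exists>h. tame h \<and> (\<forall>l t x. ev2 (r l) (l * u l t x) p = l ^ n * h l t x)"
  using assms(1)
proof (induction n p rule: low2.induct)
  case (1 p)
  show ?case
    by (intro exI[of _ "\<lambda>l t x. ev2 (r l) (l * u l t x) p"])
      (simp add: tame_ev2 tame_intros assms)
next
  case (2 n)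
  show ?case by (intro exI[of _ "\<lambda>l t x. 0"]) (simp add: tame_intros)
next
  case (3 n a p)
  then obtain h where h: "tame h" "\<And>l t x. ev2 (r l) (l * u l t x) p = l ^ n * h l t x"
    by auto
  show ?case
    using 3(2) by (intro exI[of _ "\<lambda>l t x. u l t x * h l t x"])
      (simp add: tame_intros h assms ev1_zero)
qed

lemma low3_scale:
  assumes "low3 n p" "Bfun r (at_right 0)" "tame u" "tame v"
  shows "\<exists>h. tame h \<and> (\<forall>l t x. ev3 (r l) (l * u l t x) (l * v l t x) p = l ^ n * h l t x)"
  using assms(1)
proof (induction n p rule: low3.induct)
  case (1 p)
  show ?case
    by (intro exI[of _ "\<lambda>l t x. ev3 (r l) (l * u l t x) (l * v l t x) p"])
      (simp add: tame_ev3 tame_intros assms)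
next
  case (2 n)
  show ?case by (intro exI[of _ "\<lambda>l t x. 0"]) (simp add: tame_intros)
next
  case (3 n a p)
  then obtain h where h: "tame h" "\<And>l t x. ev3 (r l) (l * u l t x) (l * v l t x) p = l ^ n * h l t x"
    by auto
  obtain k where k: "tame k" "\<And>l t x. ev2 (r l) (l * u l t x) a = l ^ Suc n * k l t x"
    using low2_scale[OF _ assms(2,3), of "Suc n" a] 3(2) by auto
  show ?case
    by (intro exI[of _ "\<lambda>l t x. k l t x + v l t x * h l t x"])
      (simp add: tame_intros h k assms algebra_simps)
qed

section \<open>Error terms that tend to zero together with their Lipschitz constants\<close>

definition null :: "(real \<Rightarrow> real \<Rightarrow> real \<Rightarrow> real) \<Rightarrow> bool" where
  "null f \<longleftrightarrow> (\<forall>\<delta>>0. \<forall>\<^sub>F l in at_right 0. controlled f \<delta> \<delta> l)"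

lemma null_add:
  assumes "null f" "null g"
  shows "null (\<lambda>l t x. f l t x + g l t x)"
  unfolding null_def
proof (intro allI impI)
  fix \<delta> :: real assume "\<delta> > 0"
  then have "\<delta> / 2 > 0" by simp
  note ev = assms[unfolded null_def, rule_format, OF this]
  show "\<forall>\<^sub>F l in at_right 0. \<forall>t. \<forall>x\<in>{1/2..3}. \<bar>f l t x + g l t x\<bar> \<le> \<delta> \<and>
     (\<forall>y\<in>{1/2..3}. \<bar>f l t x + g l t x - (f l t y + g l t y)\<bar> \<le> \<delta> * \<bar>x - y\<bar>)"
  proof (rule eventually_elim2[OF ev], intro allI ballI conjI)
    fix l t x y :: real
    assume f: "controlled f (\<delta> / 2) (\<delta> / 2) l"
      and g: "controlled g (\<delta> / 2) (\<delta> / 2) l"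
      and x: "x \<in> {1/2..3}"
    have "\<bar>f l t x\<bar> \<le> \<delta> / 2" "\<bar>g l t x\<bar> \<le> \<delta> / 2" using f g x by blast+
    then show "\<bar>f l t x + g l t x\<bar> \<le> \<delta>" by linarith
    assume y: "y \<in> {1/2..3}"
    have "\<bar>f l t x - f l t y\<bar> \<le> \<delta> / 2 * \<bar>x - y\<bar>" "\<bar>g l t x - g l t y\<bar> \<le> \<delta> / 2 * \<bar>x - y\<bar>"
      using f g x y by blast+
    then show "\<bar>f l t x + g l t x - (f l t y + g l t y)\<bar> \<le> \<delta> * \<bar>x - y\<bar>"
      by linarith
  qed
qed

lemma null_param_times_tame:
  assumes "(h \<longlongrightarrow> 0) (at_right 0)" "tame f"
  shows "null (\<lambda>l t x. h l * f l t x)"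
  unfolding null_def
proof (intro allI impI)
  fix \<delta> :: real assume \<delta>: "\<delta> > 0"
  obtain C where C0: "C > 0" and C: "\<forall>\<^sub>F l in at_right 0. controlled f C C l"
    using assms(2) by (rule tameE)
  have "\<forall>\<^sub>F l in at_right 0. \<bar>h l\<bar> < \<delta> / C"
    using tendstoD[OF assms(1), of "\<delta> / C"] \<delta> C0 by simp
  then show "\<forall>\<^sub>F l in at_right 0. controlled (\<lambda>l t x. h l * f l t x) \<delta> \<delta> l"
  proof (rule eventually_elim2[OF C], intro allI ballI conjI)
    fix l t x y :: real
    assume f: "controlled f C C l"
      and l: "\<bar>h l\<bar> < \<delta> / C" and x: "x \<in> {1/2..3}"
    have lC: "\<bar>h l\<bar> * C \<le> \<delta>" using l C0 by (simp add: field_simps)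
    have "\<bar>h l * f l t x\<bar> \<le> \<bar>h l\<bar> * C" unfolding abs_mult using f x by (intro mult_left_mono) auto
    with lC show "\<bar>h l * f l t x\<bar> \<le> \<delta>" by linarith
    assume y: "y \<in> {1/2..3}"
    have "\<bar>h l * f l t x - h l * f l t y\<bar> = \<bar>h l\<bar> * \<bar>f l t x - f l t y\<bar>"
      by (simp add: abs_mult[symmetric] right_diff_distrib)
    also have "\<dots> \<le> \<bar>h l\<bar> * (C * \<bar>x - y\<bar>)" using f x y by (intro mult_left_mono) auto
    also have "\<dots> \<le> \<delta> * \<bar>x - y\<bar>"
      using mult_right_mono[OF lC, of "\<bar>x - y\<bar>"] by (simp add: mult.assoc)
    finally show "\<bar>h l * f l t x - h l * f l t y\<bar> \<le> \<delta> * \<bar>x - y\<bar>" .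
  qed
qed

lemma null_l_times_tame: "tame f \<Longrightarrow> null (\<lambda>l t x. l * f l t x)"
  by (rule null_param_times_tame) (rule tendsto_ident_at)

lemma null_times_tame:
  assumes "null f" "tame g"
  shows "null (\<lambda>l t x. f l t x * g l t x)"
  unfolding null_def
proof (intro allI impI)
  fix \<delta> :: real assume \<delta>: "\<delta> > 0"
  obtain C where C0: "C > 0" and C: "\<forall>\<^sub>F l in at_right 0. controlled g C C l"
    using assms(2) by (rule tameE)
  define \<epsilon> where "\<epsilon> = \<delta> / (2 * C)"
  have \<epsilon>: "\<epsilon> > 0" "2 * (\<epsilon> * C) = \<delta>" using \<delta> C0 by (auto simp: \<epsilon>_def)
  have eC: "\<epsilon> * C > 0" using \<epsilon> C0 by simp
  show "\<forall>\<^sub>F l in at_right 0. \<forall>t. \<forall>x\<in>{1/2..3}. \<bar>f l t x * g l t x\<bar> \<le> \<delta> \<and>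
     (\<forall>y\<in>{1/2..3}. \<bar>f l t x * g l t x - f l t y * g l t y\<bar> \<le> \<delta> * \<bar>x - y\<bar>)"
  proof (rule eventually_elim2[OF assms(1)[unfolded null_def, rule_format, OF \<epsilon>(1)] C],
      intro allI ballI conjI)
    fix l t x y :: real
    assume f: "controlled f \<epsilon> \<epsilon> l"
      and g: "controlled g C C l"
      and x: "x \<in> {1/2..3}"
    have fg: "\<bar>f l t x\<bar> \<le> \<epsilon>" "\<bar>g l t x\<bar> \<le> C" using f g x by blast+
    then have "\<bar>f l t x * g l t x\<bar> \<le> \<epsilon> * C"
      using \<epsilon> unfolding abs_mult by (intro mult_mono) auto
    then show "\<bar>f l t x * g l t x\<bar> \<le> \<delta>" using \<epsilon> eC by linarith
    assume y: "y \<in> {1/2..3}"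
    have fy: "\<bar>f l t y\<bar> \<le> \<epsilon>" using f y by blast
    have d: "\<bar>f l t x - f l t y\<bar> \<le> \<epsilon> * \<bar>x - y\<bar>" "\<bar>g l t x - g l t y\<bar> \<le> C * \<bar>x - y\<bar>"
      using f g x y by blast+
    have "\<bar>f l t x * g l t x - f l t y * g l t y\<bar>
        = \<bar>(f l t x - f l t y) * g l t x + f l t y * (g l t x - g l t y)\<bar>"
      by (simp add: algebra_simps)
    also have "\<dots> \<le> \<bar>f l t x - f l t y\<bar> * \<bar>g l t x\<bar> + \<bar>f l t y\<bar> * \<bar>g l t x - g l t y\<bar>"
      unfolding abs_mult[symmetric] by (rule abs_triangle_ineq)
    also have "\<dots> \<le> (\<epsilon> * \<bar>x - y\<bar>) * C + \<epsilon> * (C * \<bar>x - y\<bar>)"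
      using C0 \<epsilon> d fg fy by (intro add_mono mult_mono) auto
    also have "\<dots> = (2 * (\<epsilon> * C)) * \<bar>x - y\<bar>" by (simp add: algebra_simps)
    finally show "\<bar>f l t x * g l t x - f l t y * g l t y\<bar> \<le> \<delta> * \<bar>x - y\<bar>"
      unfolding \<epsilon>(2) .
  qed
qed

text \<open>In the coordinates u = 2 l x sin t, v = 2 l x cos t the field is a perturbation of the
  rotation, and the derivative of the function V along it is m (\<phi> x + o(1)); every simple zero
  of \<phi> then carries a limit cycle.\<close>

lemma eventually_limit_cycle:
  fixes F :: "real \<Rightarrow> real \<times> real \<Rightarrow> real \<times> real" and V Vx Vy :: "real \<Rightarrow> real \<Rightarrow> real \<Rightarrow> real"
  assumes F_cont: "\<forall>\<^sub>F l in at_right 0. continuous_on UNIV (F l)"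
    and V_deriv: "\<And>l x y x' y' t. (x has_real_derivative x') (at t) \<Longrightarrow> (y has_real_derivative y') (at t) \<Longrightarrow>
      ((\<lambda>t. V l (x t) (y t)) has_real_derivative Vx l (x t) (y t) * x' + Vy l (x t) (y t) * y') (at t)"
    and f1: "tame f1" and f2: "tame f2" and v1: "tame v1" and n: "null n"
    and \<phi>: "tame (\<lambda>l t. \<phi>)"
    and F: "\<forall>\<^sub>F l in at_right 0. \<forall>t. \<forall>x\<in>{1/2..3}.
       F l (2 * l * x * sin t, 2 * l * x * cos t)
         = (l * (2 * x * cos t + l * f1 l t x), l * (- 2 * x * sin t + l * f2 l t x))"
    and Vr: "\<forall>\<^sub>F l in at_right 0. \<forall>t. \<forall>x\<in>{1/2..3}.
       Vx l (2 * l * x * sin t) (2 * l * x * cos t) * sin t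
         + Vy l (2 * l * x * sin t) (2 * l * x * cos t) * cos t = l * (x + l * v1 l t x)"
    and Vdot: "\<forall>\<^sub>F l in at_right 0. m l > 0 \<and> (\<forall>t. \<forall>x\<in>{1/2..3}.
       Vx l (2 * l * x * sin t) (2 * l * x * cos t) * fst (F l (2 * l * x * sin t, 2 * l * x * cos t))
         + Vy l (2 * l * x * sin t) (2 * l * x * cos t) * snd (F l (2 * l * x * sin t, 2 * l * x * cos t))
       = m l * (\<phi> x + n l t x))"
    and \<phi>': "\<And>x. (\<phi> has_real_derivative \<phi>' x) (at x)" "isCont \<phi>' c" "\<phi>' c \<noteq> 0" "\<phi> c = 0"
    and w: "w > 0" "1 / 2 < c - w" "c + w < 3"
  shows "\<forall>\<^sub>F l in at_right 0. \<exists>\<Gamma>. limit_cycle (F l) \<Gamma> \<and>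
     \<Gamma> \<subseteq> {z. 2 * l * (c - w) < norm z \<and> norm z < 2 * l * (c + w)}"
proof -
  define \<sigma> where "\<sigma> = sgn (\<phi>' c)"
  \<comment> \<open>Near c the slope of \<sigma> * \<phi> is at least k; the other half of
    \<bar>\<phi>' c\<bar> is the allowance for the variation of \<phi>'.\<close>
  define k where "k = \<bar>\<phi>' c\<bar> / 2"
  have k: "k > 0" using \<phi>'(3) by (simp add: k_def)
  have \<sigma>c: "\<sigma> * \<phi>' c = 2 * k" by (simp add: \<sigma>_def k_def sgn_mult_abs[symmetric] abs_sgn mult.commute)
  have \<sigma>1: "\<bar>\<sigma>\<bar> = 1" using \<phi>'(3) by (simp add: \<sigma>_def abs_sgn_eq)
  obtain d where d: "d > 0" "\<And>x. \<bar>x - c\<bar> < d \<Longrightarrow> \<bar>\<phi>' x - \<phi>' c\<bar> < k"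
    using \<phi>'(2) k unfolding isCont_def LIM_def by (metis abs_eq_0_iff dist_real_def eq_iff_diff_eq_0)
  define h where "h = min w (d / 2)"
  have h: "h > 0" "h \<le> w" "h < d" using w d by (auto simp: h_def)
  \<comment> \<open>Here c = a + 4 * e and b = a + 8 * e, so on the outer strips of width 2 * e the
    distance to c is at least 2 * e = h / 2.\<close>
  define a b e where "a = c - h" and "b = c + h" and "e = h / 4"
  have dom: "a \<le> x \<Longrightarrow> x \<le> b \<Longrightarrow> x \<in> {1/2..3}" for x
    using h w by (auto simp: a_def b_def)
  have slope: "\<sigma> * \<phi> y - \<sigma> * \<phi> x \<ge> k * (y - x)" if "a \<le> x" "x < y" "y \<le> b" for x y
  proof -
    obtain z where z: "x < z" "z < y" "\<phi> y - \<phi> x = (y - x) * \<phi>' z"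
      using MVT2[OF \<open>x < y\<close> \<phi>'(1)] by blast
    have "\<bar>\<phi>' z - \<phi>' c\<bar> < k"
      using z that h by (intro d(2)) (auto simp: a_def b_def)
    then have "\<bar>\<sigma> * (\<phi>' z - \<phi>' c)\<bar> < k" by (simp add: abs_mult \<sigma>1)
    then have "\<sigma> * \<phi>' z \<ge> k" using \<sigma>c by (simp add: right_diff_distrib)
    then have "k * (y - x) \<le> (\<sigma> * \<phi>' z) * (y - x)"
      using that by (intro mult_right_mono) auto
    also have "\<dots> = \<sigma> * (\<phi> y - \<phi> x)" using z(3) by simp
    finally show ?thesis by (simp add: right_diff_distrib)
  qed
  \<comment> \<open>The angular velocity is 1 + l * \<open>o1\<close> and the radial one is l *
    \<open>r1\<close>.\<close>
  define o1 where "o1 l t x = (f1 l t x * cos t - f2 l t x * sin t) * (1 / 2) * (1 / x)" for l t x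
  define r1 where "r1 l t x = (f1 l t x * sin t + f2 l t x * cos t) * (1 / 2)" for l t x
  define g1 where "g1 l t x = r1 l t x / (1 + l * o1 l t x)" for l t x
  \<comment> \<open>What is left of (\<phi> x + n) / (1 + l * \<open>o1\<close>) after subtracting
    \<phi> x.\<close>
  define n2 where "n2 l t x = (n l t x + l * (- (o1 l t x * \<phi> x))) * (1 / (1 + l * o1 l t x))" for l t x
  have o1: "tame o1" unfolding o1_def by (intro tame_intros f1 f2)
  have r1: "tame r1" unfolding r1_def by (intro tame_intros f1 f2)
  have g1: "tame g1" unfolding g1_def by (rule tame_divide_near[OF r1 o1])
  have n2: "null n2" unfolding n2_def
    by (intro null_times_tame null_add n null_l_times_tame tame_divide_near tame_intros o1 \<phi>)
  \<comment> \<open>Serves both as the bound B and as the Lipschitz constant L of the slope; the two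
    entries of the minimum yield 4 * pi * \<delta> < e and 4 * pi * \<delta> \<le> 1 / 2.\<close>
  define \<delta> where "\<delta> = min (e / (8 * pi)) (1 / (8 * pi))"
  have \<delta>: "\<delta> > 0" "4 * pi * \<delta> < e" "4 * pi * \<delta> \<le> 1 / 2"
  proof -
    show "\<delta> > 0" using h by (simp add: \<delta>_def e_def)
    have "4 * pi * \<delta> \<le> 4 * pi * (e / (8 * pi))" "4 * pi * \<delta> \<le> 4 * pi * (1 / (8 * pi))"
      unfolding \<delta>_def by (intro mult_left_mono; simp)+
    moreover have "e > 0" using h by (simp add: e_def)
    ultimately show "4 * pi * \<delta> < e" "4 * pi * \<delta> \<le> 1 / 2" by auto
  qed
  \<comment> \<open>The first entry keeps half of the slope k for strict monotonicity. The second
    keeps the sign on the outer strips, where the slope bound makes \<phi> at least k * h / 2 in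
    absolute value.\<close>
  define \<mu> where "\<mu> = min (k / 2) (k * h / 4)"
  have \<mu>: "\<mu> > 0" "\<mu> \<le> k / 2" "\<mu> < k * h / 2" using k h by (auto simp: \<mu>_def min_def)
  have ev_g: "\<forall>\<^sub>F l in at_right 0. controlled (\<lambda>l t x. l * g1 l t x) \<delta> \<delta> l"
    by (rule tame_small[OF g1 \<delta>(1)])
  have ev_o: "\<forall>\<^sub>F l in at_right 0. controlled (\<lambda>l t x. l * o1 l t x) (1/2) (1/2) l"
    by (rule tame_small[OF o1]) simp
  have ev_v: "\<forall>\<^sub>F l in at_right 0. controlled (\<lambda>l t x. l * v1 l t x) (1/4) (1/4) l"
    by (rule tame_small[OF v1]) simp
  have ev_n: "\<forall>\<^sub>F l in at_right 0. controlled n2 \<mu> \<mu> l"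
    using n2 \<mu>(1) by (simp add: null_def)
  have "\<forall>\<^sub>F l in at_right (0::real). 0 < l" by (rule eventually_at_right_less)
  from this F_cont F Vr Vdot ev_g ev_o ev_v ev_n show ?thesis
  proof eventually_elim
    case (elim l)
    define pt where "pt t x = (2 * l * x * sin t, 2 * l * x * cos t)" for t x
    define om where "om t x = (fst (F l (pt t x)) * cos t - snd (F l (pt t x)) * sin t) / (2 * l * x)" for t x
    define rad where "rad t x = (fst (F l (pt t x)) * sin t + snd (F l (pt t x)) * cos t) / (2 * l)" for t x
    have l: "l > 0" by (rule elim(1))
    have Feq: "fst (F l (pt t x)) = l * (2 * x * cos t + l * f1 l t x)"
      "snd (F l (pt t x)) = l * (- 2 * x * sin t + l * f2 l t x)" if "x \<in> {1/2..3}" for t x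
      using elim(3) that by (simp_all add: pt_def)
    have om: "om t x = 1 + l * o1 l t x" if "x \<in> {1/2..3}" for t x
    proof -
      have x: "x > 0" using that by auto
      have "fst (F l (pt t x)) * cos t - snd (F l (pt t x)) * sin t
         = l * (2 * x * (sin t ^ 2 + cos t ^ 2) + l * (f1 l t x * cos t - f2 l t x * sin t))"
        unfolding Feq[OF that] by (simp only: algebra_simps power2_eq_square)
      also have "\<dots> = (2 * l * x) * (1 + l * o1 l t x)"
        using x by (simp add: o1_def field_simps)
      finally show ?thesis using l x by (simp add: om_def)
    qed
    have rad: "rad t x = l * r1 l t x" if "x \<in> {1/2..3}" for t x
    proof -
      have "fst (F l (pt t x)) * sin t + snd (F l (pt t x)) * cos t
         = l * (l * (f1 l t x * sin t + f2 l t x * cos t))"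
        unfolding Feq[OF that] by (simp add: algebra_simps)
      also have "\<dots> = (2 * l) * (l * r1 l t x)" by (simp add: r1_def)
      finally show ?thesis using l by (simp add: rad_def)
    qed
    have o_half: "1 + l * o1 l t x \<ge> 1 / 2" if "x \<in> {1/2..3}" for t x
    proof -
      have "\<bar>l * o1 l t x\<bar> \<le> 1/2" using elim(7) that by blast
      then show ?thesis by linarith
    qed
    have g: "rad t x / om t x = l * g1 l t x" if "x \<in> {1/2..3}" for t x
      using that by (simp add: om rad g1_def)
    define psi where "psi t x = (Vx l (fst (pt t x)) (snd (pt t x)) * fst (F l (pt t x))
        + Vy l (fst (pt t x)) (snd (pt t x)) * snd (F l (pt t x))) / om t x" for t x
    have m: "m l > 0" using elim(5) by blast
    have psi: "psi t x = m l * (\<phi> x + n2 l t x)" if "x \<in> {1/2..3}" for t x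
    proof -
      have "psi t x = m l * ((\<phi> x + n l t x) / (1 + l * o1 l t x))"
        unfolding psi_def om[OF that] using elim(5) that by (simp add: pt_def)
      also have "(\<phi> x + n l t x) / (1 + l * o1 l t x) = \<phi> x + n2 l t x"
        using o_half[OF that, of t] by (simp add: n2_def field_simps)
      finally show ?thesis .
    qed
    have n_le: "\<bar>\<sigma> * n2 l t x\<bar> \<le> \<mu>" "\<bar>\<sigma> * n2 l t x - \<sigma> * n2 l t y\<bar> \<le> \<mu> * \<bar>x - y\<bar>"
      if "x \<in> {1/2..3}" "y \<in> {1/2..3}" for t x y
      using elim(9) that by (simp_all add: abs_mult \<sigma>1 right_diff_distrib[symmetric])
    have "annulus (F l) (V l) (Vx l) (Vy l) (2 * l) a b e \<delta> \<delta> \<sigma>"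
    proof (rule annulus.intro, fold pt_def, fold om_def rad_def, fold psi_def)
      show "2 * l > 0" "a > 0" "e > 0" "a + 4 * e < b" "continuous_on UNIV (F l)"
        using l h w elim(2) by (auto simp: a_def b_def e_def)
      show "4 * pi * \<delta> \<le> 1 / 2" "4 * pi * \<delta> < e" by (fact \<delta>)+
      have he: "h = 4 * e" "a = c - 4 * e" "b = c + 4 * e" "e > 0"
        using h by (auto simp: a_def b_def e_def)
      have \<mu>e: "\<mu> < k * (2 * e)" using \<mu>(3) unfolding he(1) by (simp add: mult_ac)
      fix t x :: real
      show "((\<lambda>t. V l (x t) (y t)) has_real_derivative
            Vx l (x t) (y t) * x' + Vy l (x t) (y t) * y') (at t)"
        if "(x has_real_derivative x') (at t)" "(y has_real_derivative y') (at t)" for x y x' y' t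
        by (rule V_deriv[OF that])
      show "\<sigma> * psi t x < 0" if x: "a \<le> x" "x \<le> a + 2 * e"
      proof -
        have X: "x \<in> {1/2..3}" using x he by (intro dom) auto
        have "k * (c - x) \<le> \<sigma> * \<phi> c - \<sigma> * \<phi> x" using x he by (intro slope) auto
        moreover have "k * (2 * e) \<le> k * (c - x)" using x he k by (intro mult_left_mono) auto
        ultimately have "\<sigma> * (\<phi> x + n2 l t x) < 0"
          using n_le(1)[OF X X, of t] \<mu>e \<phi>'(4) unfolding distrib_left by simp
        from mult_strict_left_mono[OF this m] show ?thesis unfolding psi[OF X]
          by (simp add: mult.left_commute)
      qed
      show "0 < \<sigma> * psi t x" if x: "b - 2 * e \<le> x" "x \<le> b"
      proof -
        have X: "x \<in> {1/2..3}" using x he by (intro dom) auto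
        have "k * (x - c) \<le> \<sigma> * \<phi> x - \<sigma> * \<phi> c" using x he by (intro slope) auto
        moreover have "k * (2 * e) \<le> k * (x - c)" using x he k by (intro mult_left_mono) auto
        ultimately have "0 < \<sigma> * (\<phi> x + n2 l t x)"
          using n_le(1)[OF X X, of t] \<mu>e \<phi>'(4) unfolding distrib_left by simp
        from mult_strict_left_mono[OF this m] show ?thesis unfolding psi[OF X]
          by (simp add: mult.left_commute)
      qed
      show "\<sigma> * psi t x < \<sigma> * psi t y" if x: "a \<le> x" "x < y" "y \<le> b" for y
      proof -
        have X: "x \<in> {1/2..3}" "y \<in> {1/2..3}" by (rule dom; use x in linarith)+
        have "k * (y - x) \<le> \<sigma> * \<phi> y - \<sigma> * \<phi> x" by (rule slope[OF x])
        moreover have "\<bar>\<sigma> * n2 l t x - \<sigma> * n2 l t y\<bar> \<le> k / 2 * (y - x)"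
        proof -
          have "\<bar>\<sigma> * n2 l t x - \<sigma> * n2 l t y\<bar> \<le> \<mu> * (y - x)"
            using n_le(2)[OF X, of t] x by simp
          also have "\<dots> \<le> k / 2 * (y - x)" using \<mu>(2) x by (intro mult_right_mono) auto
          finally show ?thesis .
        qed
        moreover have "k / 2 * (y - x) < k * (y - x)" using x k by (intro mult_strict_right_mono) auto
        ultimately have "\<sigma> * (\<phi> x + n2 l t x) < \<sigma> * (\<phi> y + n2 l t y)"
          unfolding distrib_left by linarith
        from mult_strict_left_mono[OF this m] show ?thesis unfolding psi[OF X(1)] psi[OF X(2)]
          by (simp add: mult.left_commute)
      qed
      assume x: "a \<le> x" "x \<le> b"
      have X: "x \<in> {1/2..3}" by (rule dom[OF x])
      show "0 < om t x" using o_half[OF X, of t] om[OF X, of t] by linarith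
      show "\<bar>rad t x / om t x\<bar> \<le> \<delta>" unfolding g[OF X] using elim(6) X by blast
      show "\<bar>rad t x / om t x - rad t y / om t y\<bar> \<le> \<delta> * \<bar>x - y\<bar>" if y: "a \<le> y" "y \<le> b" for y
        unfolding g[OF X] g[OF dom[OF y]] using elim(6) X dom[OF y] by blast
      have "\<bar>l * v1 l t x\<bar> \<le> 1/4" using elim(8) X by blast
      then have "0 < l * (x + l * v1 l t x)" using l X by (intro mult_pos_pos) auto
      then show "0 < Vx l (fst (pt t x)) (snd (pt t x)) * sin t
          + Vy l (fst (pt t x)) (snd (pt t x)) * cos t"
        using elim(4) X by (simp add: pt_def)
    qed
    from annulus.limit_cycle_in_ring[OF this] annulus.ring_def[OF this]
    obtain \<Gamma> where \<Gamma>: "limit_cycle (F l) \<Gamma>" "\<Gamma> \<subseteq> {z. 2 * l * a < norm z \<and> norm z < 2 * l * b}"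
      by auto
    have "2 * l * (c - w) \<le> 2 * l * a" "2 * l * b \<le> 2 * l * (c + w)"
      using h l by (auto simp: a_def b_def)
    with \<Gamma> show ?case by (intro exI[of _ \<Gamma>]) force
  qed
qed

section \<open>Focal values\<close>

text \<open>Horner's scheme at 2 with absolute values, which bounds the polynomial on [-2, 2] and is
  computed in integers.\<close>

fun abs_bound :: "int list \<Rightarrow> int" where
  "abs_bound [] = 0"
| "abs_bound (c # p) = \<bar>c\<bar> + 2 * abs_bound p"

lemma ev1_le_abs_bound: "\<bar>r\<bar> \<le> 2 \<Longrightarrow> \<bar>ev1 r p\<bar> \<le> of_int (abs_bound p)"
proof (induction p)
  case (Cons c p)
  have "\<bar>ev1 r (c # p)\<bar> \<le> \<bar>of_int c\<bar> + \<bar>r\<bar> * \<bar>ev1 r p\<bar>"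
    unfolding ev1_Cons abs_mult[symmetric] by (rule abs_triangle_ineq)
  also have "\<bar>r\<bar> * \<bar>ev1 r p\<bar> \<le> 2 * of_int (abs_bound p)"
    using Cons by (intro mult_mono) auto
  finally show ?case by simp
qed simp

text \<open>An approximate Bezout identity v p + w f = a + (small) shows that p and f have no
  common zero in [-2, 2]; this keeps the cofactors v and w short.\<close>

lemma ev1_nonzero:
  assumes "ev1 r f = 0" "\<bar>r\<bar> \<le> 2" "add1 (mul1 v p) (mul1 w f) = a # q" "2 * abs_bound q < \<bar>a\<bar>"
  shows "ev1 r p \<noteq> 0"
proof
  assume "ev1 r p = 0"
  then have "ev1 r (add1 (mul1 v p) (mul1 w f)) = 0" using assms(1) by simp
  then have "\<bar>of_int a\<bar> = \<bar>r\<bar> * \<bar>ev1 r q\<bar>"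
    unfolding assms(3) ev1_Cons abs_mult[symmetric] by (metis abs_minus_cancel add_eq_0_iff)
  also have "\<dots> \<le> 2 * of_int (abs_bound q)"
    using assms(2) ev1_le_abs_bound[OF assms(2), of q] by (intro mult_mono) auto
  finally have "\<bar>a\<bar> \<le> 2 * abs_bound q"
    by (metis of_int_abs of_int_le_iff of_int_mult of_int_numeral)
  then show False using assms(4) by simp
qed

text \<open>Tests the difference entrywise, so that trailing zeros do not matter.\<close>

definition eq1 :: "poly1 \<Rightarrow> poly1 \<Rightarrow> bool" where
  "eq1 p q = list_all (\<lambda>c. c = 0) (add1 p (mul1 [-1] q))"

lemma eq1D: "eq1 p q \<Longrightarrow> ev1 r p = ev1 r q"
  using ev1_zero[of "add1 p (mul1 [-1] q)" r] by (simp add: eq1_def)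

section \<open>The polynomials in r of the theorem and their values at the zeros of f\<close>

definition pf :: poly1 where
  "pf = [780900831, -459924741, -2093583104, -1597844992, -108363776, 1381957632]"
definition pf' :: poly1 where
  "pf' = [-459924741, -4187166208, -4793534976, -433455104, 6909788160]"
definition pA :: poly1 where "pA = [-696, -17328, 1792]"
definition pB :: poly1 where "pB = [11107, -5680]"
definition pM :: poly1 where "pM = [-43347, 17680]"
definition pN :: poly1 where "pN = [6544683, 11682846, 30378720, -40278528, -21471232]"
definition pD :: poly1 where "pD = [2770317, -11417834, 11442688, 442880]"
text \<open>Together with \<open>pP\<close>, the factors that appear when the relations for c10 and
  c20 are inserted in the last two focal values: B_5 becomes a multiple of f * \<open>pQ\<close> and
  B_6 a multiple of \<open>pP\<close>.\<close>

definition pQ :: poly1 where "pQ = [7, -4, -4]"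
definition pP :: poly1 where
  "pP = [-2525067941235, 1606997627619, 10463081781386, 5715123892420, -6735071718488,
         -13544509927424, -3263042031616, 4370369871872, 1784978866176]"

lemma ev1_pf: "ev1 r pf = fpoly r"
  by (simp add: pf_def fpoly_def algebra_simps eval_nat_numeral)

text \<open>For y = 1 / r with \<bar>y\<bar> \<le> 1 / 2, the leading coefficient exceeds the sum of
  all other terms of y^5 f(1 / y) in absolute value.\<close>

lemma fpoly_root_bound:
  assumes "fpoly r = 0"
  shows "\<bar>r\<bar> \<le> 2"
proof (rule ccontr)
  assume "\<not> \<bar>r\<bar> \<le> 2"
  then have r: "\<bar>1 / r\<bar> \<le> 1 / 2" "r \<noteq> 0" by (auto simp: field_simps)
  define y where "y = 1 / r"
  have "0 = fpoly r * y ^ 5" using assms by simp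
  also have "\<dots> = 1381957632 - 108363776 * y - 1597844992 * y ^ 2 - 2093583104 * y ^ 3
      - 459924741 * y ^ 4 + 780900831 * y ^ 5"
    using r(2) by (simp add: fpoly_def y_def field_simps eval_nat_numeral)
  finally have "1381957632 = 108363776 * y + 1597844992 * y ^ 2 + 2093583104 * y ^ 3
      + 459924741 * y ^ 4 - 780900831 * y ^ 5" by simp
  moreover have "\<bar>y\<bar> ^ n \<le> (1 / 2) ^ n" for n using r by (intro power_mono) (auto simp: y_def)
  from this[of 1] this[of 2] this[of 3] this[of 4] this[of 5]
  have "\<bar>y\<bar> \<le> 1/2" "\<bar>y ^ 2\<bar> \<le> 1/4" "\<bar>y ^ 3\<bar> \<le> 1/8" "\<bar>y ^ 4\<bar> \<le> 1/16" "\<bar>y ^ 5\<bar> \<le> 1/32"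
    by (simp_all add: power_abs power_divide)
  ultimately show False by linarith
qed

text \<open>\<open>pD\<close> and \<open>pM\<close> are the denominators in the relations for c20
  and c10. Nonzero \<open>pf'\<close> and \<open>pQ\<close> let B_5 be steered by r, and nonzero
  \<open>pP\<close> keeps B_6 away from 0. For \<open>pM\<close> the constant coefficient alone
  dominates on [-2, 2], so the cofactors are simply 1 and 0.\<close>

lemma nonzero_at_root:
  assumes "fpoly r = 0"
  shows "ev1 r pD \<noteq> 0" "ev1 r pM \<noteq> 0" "ev1 r pQ \<noteq> 0" "ev1 r pf' \<noteq> 0" "ev1 r pP \<noteq> 0"
proof -
  have r: "ev1 r pf = 0" "\<bar>r\<bar> \<le> 2"
    using assms fpoly_root_bound by (simp_all add: ev1_pf)
  show "ev1 r pD \<noteq> 0"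
    by (rule ev1_nonzero[OF r, of "[-4577351, -7302218, -3653886, 1408384, 3720908]" _ "[16415, -31354, -1192]"
      "137773850598" "[-54064061, -629018936, -1276161804, -1292269732, -140616312, 204453888, 622237696]"])
      code_simp+
  show "ev1 r pM \<noteq> 0"
    by (rule ev1_nonzero[OF r, of "[1]" _ "[]" "-43347" "[17680]"]) code_simp+
  show "ev1 r pQ \<noteq> 0"
    by (rule ev1_nonzero[OF r, of "[12771976025, 6975559409, 2527305976, -4416639188, -4390357593]" _ "[-26, -13]"
      69100410569 "[-452655774, -886817567, -167385712, 414272769, 705817780, -404018844]"])
      code_simp+
  show "ev1 r pf' \<noteq> 0"
    by (rule ev1_nonzero[OF r, of "[-141, -456, -47, -18, 208]" _ "[1325, -243, 73, -1038]"
      1099542989556 "[956933466, 1622545217, -508912965, -2359169226, -1215115264, 823714816, -1170341888, 2763915264]"])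
      code_simp+
  show "ev1 r pP \<noteq> 0"
    by (rule ev1_nonzero[OF r, of "[12318, 15011, 29186, -10427, -12951]" _
        "[51364026, 53441642, 67622096, -96850908, -174362208, -11589085, 55736561, 16727814]"
        9006423686772876 "[238204169493, 2410456297197, 2632926904041, 3205006839360, 525081592362,
        -3918371453954, -6715694837199, -4034778281526, 1819484958720, 2301383793664, 241917886464, -131071868928]"])
      code_simp+
qed

text \<open>The coefficient of (X^2 + Y^2)^(j + 1) that the families of c10 = x, c01 = y and c20 = z
  produce. Their data are stored with the denominators 369008640, 369008640 / 16 and 369008640 / 2,
  whence the factors 16 and 2.\<close>

definition beta :: "nat \<Rightarrow> real \<Rightarrow> real \<Rightarrow> real \<Rightarrow> real \<Rightarrow> real" where
  "beta j r x y z = (ev1 r (b_c10 ! j) * x + 16 * ev1 r (b_c01 ! j) * y + 2 * ev1 r (b_c20 ! j) * z) / 369008640"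

text \<open>Inserting the relation for c10 and clearing \<open>pM\<close> leaves \<open>pU j\<close>
  as the coefficient of c20 and \<open>pV j\<close> as that of c01. Inserting the relation for c20
  and clearing 2 * \<open>pD\<close> then leaves \<open>pT j\<close> for c01.\<close>

definition pU :: "nat \<Rightarrow> poly1" where
  "pU j = add1 (mul1 [2] (mul1 pB (b_c10 ! j))) (mul1 [2] (mul1 pM (b_c20 ! j)))"
definition pV :: "nat \<Rightarrow> poly1" where
  "pV j = add1 (mul1 [2] (mul1 pA (b_c10 ! j))) (mul1 [16] (mul1 pM (b_c01 ! j)))"
definition pT :: "nat \<Rightarrow> poly1" where
  "pT j = add1 (mul1 pN (pU j)) (mul1 [2] (mul1 pD (pV j)))"

text \<open>The triangular structure behind the independent perturbations. On the relation for c10,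
  B_3 vanishes identically in r, so only the deviation from that relation moves it; on both
  relations B_4 vanishes as well and the deviation of c20 moves it; B_5 is then divisible by f, and
  r moves it.\<close>

lemma pU_3: "eq1 (pU 3) []" and pT_3: "eq1 (pT 3) []" and b_3: "eq1 (b_c10 ! 3) (mul1 [57657600] pM)"
  and pU_4: "eq1 (pU 4) (mul1 [-3874590720] pD)" and pT_4: "eq1 (pT 4) []"
  and pT_5: "eq1 (pT 5) (mul1 [369008640] (mul1 pf (mul1 pM (mul1 [42] pQ))))"
  and pT_6: "eq1 (pT 6) (mul1 [369008640] (mul1 pM (mul1 [6] pP)))"
  by code_simp+

lemma beta_split:
  assumes M: "ev1 r pM \<noteq> 0" and D: "ev1 r pD \<noteq> 0"
    and z: "z = ev1 r pN / (2 * ev1 r pD) * y + s4"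
    and x: "x = 2 / ev1 r pM * (ev1 r pA * y + ev1 r pB * z) + s3"
  shows "beta j r x y z = (ev1 r (pU j) * s4 / ev1 r pM + ev1 r (pT j) * y / (2 * ev1 r pD * ev1 r pM)
      + ev1 r (b_c10 ! j) * s3) / 369008640"
proof -
  have Y: "2 * ev1 r pD * z = ev1 r pN * y + 2 * ev1 r pD * s4"
    using D by (simp add: z field_simps)
  have X: "ev1 r pM * x = 2 * (ev1 r pA * y + ev1 r pB * z) + ev1 r pM * s3"
    using M by (simp add: x distrib_left)
  have "2 * ev1 r pD * ev1 r pM * (ev1 r (b_c10 ! j) * x + 16 * ev1 r (b_c01 ! j) * y + 2 * ev1 r (b_c20 ! j) * z)
    = 2 * ev1 r pD * ev1 r (b_c10 ! j) * (ev1 r pM * x)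
      + 16 * (2 * ev1 r pD * ev1 r pM) * ev1 r (b_c01 ! j) * y + 2 * ev1 r pM * ev1 r (b_c20 ! j) * (2 * ev1 r pD * z)"
    by (simp add: algebra_simps)
  also have "\<dots> = 2 * ev1 r (b_c10 ! j) * (2 * ev1 r pD * ev1 r pA * y + ev1 r pB * (2 * ev1 r pD * z)
        + ev1 r pD * ev1 r pM * s3)
      + 16 * (2 * ev1 r pD * ev1 r pM) * ev1 r (b_c01 ! j) * y + 2 * ev1 r pM * ev1 r (b_c20 ! j) * (2 * ev1 r pD * z)"
    unfolding X by (simp add: algebra_simps)
  also have "\<dots> = 2 * ev1 r pD * ev1 r (pU j) * s4 + ev1 r (pT j) * y + 2 * ev1 r pD * ev1 r pM * ev1 r (b_c10 ! j) * s3"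
    unfolding Y by (simp add: pU_def pT_def pV_def algebra_simps)
  finally have "(ev1 r (b_c10 ! j) * x + 16 * ev1 r (b_c01 ! j) * y + 2 * ev1 r (b_c20 ! j) * z)
     = (2 * ev1 r pD * ev1 r (pU j) * s4 + ev1 r (pT j) * y + 2 * ev1 r pD * ev1 r pM * ev1 r (b_c10 ! j) * s3)
       / (2 * ev1 r pD * ev1 r pM)"
    using M D by (simp add: eq_divide_eq mult_ac)
  also have "\<dots> = ev1 r (pU j) * s4 / ev1 r pM + ev1 r (pT j) * y / (2 * ev1 r pD * ev1 r pM)
      + ev1 r (b_c10 ! j) * s3"
    using M D by (simp add: add_divide_distrib)
  finally show ?thesis by (simp add: beta_def)
qed

lemma tendsto_ev1 [tendsto_intros]:
  "(f \<longlongrightarrow> c) F \<Longrightarrow> ((\<lambda>l. ev1 (f l) p) \<longlongrightarrow> ev1 c p) F"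
  by (induction p) (auto intro!: tendsto_eq_intros)

text \<open>An exact Taylor formula: at a root r with h = \<kappa> * l^2 it exhibits the factor l^2
  of f and the limit of the quotient.\<close>

lemma fpoly_increment:
  "fpoly (r + h) - fpoly r = h * (ev1 r pf' + h * (- 2093583104 - 1597844992 * (3 * r + h)
     - 108363776 * (6 * r^2 + 4 * r * h + h^2)
     + 1381957632 * (10 * r^3 + 10 * r^2 * h + 5 * r * h^2 + h^3)))"
  by (simp add: fpoly_def pf'_def eval_nat_numeral algebra_simps)

text \<open>The coefficients of s (s - 1) ... (s - 6).\<close>

definition target :: "nat \<Rightarrow> real" where
  "target j = [720, -1764, 1624, -735, 175, -21, 1] ! j"

text \<open>No parameter is left for B_6, so its limit defines \<tau> (\<open>target 6\<close> is 1)
  and the other six values are tuned to it. The deviations that tune B_3 and B_4 enter the focal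
  values of higher index with a surplus factor of at least l^2 and drop out in the limit; the motion
  of r does not disturb B_3 and B_4, because their tuning is done at the moving r.\<close>

lemma parameters:
  fixes r0 y :: real
  assumes f0: "fpoly r0 = 0" and y: "y \<noteq> 0"
  obtains \<tau> :: real and r c10 c20 s0 s1 s2 :: "real \<Rightarrow> real" and B :: "nat \<Rightarrow> real \<Rightarrow> real" where
    "\<tau> \<noteq> 0" "(r \<longlongrightarrow> r0) (at_right 0)"
    "(c20 \<longlongrightarrow> ev1 r0 pN / (2 * ev1 r0 pD) * y) (at_right 0)"
    "(c10 \<longlongrightarrow> 2 / ev1 r0 pM * (ev1 r0 pA * y + ev1 r0 pB * (ev1 r0 pN / (2 * ev1 r0 pD) * y))) (at_right 0)"
    "\<And>j. j \<le> 6 \<Longrightarrow> (B j \<longlongrightarrow> \<tau> * target j) (at_right 0)"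
    "\<And>l. s0 l = l ^ 12 * B 0 l" "\<And>l. s1 l = l ^ 10 * B 1 l" "\<And>l. s2 l = - (l ^ 8 * B 2 l)"
    "\<And>j. 3 \<le> j \<Longrightarrow> j \<le> 6 \<Longrightarrow>
      \<forall>\<^sub>F l in at_right 0. beta j (r l) (c10 l) y (c20 l) = l ^ (12 - 2 * j) * B j l"
proof -
  note nz = nonzero_at_root[OF f0]
  define \<tau> where "\<tau> = y * (6 * ev1 r0 pP) / (2 * ev1 r0 pD)"
  have \<tau>: "\<tau> \<noteq> 0" using nz y by (simp add: \<tau>_def)
  \<comment> \<open>The slope of r in l^2 for which y * f(r) * 42 * \<open>pQ\<close> / (2 *
    \<open>pD\<close>), the leading part of the fifth focal value, is asymptotic to \<tau> *
    \<open>target 5\<close> * l^2.\<close>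
  define \<kappa> where "\<kappa> = \<tau> * target 5 * (2 * ev1 r0 pD) / (y * ev1 r0 pf' * (42 * ev1 r0 pQ))"
  define r where "r l = r0 + \<kappa> * l ^ 2" for l :: real
  \<comment> \<open>The constants 32 / 5 = 369008640 / 57657600 and, in \<open>q4\<close>, 2 / 21 =
    369008640 / 3874590720 invert the coefficients of \<open>s3\<close> in B_3 and of
    \<open>s4\<close> in B_4. Taking them at r l and not at r0 makes these contributions
    exact.\<close>
  define q3 where "q3 l = 32 / 5 * (\<tau> * target 3) / ev1 (r l) pM" for l
  define q4 where "q4 l = - 2 / 21 * (\<tau> * target 4) * ev1 (r l) pM / ev1 (r l) pD" for l
  define s3 where "s3 l = l ^ 6 * q3 l" for l
  define s4 where "s4 l = l ^ 4 * q4 l" for l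
  define c20 where "c20 l = ev1 (r l) pN / (2 * ev1 (r l) pD) * y + s4 l" for l
  define c10 where "c10 l = 2 / ev1 (r l) pM * (ev1 (r l) pA * y + ev1 (r l) pB * c20 l) + s3 l" for l
  have r: "(r \<longlongrightarrow> r0) (at_right 0)"
    unfolding r_def by (auto intro!: tendsto_eq_intros)
  have q3: "(q3 \<longlongrightarrow> 32 / 5 * (\<tau> * target 3) / ev1 r0 pM) (at_right 0)"
    and q4: "(q4 \<longlongrightarrow> - 2 / 21 * (\<tau> * target 4) * ev1 r0 pM / ev1 r0 pD) (at_right 0)"
    unfolding q3_def q4_def by (intro tendsto_intros r nz)+
  have s3: "(s3 \<longlongrightarrow> 0) (at_right 0)" and s4: "(s4 \<longlongrightarrow> 0) (at_right 0)"
    unfolding s3_def s4_def by (auto intro!: tendsto_eq_intros q3 q4)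
  have c20: "(c20 \<longlongrightarrow> ev1 r0 pN / (2 * ev1 r0 pD) * y) (at_right 0)"
  proof -
    have "(c20 \<longlongrightarrow> ev1 r0 pN / (2 * ev1 r0 pD) * y + 0) (at_right 0)"
      unfolding c20_def using nz(1) by (intro tendsto_intros r s4) simp
    then show ?thesis by simp
  qed
  have c10: "(c10 \<longlongrightarrow> 2 / ev1 r0 pM * (ev1 r0 pA * y + ev1 r0 pB * (ev1 r0 pN / (2 * ev1 r0 pD) * y))) (at_right 0)"
  proof -
    have "(c10 \<longlongrightarrow> 2 / ev1 r0 pM * (ev1 r0 pA * y + ev1 r0 pB * (ev1 r0 pN / (2 * ev1 r0 pD) * y)) + 0) (at_right 0)"
      unfolding c10_def by (intro tendsto_intros r s3 c20 nz)
    then show ?thesis by simp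
  qed
  have evM: "\<forall>\<^sub>F l in at_right 0. ev1 (r l) pM \<noteq> 0" and evD: "\<forall>\<^sub>F l in at_right 0. ev1 (r l) pD \<noteq> 0"
    using tendsto_imp_eventually_ne[OF tendsto_ev1[OF r]] nz by blast+
  \<comment> \<open>For j < 3 the values are prescribed, since c00, c02 and c11 are set from them;
    for larger j the scaled value is whatever the choice of r, c10 and c20 produces.\<close>
  define B where "B j l = (if j < 3 then \<tau> * target j else beta j (r l) (c10 l) y (c20 l) / l ^ (12 - 2 * j))"
    for j :: nat and l
  have l0: "\<forall>\<^sub>F l in at_right (0::real). 0 < l" by (rule eventually_at_right_less)
  have split: "\<forall>\<^sub>F l in at_right 0. beta j (r l) (c10 l) y (c20 l)
     = (ev1 (r l) (pU j) * s4 l / ev1 (r l) pM + ev1 (r l) (pT j) * y / (2 * ev1 (r l) pD * ev1 (r l) pM)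
      + ev1 (r l) (b_c10 ! j) * s3 l) / 369008640" for j
    using evM evD by eventually_elim (rule beta_split[OF _ _ c20_def c10_def])
  have B3: "(B 3 \<longlongrightarrow> \<tau> * target 3) (at_right 0)"
  proof (rule tendsto_eventually)
    show "\<forall>\<^sub>F l in at_right 0. B 3 l = \<tau> * target 3"
      using split[of 3] evM evD l0
      by eventually_elim
        (simp add: B_def eq1D[OF pU_3] eq1D[OF pT_3] eq1D[OF b_3] s3_def, simp add: q3_def)
  qed
  have B4: "(B 4 \<longlongrightarrow> \<tau> * target 4) (at_right 0)"
  proof (rule Lim_transform_eventually)
    show "\<forall>\<^sub>F l in at_right 0. \<tau> * target 4 + ev1 (r l) (b_c10 ! 4) * q3 l * l ^ 2 / 369008640 = B 4 l"
      using split[of 4] evM evD l0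
    proof eventually_elim
      case (elim l)
      have "- (3874590720 * ev1 (r l) pD * s4 l / ev1 (r l) pM) = 369008640 * (\<tau> * target 4) * l ^ 4"
        using elim by (simp add: s4_def q4_def)
      moreover have "s3 l = (q3 l * l ^ 2) * l ^ 4" by (simp add: s3_def eval_nat_numeral)
      ultimately have "beta 4 (r l) (c10 l) y (c20 l)
          = (\<tau> * target 4 + ev1 (r l) (b_c10 ! 4) * q3 l * l ^ 2 / 369008640) * l ^ 4"
        using elim(1) by (simp add: eq1D[OF pU_4] eq1D[OF pT_4] algebra_simps)
      then show ?case using elim(4) by (simp add: B_def)
    qed
    show "((\<lambda>l. \<tau> * target 4 + ev1 (r l) (b_c10 ! 4) * q3 l * l ^ 2 / 369008640) \<longlongrightarrow> \<tau> * target 4) (at_right 0)"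
      by (rule tendsto_eq_intros r q3 refl | simp)+
  qed
  have B5: "(B 5 \<longlongrightarrow> \<tau> * target 5) (at_right 0)"
  proof -
    define w where "w l = - 2093583104 - 1597844992 * (3 * r0 + \<kappa> * l ^ 2)
     - 108363776 * (6 * r0^2 + 4 * r0 * (\<kappa> * l ^ 2) + (\<kappa> * l ^ 2)^2)
     + 1381957632 * (10 * r0^3 + 10 * r0^2 * (\<kappa> * l ^ 2) + 5 * r0 * (\<kappa> * l ^ 2)^2 + (\<kappa> * l ^ 2)^3)" for l
    have "isCont w 0" unfolding w_def by (intro continuous_intros)
    then have w: "(w \<longlongrightarrow> w 0) (at_right 0)" by (simp add: isCont_def filterlim_at_split)
    have f: "fpoly (r l) = \<kappa> * l ^ 2 * (ev1 r0 pf' + \<kappa> * l ^ 2 * w l)" for l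
      using fpoly_increment[of r0 "\<kappa> * l ^ 2"] by (simp add: f0 r_def w_def)
    define b5 where "b5 l = ev1 (r l) (pU 5) * q4 l * l ^ 2 / ev1 (r l) pM / 369008640
        + y * \<kappa> * (ev1 r0 pf' + \<kappa> * l ^ 2 * w l) * (42 * ev1 (r l) pQ) / (2 * ev1 (r l) pD)
        + ev1 (r l) (b_c10 ! 5) * q3 l * l ^ 4 / 369008640" for l
    have "\<forall>\<^sub>F l in at_right 0. b5 l = B 5 l"
      using split[of 5] evM evD l0
    proof eventually_elim
      case (elim l)
      have "beta 5 (r l) (c10 l) y (c20 l) = ev1 (r l) (pU 5) * s4 l / ev1 (r l) pM / 369008640
          + y * fpoly (r l) * (42 * ev1 (r l) pQ) / (2 * ev1 (r l) pD) + ev1 (r l) (b_c10 ! 5) * s3 l / 369008640"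
        using elim(1,2) by (simp add: eq1D[OF pT_5] ev1_pf add_divide_distrib)
      also have "\<dots> = b5 l * l ^ 2"
      proof -
        have "s4 l = q4 l * l ^ 2 * l ^ 2" "s3 l = q3 l * l ^ 4 * l ^ 2"
          by (simp_all add: s3_def s4_def eval_nat_numeral)
        then show ?thesis unfolding f b5_def
          by (simp only: distrib_left distrib_right add_divide_distrib times_divide_eq_left times_divide_eq_right mult_ac)
      qed
      finally show ?case using elim(4) by (simp add: B_def)
    qed
    moreover have "(b5 \<longlongrightarrow> ev1 r0 (pU 5) * (- 2 / 21 * (\<tau> * target 4) * ev1 r0 pM / ev1 r0 pD) * 0 ^ 2 / ev1 r0 pM / 369008640
        + y * \<kappa> * (ev1 r0 pf' + \<kappa> * 0 ^ 2 * w 0) * (42 * ev1 r0 pQ) / (2 * ev1 r0 pD)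
        + ev1 r0 (b_c10 ! 5) * (32 / 5 * (\<tau> * target 3) / ev1 r0 pM) * 0 ^ 4 / 369008640) (at_right 0)"
      unfolding b5_def using nz by (intro tendsto_intros r q3 q4 w) auto
    moreover have "y * \<kappa> * ev1 r0 pf' * (42 * ev1 r0 pQ) / (2 * ev1 r0 pD) = \<tau> * target 5"
      using nz y by (simp add: \<kappa>_def)
    ultimately show ?thesis by (simp add: Lim_transform_eventually)
  qed
  have B6: "(B 6 \<longlongrightarrow> \<tau> * target 6) (at_right 0)"
  proof (rule Lim_transform_eventually)
    show "\<forall>\<^sub>F l in at_right 0. ev1 (r l) (pU 6) * s4 l / ev1 (r l) pM / 369008640
         + y * (6 * ev1 (r l) pP) / (2 * ev1 (r l) pD) + ev1 (r l) (b_c10 ! 6) * s3 l / 369008640 = B 6 l"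
      using split[of 6] evM evD l0
      by eventually_elim (simp add: B_def eq1D[OF pT_6] add_divide_distrib)
    show "((\<lambda>l. ev1 (r l) (pU 6) * s4 l / ev1 (r l) pM / 369008640
         + y * (6 * ev1 (r l) pP) / (2 * ev1 (r l) pD) + ev1 (r l) (b_c10 ! 6) * s3 l / 369008640)
        \<longlongrightarrow> \<tau> * target 6) (at_right 0)"
    proof -
      have "((\<lambda>l. ev1 (r l) (pU 6) * s4 l / ev1 (r l) pM / 369008640
         + y * (6 * ev1 (r l) pP) / (2 * ev1 (r l) pD) + ev1 (r l) (b_c10 ! 6) * s3 l / 369008640)
        \<longlongrightarrow> ev1 r0 (pU 6) * 0 / ev1 r0 pM / 369008640
         + y * (6 * ev1 r0 pP) / (2 * ev1 r0 pD) + ev1 r0 (b_c10 ! 6) * 0 / 369008640) (at_right 0)"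
        using nz by (intro tendsto_intros r s3 s4) auto
      then show ?thesis by (simp add: \<tau>_def target_def)
    qed
  qed
  have Blt: "(B j \<longlongrightarrow> \<tau> * target j) (at_right 0)" if "j < 3" for j
    using that by (simp add: B_def[abs_def])
  have B: "(B j \<longlongrightarrow> \<tau> * target j) (at_right 0)" if "j \<le> 6" for j
  proof -
    have "j < 3 \<or> j = 3 \<or> j = 4 \<or> j = 5 \<or> j = 6" using that by linarith
    then show ?thesis using B3 B4 B5 B6 Blt by blast
  qed
  show ?thesis
  proof (rule that[of \<tau> r c20 c10 B "\<lambda>l. l ^ 12 * B 0 l" "\<lambda>l. l ^ 10 * B 1 l" "\<lambda>l. - (l ^ 8 * B 2 l)", OF \<tau> r c20 c10 B])
    fix j :: nat assume "3 \<le> j"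
    show "\<forall>\<^sub>F l in at_right 0. beta j (r l) (c10 l) y (c20 l) = l ^ (12 - 2 * j) * B j l"
      using l0 by eventually_elim (use \<open>3 \<le> j\<close> in \<open>simp add: B_def\<close>)
  qed (auto)
qed

section \<open>The near-Hamiltonian system\<close>

lemma ev3_chain:
  assumes "(x has_real_derivative x') (at t)" "(y has_real_derivative y') (at t)"
  shows "((\<lambda>t. ev3 r (x t) (y t) p) has_real_derivative
      ev3 r (x t) (y t) (derx p) * x' + ev3 r (x t) (y t) (dery p) * y') (at t)"
proof (induction p)
  case (Cons a p)
  have "((\<lambda>t. ev2 r (x t) a) has_real_derivative ev2 r (x t) (lder add1 [] a) * x') (at t)"
    by (rule DERIV_chain2[OF ev2_lder assms(1)])
  moreover have "dery (a # p) = add3 p ([] # dery p)"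
    by (simp add: dery_def add3_def)
  ultimately show ?case
    using Cons by (auto intro!: derivative_eq_intros assms(2) simp: derx_def algebra_simps)
qed (simp add: derx_def dery_def)

lemma continuous_on_ev3 [continuous_intros]:
  assumes "continuous_on S f" "continuous_on S g"
  shows "continuous_on S (\<lambda>z. ev3 r (f z) (g z) p)"
proof -
  have "continuous_on S (\<lambda>z. ev2 r (f z) a)" for a
    by (induction a) (auto intro!: continuous_intros assms(1))
  then show ?thesis
    by (induction p) (auto intro!: continuous_intros assms(2))
qed

lemma Ham_chain:
  assumes "(x has_real_derivative x') (at t)" "(y has_real_derivative y') (at t)"
  shows "((\<lambda>t. Ham r (x t) (y t)) has_real_derivative
      ev3 r (x t / 2) (y t / 2) KX * x' + ev3 r (x t / 2) (y t / 2) KY * y') (at t)"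
  unfolding Ham_def KX_def KY_def
  by (rule derivative_eq_intros assms refl | simp)+
    (simp add: field_simps eval_nat_numeral)

lemma deriv_Ham:
  "deriv (\<lambda>v. Ham r u v) v = ev3 r (u / 2) (v / 2) KY"
  "deriv (\<lambda>u. Ham r u v) u = ev3 r (u / 2) (v / 2) KX"
  using Ham_chain[where t = v, OF DERIV_const[where k = u] DERIV_ident, of r]
    Ham_chain[where t = u, OF DERIV_ident DERIV_const[where k = v], of r]
  by (simp_all add: DERIV_imp_deriv)

lemma ev3_resid:
  "ev3 r X Y (resid G W b) = ev3 r X Y KY * ev3 r X Y G
     - (ev3 r X Y (derx W) * ev3 r X Y KY - ev3 r X Y (dery W) * ev3 r X Y KX) - ev3 r X Y (radial b)"
  by (simp add: resid_def neg3_def algebra_simps)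

lemma ev3_radial:
  "ev3 r X Y (radial b) = (\<Sum>j<length b. ev1 r (b ! j) * (X ^ 2 + Y ^ 2) ^ Suc j)"
proof (induction b)
  case (Cons c b)
  have "ev3 r X Y RR = X ^ 2 + Y ^ 2"
    by (simp add: RR_def power2_eq_square)
  then show ?case
    using Cons by (simp add: sum.lessThan_Suc_shift sum_distrib_left algebra_simps del: sum.lessThan_Suc)
qed simp

section \<open>Decomposition of the divergence into six coefficient families\<close>

definition Gs :: "poly3 list" where "Gs = [G_c10, G_c01, G_c20, G_c00, G_c02, G_c11]"
definition Ws :: "poly3 list" where "Ws = [W_c10, W_c01, W_c20, W_c00, W_c02, W_c11]"
definition bs :: "poly1 list list" where "bs = [b_c10, b_c01, b_c20, b_c00, b_c02, b_c11]"
text \<open>The last three families will carry weights of size l^12, l^10 and l^8, so the orders 3,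
  5 and 7 already bring their residues to l^15.\<close>

definition orders :: "nat list" where "orders = [15, 15, 15, 3, 5, 7]"

lemma low3_resid: "i < 6 \<Longrightarrow> low3 (orders ! i) (resid (Gs ! i) (Ws ! i) (bs ! i))"
proof -
  have "\<forall>i\<in>set [0,1,2,3,4,5]. low3 (orders ! i) (resid (Gs ! i) (Ws ! i) (bs ! i))"
    by code_simp
  moreover assume "i < 6"
  then have "i \<in> set [0,1,2,3,4,5]" by auto
  ultimately show ?thesis by blast
qed

text \<open>The divisors are the normalisations of the stored data. The arguments x, y, z stand for
  c10, c01, c20, and s0, s1, s2 for the deviations of c00, c02, c11 from their relations; those
  relations themselves are already built into the first three families.\<close>

definition weight :: "real \<Rightarrow> real \<Rightarrow> real \<Rightarrow> real \<Rightarrow> real \<Rightarrow> real \<Rightarrow> nat \<Rightarrow> real" where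
  "weight x y z s0 s1 s2 i = [x / 369008640, y / 23063040, z / 184504320, s0 / 2, s1 / 6, s2 / 30] ! i"

lemma sum6: "(\<Sum>i<6. f i) = f 0 + f 1 + f 2 + f 3 + f 4 + f (5::nat)" for f :: "nat \<Rightarrow> real"
  by (simp add: eval_nat_numeral)

definition Dhat :: "param \<Rightarrow> real \<Rightarrow> real \<Rightarrow> real" where
  "Dhat d u v = c00 d * v + c10 d * u * v + c01 d * v^2 / 2 + c20 d * u^2 * v + c11 d * u * v^2 / 2 + c02 d * v^3 / 3"

lemma Dhat_eq:
  assumes "c00 d = s0" "c02 d = - 3/2 * c10 d + 3 * c01 d - c20 d + s1"
    "c11 d = (12 * r - 191/4) * c10 d + (40 * r + 3) * c01 d + (8 * r - 47/2) * c20 d + s2"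
  shows "Dhat d (2 * X) (2 * Y)
     = 2 * (\<Sum>i<6. weight (c10 d) (c01 d) (c20 d) s0 s1 s2 i * ev3 r X Y (Gs ! i))"
  unfolding sum6 Dhat_def assms
  by (simp add: weight_def Gs_def G_c10_def G_c01_def G_c20_def G_c00_def G_c02_def G_c11_def
      field_simps eval_nat_numeral)

lemma radial_sum:
  "(\<Sum>i<6. weight x y z s0 s1 s2 i * ev3 r X Y (radial (bs ! i)))
   = s0 * (X^2 + Y^2) + s1 * (X^2 + Y^2) ^ 2 - s2 * (X^2 + Y^2) ^ 3
     + (\<Sum>j\<in>{3..6}. beta j r x y z * (X^2 + Y^2) ^ Suc j)"
proof -
  define R where "R = X^2 + Y^2"
  have len: "length b_c10 = 7" "length b_c01 = 7" "length b_c20 = 7"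
    "length b_c00 = 1" "length b_c02 = 2" "length b_c11 = 3" by code_simp+
  \<comment> \<open>The relations for c02 and c11 have removed the first focal values from the
    families of c10, c01 and c20.\<close>
  have zero: "b_c10 ! 0 = []" "b_c10 ! 1 = []" "b_c10 ! 2 = []" "b_c01 ! 0 = []" "b_c01 ! 1 = []" "b_c01 ! 2 = []"
    "b_c20 ! 0 = []" "b_c20 ! 1 = []" "b_c20 ! 2 = []" by code_simp+
  have s7: "(\<Sum>j<7. f j) = f 0 + f 1 + f 2 + (\<Sum>j\<in>{3..6}. f j)" for f :: "nat \<Rightarrow> real"
    by (simp add: eval_nat_numeral)
  have "(\<Sum>i<6. weight x y z s0 s1 s2 i * ev3 r X Y (radial (bs ! i)))
     = x / 369008640 * (\<Sum>j\<in>{3..6}. ev1 r (b_c10 ! j) * R ^ Suc j)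
     + y / 23063040 * (\<Sum>j\<in>{3..6}. ev1 r (b_c01 ! j) * R ^ Suc j)
     + z / 184504320 * (\<Sum>j\<in>{3..6}. ev1 r (b_c20 ! j) * R ^ Suc j)
     + s0 * R + s1 * R ^ 2 - s2 * R ^ 3"
    unfolding sum6 ev3_radial R_def[symmetric]
    by (simp add: weight_def bs_def len s7 zero del: One_nat_def)
      (simp add: b_c00_def b_c02_def b_c11_def eval_nat_numeral)
  also have "x / 369008640 * (\<Sum>j\<in>{3..6}. ev1 r (b_c10 ! j) * R ^ Suc j)
     + y / 23063040 * (\<Sum>j\<in>{3..6}. ev1 r (b_c01 ! j) * R ^ Suc j)
     + z / 184504320 * (\<Sum>j\<in>{3..6}. ev1 r (b_c20 ! j) * R ^ Suc j)
     = (\<Sum>j\<in>{3..6}. beta j r x y z * R ^ Suc j)"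
    unfolding sum_distrib_left sum.distrib[symmetric]
    by (rule sum.cong) (simp_all add: beta_def field_simps)
  finally show ?thesis by (simp add: R_def)
qed

lemma sum_deg3:
  "(\<Sum>i\<le>3. \<Sum>j\<le>3 - i. f i j) = f 0 0 + f 0 1 + f 0 2 + f 0 3 + f 1 0 + f 1 1 + f 1 2 + f 2 0 + f 2 1 + f 3 (0::nat)"
  for f :: "nat \<Rightarrow> nat \<Rightarrow> real"
  by (simp add: eval_nat_numeral)

text \<open>The first integral of the divergence-free part (A_v, - A_u) of the perturbation (p, q); what remains
  is (0, Dhat) with Dhat the v-primitive of the divergence.\<close>

definition Apot :: "(nat \<Rightarrow> nat \<Rightarrow> real) \<Rightarrow> (nat \<Rightarrow> nat \<Rightarrow> real) \<Rightarrow> real \<Rightarrow> real \<Rightarrow> real" where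
  "Apot P Q u v = (\<Sum>i\<le>3. \<Sum>j\<le>3 - i. P i j * u ^ i * v ^ Suc j / real (Suc j))
     - (Q 0 0 * u + Q 1 0 * u ^ 2 / 2 + Q 2 0 * u ^ 3 / 3 + Q 3 0 * u ^ 4 / 4)"

lemma Apot_chain:
  assumes p: "\<And>u v. p u v = (\<Sum>i\<le>3. \<Sum>j\<le>3 - i. P i j * u ^ i * v ^ j)"
    and q: "\<And>u v. q u v = (\<Sum>i\<le>3. \<Sum>j\<le>3 - i. Q i j * u ^ i * v ^ j)"
    and div: "\<And>u v. deriv (\<lambda>u. p u v) u + deriv (\<lambda>v. q u v) v =
                c00 d + c10 d * u + c01 d * v + c20 d * u^2 + c11 d * u * v + c02 d * v^2"
    and xy: "(x has_real_derivative x') (at t)" "(y has_real_derivative y') (at t)"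
  shows "((\<lambda>t. Apot P Q (x t) (y t)) has_real_derivative
     (Dhat d (x t) (y t) - q (x t) (y t)) * x' + p (x t) (y t) * y') (at t)"
proof -
  define Au where "Au u v = (P 1 0 * v + P 1 1 * v^2 / 2 + P 1 2 * v^3 / 3 + P 2 0 * (2 * u) * v
      + P 2 1 * (2 * u) * v^2 / 2 + P 3 0 * (3 * u^2) * v) - (Q 0 0 + Q 1 0 * u + Q 2 0 * u ^ 2 + Q 3 0 * u ^ 3)" for u v
  have A: "((\<lambda>t. Apot P Q (x t) (y t)) has_real_derivative Au (x t) (y t) * x' + p (x t) (y t) * y') (at t)"
    unfolding Apot_def p sum_deg3 Au_def
    by (rule derivative_eq_intros xy refl | simp)+ (simp add: field_simps eval_nat_numeral)
  have dp: "deriv (\<lambda>u. p u v) u = P 1 0 + P 1 1 * v + P 1 2 * v^2 + P 2 0 * (2 * u) + P 2 1 * (2 * u) * v + P 3 0 * (3 * u^2)" for u v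
    unfolding p sum_deg3
    by (rule DERIV_imp_deriv, (rule derivative_eq_intros refl | simp)+)
  \<comment> \<open>\<open>deriv\<close> is only a chosen value; differentiability has to be
    established before the divergence hypothesis can be integrated in v.\<close>
  have dq: "((\<lambda>v. q u v) has_real_derivative deriv (\<lambda>v. q u v) v) (at v)" for u v
  proof -
    have "((\<lambda>v. q u v) has_real_derivative Q 0 1 + Q 0 2 * (2 * v) + Q 0 3 * (3 * v^2) + Q 1 1 * u
       + Q 1 2 * u * (2 * v) + Q 2 1 * u^2) (at v)"
      unfolding q sum_deg3 by (rule derivative_eq_intros refl | simp)+
    then show ?thesis using DERIV_imp_deriv by metis
  qed
  \<comment> \<open>The v-derivative is zero because q_v + p_u is the divergence and so is the
    v-derivative of Dhat. On v = 0 the pure powers of u in \<open>Apot\<close> cancel q, and Dhat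
    vanishes.\<close>
  have "q u v + Au u v - Dhat d u v = 0" for u v
  proof -
    have dA: "((\<lambda>v. Au u v) has_real_derivative deriv (\<lambda>u. p u v) u) (at v)" for v
      unfolding Au_def dp by (rule derivative_eq_intros refl | simp)+
    have dD: "((\<lambda>v. Dhat d u v) has_real_derivative c00 d + c10 d * u + c01 d * v + c20 d * u^2 + c11 d * u * v + c02 d * v^2) (at v)" for v
      unfolding Dhat_def by (rule derivative_eq_intros refl | simp)+
    have "((\<lambda>v. q u v + Au u v - Dhat d u v) has_real_derivative 0) (at v)" for v
      using DERIV_diff[OF DERIV_add[OF dq[of u v] dA[of v]] dD[of v]] div[of v u] by (simp add: add.commute)
    then have "q u v + Au u v - Dhat d u v = q u 0 + Au u 0 - Dhat d u 0"
      by (intro DERIV_isconst_all) auto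
    also have "\<dots> = 0" unfolding q sum_deg3 Au_def Dhat_def by simp
    finally show ?thesis .
  qed
  then have "Au u v = Dhat d u v - q u v" for u v by (simp add: algebra_simps eq_diff_eq)
  with A show ?thesis by simp
qed

lemma null_sum: "finite A \<Longrightarrow> (\<And>j. j \<in> A \<Longrightarrow> null (f j)) \<Longrightarrow> null (\<lambda>l t x. \<Sum>j\<in>A. f j l t x)"
proof (induction A rule: finite_induct)
  case empty
  then show ?case by (simp add: null_def)
next
  case (insert a A)
  then have "null (\<lambda>l t x. f a l t x + (\<Sum>j\<in>A. f j l t x))"
    by (intro null_add) auto
  with insert show ?case by simp
qed

lemma exhaust_6:
  fixes i :: 6
  shows "i = 1 \<or> i = 2 \<or> i = 3 \<or> i = 4 \<or> i = 5 \<or> i = 6"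
proof (induct i)
  case (of_int z)
  then have "z = 0 \<or> z = 1 \<or> z = 2 \<or> z = 3 \<or> z = 4 \<or> z = 5" by auto
  then show ?case by auto
qed

section \<open>The limiting polynomial in x and its simple zeros at sqrt 1, ..., sqrt 6\<close>

definition radial_poly :: "real \<Rightarrow> real" where
  "radial_poly x = (\<Sum>j\<le>6. target j * x ^ (2 * j + 2))"
definition radial_poly' :: "real \<Rightarrow> real" where
  "radial_poly' x = (\<Sum>j\<le>6. target j * (real (2 * j + 2) * x ^ (2 * j + 1)))"

lemma radial_poly_deriv: "(radial_poly has_real_derivative radial_poly' x) (at x)"
  unfolding radial_poly_def radial_poly'_def
proof (intro DERIV_sum DERIV_cmult)
  fix j :: nat
  show "((\<lambda>x. x ^ (2 * j + 2)) has_real_derivative real (2 * j + 2) * x ^ (2 * j + 1)) (at x)"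
    using DERIV_pow[of "2 * j + 2" x] by simp
qed

lemma radial_poly_zero:
  assumes "1 \<le> k" "k \<le> 6"
  shows "radial_poly (sqrt (real k)) = 0" "radial_poly' (sqrt (real k)) \<noteq> 0"
proof -
  have "k = 1 \<or> k = 2 \<or> k = 3 \<or> k = 4 \<or> k = 5 \<or> k = 6" using assms by linarith
  then have *: "(\<Sum>j\<le>6. target j * real k ^ Suc j) = 0" "(\<Sum>j\<le>6. target j * (real (2 * j + 2) * real k ^ j)) \<noteq> 0"
    by (elim disjE; simp add: target_def eval_nat_numeral)+
  have even: "sqrt (real k) ^ (2 * j + 2) = real k ^ Suc j" "sqrt (real k) ^ (2 * j + 1) = real k ^ j * sqrt (real k)" for j
    by (simp_all add: power_add power_mult power2_eq_square)
  have "radial_poly (sqrt (real k)) = (\<Sum>j\<le>6. target j * real k ^ Suc j)"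
    unfolding radial_poly_def even ..
  then show "radial_poly (sqrt (real k)) = 0" using *(1) by simp
  have "radial_poly' (sqrt (real k)) = (\<Sum>j\<le>6. target j * (real (2 * j + 2) * real k ^ j)) * sqrt (real k)"
    unfolding radial_poly'_def even sum_distrib_right by (simp add: mult.assoc)
  then show "radial_poly' (sqrt (real k)) \<noteq> 0" using *(2) assms by simp
qed

lemma sqrt_le_5_2: "k \<le> 6 \<Longrightarrow> sqrt (real k) \<le> 5 / 2"
  by (rule real_le_lsqrt) (auto simp: power2_eq_square)

section \<open>Assembly of the six cycles along a curve of parameters\<close>

lemma six_families:
  fixes p q :: "real \<Rightarrow> real \<Rightarrow> param \<Rightarrow> real"
    and P Q :: "nat \<Rightarrow> nat \<Rightarrow> param \<Rightarrow> real"
    and d0 :: param and r0 :: real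
  assumes p_poly: "\<And>u v d. p u v d = (\<Sum>i\<le>3. \<Sum>j\<le>3 - i. P i j d * u ^ i * v ^ j)"
    and q_poly: "\<And>u v d. q u v d = (\<Sum>i\<le>3. \<Sum>j\<le>3 - i. Q i j d * u ^ i * v ^ j)"
    and P_lin: "\<And>i j. linear (P i j)"
    and Q_lin: "\<And>i j. linear (Q i j)"
    and div: "\<And>u v d. deriv (\<lambda>u. p u v d) u + deriv (\<lambda>v. q u v d) v =
                c00 d + c10 d * u + c01 d * v + c20 d * u^2 + c11 d * u * v + c02 d * v^2"
    and f0: "fpoly r0 = 0"
    and h00: "c00 d0 = 0"
    and h02: "c02 d0 = - 3/2 * c10 d0 + 3 * c01 d0 - c20 d0"
    and h01: "c01 d0 \<noteq> 0"
    and h11: "c11 d0 = (12 * r0 - 191/4) * c10 d0 + (40 * r0 + 3) * c01 d0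
                       + (8 * r0 - 47/2) * c20 d0"
    and h10: "c10 d0 = 2 / ev1 r0 pM * (ev1 r0 pA * c01 d0 + ev1 r0 pB * c20 d0)"
    and h20: "c20 d0 = ev1 r0 pN / (2 * ev1 r0 pD) * c01 d0"
  obtains r :: "real \<Rightarrow> real" and d :: "real \<Rightarrow> param" where
    "(r \<longlongrightarrow> r0) (at_right 0)" "(d \<longlongrightarrow> d0) (at_right 0)"
    "\<And>k::nat. 1 \<le> k \<Longrightarrow> k \<le> 6 \<Longrightarrow> \<forall>\<^sub>F l in at_right 0. \<exists>\<Gamma>. limit_cycle (field p q (l ^ 15) (d l) (r l)) \<Gamma> \<and>
        \<Gamma> \<subseteq> {z. 2 * l * (sqrt (real k) - 1/40) < norm z \<and> norm z < 2 * l * (sqrt (real k) + 1/40)}"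
proof -
  define y where "y = c01 d0"
  obtain \<tau> r cx cz s0 s1 s2 B where \<tau>: "\<tau> \<noteq> 0" and r: "(r \<longlongrightarrow> r0) (at_right 0)"
    and cz: "(cz \<longlongrightarrow> c20 d0) (at_right 0)" and cx: "(cx \<longlongrightarrow> c10 d0) (at_right 0)"
    and B: "\<And>j. j \<le> 6 \<Longrightarrow> (B j \<longlongrightarrow> \<tau> * target j) (at_right 0)"
    and s: "\<And>l. s0 l = l ^ 12 * B 0 l" "\<And>l. s1 l = l ^ 10 * B 1 l" "\<And>l. s2 l = - (l ^ 8 * B 2 l)"
    and beta: "\<And>j. 3 \<le> j \<Longrightarrow> j \<le> 6 \<Longrightarrow>
      \<forall>\<^sub>F l in at_right 0. beta j (r l) (cx l) y (cz l) = l ^ (12 - 2 * j) * B j l"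
    by (rule parameters[OF f0 h01, folded h20, folded h10, folded y_def]) (rule that)
  have s_lim: "(s0 \<longlongrightarrow> 0) (at_right 0)" "(s1 \<longlongrightarrow> 0) (at_right 0)" "(s2 \<longlongrightarrow> 0) (at_right 0)"
  proof -
    have "((\<lambda>l. l ^ 12 * B 0 l) \<longlongrightarrow> 0 ^ 12 * (\<tau> * target 0)) (at_right 0)"
      "((\<lambda>l. l ^ 10 * B 1 l) \<longlongrightarrow> 0 ^ 10 * (\<tau> * target 1)) (at_right 0)"
      "((\<lambda>l. - (l ^ 8 * B 2 l)) \<longlongrightarrow> - (0 ^ 8 * (\<tau> * target 2))) (at_right 0)"
      by (intro tendsto_intros B; simp)+
    then show "(s0 \<longlongrightarrow> 0) (at_right 0)" "(s1 \<longlongrightarrow> 0) (at_right 0)" "(s2 \<longlongrightarrow> 0) (at_right 0)"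
      by (simp_all add: s[abs_def])
  qed
  \<comment> \<open>The components are ordered c00, c10, c01, c02, c11, c20. The relations for c02
    and c11 are kept at the moving r l, up to the deviations \<open>s1\<close> and
    \<open>s2\<close>, while c01 stays fixed.\<close>
  define d :: "real \<Rightarrow> param" where "d l = (\<chi> i. if i = 1 then s0 l else if i = 2 then cx l else if i = 3 then y
    else if i = 4 then - 3/2 * cx l + 3 * y - cz l + s1 l
    else if i = 5 then (12 * r l - 191/4) * cx l + (40 * r l + 3) * y + (8 * r l - 47/2) * cz l + s2 l
    else cz l)" for l
  have d_comp: "c00 (d l) = s0 l" "c10 (d l) = cx l" "c01 (d l) = y" "c20 (d l) = cz l"
    "c02 (d l) = - 3/2 * cx l + 3 * y - cz l + s1 l"
    "c11 (d l) = (12 * r l - 191/4) * cx l + (40 * r l + 3) * y + (8 * r l - 47/2) * cz l + s2 l" for l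
    by (simp_all add: c00_def c10_def c01_def c02_def c11_def c20_def d_def)
  have d: "(d \<longlongrightarrow> d0) (at_right 0)"
  proof (rule vec_tendstoI)
    fix i :: 6
    have "((\<lambda>l. c00 (d l)) \<longlongrightarrow> c00 d0) (at_right 0)" "((\<lambda>l. c10 (d l)) \<longlongrightarrow> c10 d0) (at_right 0)"
      "((\<lambda>l. c01 (d l)) \<longlongrightarrow> c01 d0) (at_right 0)" "((\<lambda>l. c20 (d l)) \<longlongrightarrow> c20 d0) (at_right 0)"
      unfolding d_comp h00 y_def by (intro s_lim cx cz tendsto_const)+
    moreover have "((\<lambda>l. c02 (d l)) \<longlongrightarrow> - 3/2 * c10 d0 + 3 * c01 d0 - c20 d0 + 0) (at_right 0)"
      "((\<lambda>l. c11 (d l)) \<longlongrightarrow> (12 * r0 - 191/4) * c10 d0 + (40 * r0 + 3) * c01 d0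
                       + (8 * r0 - 47/2) * c20 d0 + 0) (at_right 0)"
      unfolding d_comp y_def by (intro tendsto_intros s_lim cx cz r)+
    then have "((\<lambda>l. c02 (d l)) \<longlongrightarrow> c02 d0) (at_right 0)" "((\<lambda>l. c11 (d l)) \<longlongrightarrow> c11 d0) (at_right 0)"
      by (simp_all add: h02 h11)
    ultimately show "((\<lambda>l. d l $ i) \<longlongrightarrow> d0 $ i) (at_right 0)"
      using exhaust_6[of i] unfolding c00_def c10_def c01_def c02_def c11_def c20_def by auto
  qed
  have coeff: "tame (\<lambda>l t x. P i j (d l))" "tame (\<lambda>l t x. Q i j (d l))" for i j
    using P_lin[of i j] Q_lin[of i j]
    by (auto intro!: tame_tendsto bounded_linear.tendsto[OF _ d] simp: linear_conv_bounded_linear)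
  have r_bdd: "Bfun r (at_right 0)"
    using r unfolding Bfun_metric_def by (intro exI[of _ r0] exI[of _ 1]) (auto dest!: tendstoD[of _ _ _ 1] elim: eventually_mono)
  define a where "a l i = weight (cx l) y (cz l) (s0 l) (s1 l) (s2 l) i" for l i
  have a_tame: "tame (\<lambda>l t x. a l i)" if "i < 6" for i
  proof -
    have "tame (\<lambda>l t x. c * cx l)" "tame (\<lambda>l t x. c * cz l)" "tame (\<lambda>l t x. c * s0 l)" "tame (\<lambda>l t x. c * s1 l)"
      "tame (\<lambda>l t x. c * s2 l)" for c :: real
      by (intro tame_intros tame_tendsto[OF cx] tame_tendsto[OF cz] tame_tendsto[OF s_lim(1)]
          tame_tendsto[OF s_lim(2)] tame_tendsto[OF s_lim(3)])+
    from this[of "1/369008640"] this[of "1/184504320"] this[of "1/2"] this[of "1/6"] this[of "1/30"]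
    have "\<forall>i\<in>{0,1,2,3,4,5}. tame (\<lambda>l t x. a l i)"
      by (simp add: a_def weight_def tame_const)
    moreover have "i \<in> {0,1,2,3,4,5}" using that by auto
    ultimately show ?thesis by blast
  qed
  define pp where "pp l t x = p (2 * l * x * sin t) (2 * l * x * cos t) (d l)" for l t x
  define qq where "qq l t x = q (2 * l * x * sin t) (2 * l * x * cos t) (d l)" for l t x
  have pp: "tame pp" and qq: "tame qq"
    unfolding pp_def qq_def p_poly q_poly by (intro tame_intros coeff)+
  \<comment> \<open>Together with \<open>ay\<close>, the gradient of the order-eps part of V; the
    factor 2 in front of W cancels against the halved arguments.\<close>
  define ax where "ax l u v = (Dhat (d l) u v - q u v (d l)) / 2
     - (\<Sum>i<6. a l i * ev3 (r l) (u / 2) (v / 2) (derx (Ws ! i)))" for l u v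
  define ay where "ay l u v = p u v (d l) / 2
     - (\<Sum>i<6. a l i * ev3 (r l) (u / 2) (v / 2) (dery (Ws ! i)))" for l u v
  define V where "V l u v = Ham (r l) u v / 2 + l ^ 15 * (Apot (\<lambda>i j. P i j (d l)) (\<lambda>i j. Q i j (d l)) u v / 2
     - (\<Sum>i<6. 2 * a l i * ev3 (r l) (u / 2) (v / 2) (Ws ! i)))" for l u v
  define Vx where "Vx l u v = ev3 (r l) (u / 2) (v / 2) KX / 2 + l ^ 15 * ax l u v" for l u v
  define Vy where "Vy l u v = ev3 (r l) (u / 2) (v / 2) KY / 2 + l ^ 15 * ay l u v" for l u v
  have V_deriv: "((\<lambda>t. V l (x t) (y t)) has_real_derivative Vx l (x t) (y t) * x' + Vy l (x t) (y t) * y') (at t)"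
    if xy: "(x has_real_derivative x') (at t)" "(y has_real_derivative y') (at t)" for l x y x' y' t
  proof -
    have half: "((\<lambda>t. x t / 2) has_real_derivative x' / 2) (at t)" "((\<lambda>t. y t / 2) has_real_derivative y' / 2) (at t)"
      using DERIV_cdivide[OF xy(1)] DERIV_cdivide[OF xy(2)] by auto
    have A: "((\<lambda>t. Apot (\<lambda>i j. P i j (d l)) (\<lambda>i j. Q i j (d l)) (x t) (y t)) has_real_derivative
       (Dhat (d l) (x t) (y t) - q (x t) (y t) (d l)) * x' + p (x t) (y t) (d l) * y') (at t)"
      by (rule Apot_chain[OF p_poly q_poly div xy])
    have W: "((\<lambda>t. \<Sum>i<6. 2 * a l i * ev3 (r l) (x t / 2) (y t / 2) (Ws ! i)) has_real_derivative
       (\<Sum>i<6. 2 * a l i * (ev3 (r l) (x t / 2) (y t / 2) (derx (Ws ! i)) * (x' / 2)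
         + ev3 (r l) (x t / 2) (y t / 2) (dery (Ws ! i)) * (y' / 2)))) (at t)"
      by (intro DERIV_sum DERIV_cmult ev3_chain half)
    have "(\<Sum>i<6. 2 * a l i * (ev3 (r l) (x t / 2) (y t / 2) (derx (Ws ! i)) * (x' / 2)
         + ev3 (r l) (x t / 2) (y t / 2) (dery (Ws ! i)) * (y' / 2)))
      = (\<Sum>i<6. a l i * ev3 (r l) (x t / 2) (y t / 2) (derx (Ws ! i))) * x'
        + (\<Sum>i<6. a l i * ev3 (r l) (x t / 2) (y t / 2) (dery (Ws ! i))) * y'"
      unfolding sum_distrib_right sum.distrib[symmetric] by (rule sum.cong) (simp_all add: algebra_simps)
    with DERIV_add[OF DERIV_cdivide[OF Ham_chain[OF xy, of "r l"], of 2]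
        DERIV_cmult[OF DERIV_diff[OF DERIV_cdivide[OF A, of 2] W], of "l ^ 15"]]
    show ?thesis
      unfolding V_def Vx_def Vy_def ax_def ay_def by (simp add: field_simps)
  qed
  define X where "X l t x = l * (x * sin t)" for l t x :: real
  define Y where "Y l t x = l * (x * cos t)" for l t x :: real
  have XY: "2 * l * x * sin t / 2 = X l t x" "2 * l * x * cos t / 2 = Y l t x"
     "2 * l * x * sin t = 2 * X l t x" "2 * l * x * cos t = 2 * Y l t x" for l t x :: real
    by (simp_all add: X_def Y_def)
  have XY_tame: "tame X" "tame Y" unfolding X_def Y_def by (intro tame_intros)+
  have R: "X l t x ^ 2 + Y l t x ^ 2 = l ^ 2 * x ^ 2" for l t x
  proof -
    have "X l t x ^ 2 + Y l t x ^ 2 = l ^ 2 * x ^ 2 * ((sin t)\<^sup>2 + (cos t)\<^sup>2)"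
      unfolding X_def Y_def by (simp only: power_mult_distrib distrib_left mult.assoc)
    then show ?thesis by simp
  qed
  define axx where "axx l t x = ax l (2 * l * x * sin t) (2 * l * x * cos t)" for l t x
  define ayy where "ayy l t x = ay l (2 * l * x * sin t) (2 * l * x * cos t)" for l t x
  have tame_half: "tame f \<Longrightarrow> tame (\<lambda>l t x. f l t x / 2)" for f
    using tame_mult[OF tame_const[of "1/2"]] by simp
  have axx: "tame axx" and ayy: "tame ayy"
  proof -
    have "tame (\<lambda>l t x. c00 (d l))" "tame (\<lambda>l t x. c10 (d l))" "tame (\<lambda>l t x. c01 (d l))"
      "tame (\<lambda>l t x. c20 (d l))" "tame (\<lambda>l t x. c11 (d l))" "tame (\<lambda>l t x. c02 (d l))"
      unfolding c00_def c10_def c01_def c20_def c11_def c02_def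
      by (rule tame_tendsto[OF tendsto_vec_nth[OF d]])+
    note c = this
    have D: "tame (\<lambda>l t x. Dhat (d l) (2 * l * x * sin t) (2 * l * x * cos t))"
      unfolding Dhat_def divide_inverse by (intro tame_intros c)
    show "tame axx" unfolding axx_def ax_def XY(1,2)
      by (intro tame_diff tame_half D qq[unfolded qq_def] tame_sum tame_mult a_tame tame_ev3 r_bdd XY_tame) auto
    show "tame ayy" unfolding ayy_def ay_def XY(1,2)
      by (intro tame_diff tame_half pp[unfolded pp_def] tame_sum tame_mult a_tame tame_ev3 r_bdd XY_tame) auto
  qed
  \<comment> \<open>Together with \<open>ky\<close>, the quadratic and cubic terms of the gradient
    of K at the scaled point, with l^2 taken out.\<close>
  define kx where "kx l t x = - 6 * (x * sin t)^2 + l * (4 * (x * sin t)^3 - 8 * (x * cos t)^3)" for l t x :: real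
  define ky where "ky l t x = 12 * (x * cos t)^2 + l * (32 * r l * (x * cos t)^3 - 24 * (x * sin t) * (x * cos t)^2)" for l t x :: real
  have kx: "tame kx" and ky: "tame ky"
    unfolding kx_def ky_def by (intro tame_intros tame_tendsto[OF r])+
  have KX: "ev3 (r l) (X l t x) (Y l t x) KX = l * (2 * x * sin t + l * kx l t x)"
    and KY: "ev3 (r l) (X l t x) (Y l t x) KY = l * (2 * x * cos t + l * ky l t x)" for l t x
    unfolding X_def Y_def KX_def KY_def kx_def ky_def
    by (simp_all add: algebra_simps eval_nat_numeral)
  \<comment> \<open>Of eps = l^15 the power l^13 remains, one factor l being the scale of the point
    and a second one standing in front of \<open>f1\<close>.\<close>
  define f1 where "f1 l t x = ky l t x + l ^ 13 * pp l t x" for l t x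
  define f2 where "f2 l t x = - kx l t x + l ^ 13 * qq l t x" for l t x
  define v1 where "v1 l t x = (kx l t x * sin t + ky l t x * cos t) / 2 + l ^ 13 * (axx l t x * sin t + ayy l t x * cos t)" for l t x
  have f1: "tame f1" and f2: "tame f2" unfolding f1_def f2_def by (intro tame_intros kx ky pp qq)+
  have v1: "tame v1" unfolding v1_def by (intro tame_add tame_half tame_intros kx ky axx ayy)
  have l15: "l ^ 15 = l * (l * l ^ 13)" for l :: real by (simp add: eval_nat_numeral)
  have F_eq: "field p q (l ^ 15) (d l) (r l) (2 * l * x * sin t, 2 * l * x * cos t)
     = (ev3 (r l) (X l t x) (Y l t x) KY + l ^ 15 * pp l t x, - ev3 (r l) (X l t x) (Y l t x) KX + l ^ 15 * qq l t x)" for l t x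
    by (simp add: field_def deriv_Ham XY pp_def qq_def)
  have F: "field p q (l ^ 15) (d l) (r l) (2 * l * x * sin t, 2 * l * x * cos t)
     = (l * (2 * x * cos t + l * f1 l t x), l * (- 2 * x * sin t + l * f2 l t x))" for l t x
    unfolding F_eq unfolding KX KY f1_def f2_def l15 by (simp add: algebra_simps)
  have Vr: "Vx l (2 * l * x * sin t) (2 * l * x * cos t) * sin t
         + Vy l (2 * l * x * sin t) (2 * l * x * cos t) * cos t = l * (x + l * v1 l t x)" for l t x
  proof -
    have "Vx l (2 * l * x * sin t) (2 * l * x * cos t) * sin t + Vy l (2 * l * x * sin t) (2 * l * x * cos t) * cos t
      = l * (x * ((sin t)\<^sup>2 + (cos t)\<^sup>2) + l * v1 l t x)"
      unfolding Vx_def Vy_def axx_def[symmetric] ayy_def[symmetric] XY(1,2) KX KY v1_def l15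
      by (simp only: power2_eq_square) (simp add: field_simps del: sin_cos_squared_add3)
    then show ?thesis by simp
  qed
  obtain hres where hres: "tame hres" "\<And>l t x. (\<Sum>i<6. a l i * ev3 (r l) (X l t x) (Y l t x) (resid (Gs ! i) (Ws ! i) (bs ! i))) = l ^ 15 * hres l t x"
  proof -
    have B_tame: "tame (\<lambda>l t x. B j l)" if "j \<le> 6" for j by (rule tame_tendsto[OF B[OF that]])
    have "\<exists>h. tame h \<and> (\<forall>l t x. a l i * ev3 (r l) (X l t x) (Y l t x) (resid (Gs ! i) (Ws ! i) (bs ! i)) = l ^ 15 * h l t x)"
      if i: "i < 6" for i
    proof -
      have "tame (\<lambda>l t x. x * sin t)" "tame (\<lambda>l t x. x * cos t)" by (intro tame_intros)+
      from low3_scale[OF low3_resid[OF i] r_bdd this] obtain h where h: "tame h"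
        "\<And>l t x. ev3 (r l) (X l t x) (Y l t x) (resid (Gs ! i) (Ws ! i) (bs ! i)) = l ^ (orders ! i) * h l t x"
        unfolding X_def Y_def by blast
      obtain b where b: "tame b" "\<And>l t x. a l i * l ^ (orders ! i) = l ^ 15 * b l t x"
      proof -
        have "i = 0 \<or> i = 1 \<or> i = 2 \<or> i = 3 \<or> i = 4 \<or> i = 5" using i by linarith
        then consider "orders ! i = 15" | "i = 3" | "i = 4" | "i = 5" by (auto simp: orders_def)
        then show ?thesis
        proof cases
          case 1 then show ?thesis by (intro that[of "\<lambda>l t x. a l i"] a_tame i) simp
        next
          case 2 then show ?thesis
            by (intro that[of "\<lambda>l t x. 1 / 2 * B 0 l"] tame_intros B_tame)
              (simp_all add: orders_def a_def weight_def s eval_nat_numeral)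
        next
          case 3 then show ?thesis
            by (intro that[of "\<lambda>l t x. 1 / 6 * B 1 l"] tame_intros B_tame)
              (simp_all add: orders_def a_def weight_def s eval_nat_numeral)
        next
          case 4 then show ?thesis
            by (intro that[of "\<lambda>l t x. - 1 / 30 * B 2 l"] tame_intros B_tame)
              (simp_all add: orders_def a_def weight_def s eval_nat_numeral)
        qed
      qed
      have "a l i * ev3 (r l) (X l t x) (Y l t x) (resid (Gs ! i) (Ws ! i) (bs ! i)) = l ^ 15 * (b l t x * h l t x)" for l t x
        unfolding h(2) using b(2)[of l t x] by (simp add: mult.assoc[symmetric])
      then show ?thesis using tame_mult[OF b(1) h(1)] by blast
    qed
    then obtain H where H: "\<And>i. i < 6 \<Longrightarrow> tame (H i)"
      "\<And>i l t x. i < 6 \<Longrightarrow> a l i * ev3 (r l) (X l t x) (Y l t x) (resid (Gs ! i) (Ws ! i) (bs ! i)) = l ^ 15 * H i l t x"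
      by metis
    show ?thesis
      by (rule that[of "\<lambda>l t x. \<Sum>i<6. H i l t x"]) (auto intro!: tame_sum H(1) simp: H(2) sum_distrib_left)
  qed
  \<comment> \<open>Three sources of error: the distance of the focal values from their limits, the
    residues of order 15, and the terms quadratic in eps. In units of l^29 the last two are l times
    a tame term.\<close>
  define n where "n l t x = (\<Sum>j\<le>6. (B j l - \<tau> * target j) * x ^ (2 * j + 2))
     + l * (hres l t x + (axx l t x * pp l t x + ayy l t x * qq l t x))" for l t x
  have n: "null n" unfolding n_def
  proof (intro null_add null_sum null_l_times_tame null_param_times_tame)
    fix j :: nat assume "j \<in> {..6}"
    then show "((\<lambda>l. B j l - \<tau> * target j) \<longlongrightarrow> 0) (at_right 0)" using B[of j] by (simp add: LIM_zero_iff)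
  qed (intro tame_intros hres(1) axx ayy pp qq | simp)+
  define \<phi> where "\<phi> x = \<tau> * radial_poly x" for x
  have Vdot: "\<forall>\<^sub>F l in at_right 0. l ^ 29 > 0 \<and> (\<forall>t. \<forall>x\<in>{1/2..3}.
       Vx l (2 * l * x * sin t) (2 * l * x * cos t) * fst (field p q (l ^ 15) (d l) (r l) (2 * l * x * sin t, 2 * l * x * cos t))
         + Vy l (2 * l * x * sin t) (2 * l * x * cos t) * snd (field p q (l ^ 15) (d l) (r l) (2 * l * x * sin t, 2 * l * x * cos t))
       = l ^ 29 * (\<phi> x + n l t x))"
  proof -
    have ev: "\<forall>\<^sub>F l in at_right 0. \<forall>j\<in>{3..6}. beta j (r l) (cx l) y (cz l) = l ^ (12 - 2 * j) * B j l"
      by (intro eventually_ball_finite ballI beta) auto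
    have "\<forall>\<^sub>F l in at_right (0::real). 0 < l" by (rule eventually_at_right_less)
    from this ev show ?thesis
    proof (eventually_elim, intro conjI allI ballI)
      fix l t x :: real
      assume bt: "\<forall>j\<in>{3..6}. beta j (r l) (cx l) y (cz l) = l ^ (12 - 2 * j) * B j l"
      define Kx Ky where "Kx = ev3 (r l) (X l t x) (Y l t x) KX" and "Ky = ev3 (r l) (X l t x) (Y l t x) KY"
      define G where "G i = ev3 (r l) (X l t x) (Y l t x) (Gs ! i)" for i
      define Wx where "Wx i = ev3 (r l) (X l t x) (Y l t x) (derx (Ws ! i))" for i
      define Wy where "Wy i = ev3 (r l) (X l t x) (Y l t x) (dery (Ws ! i))" for i
      define S where "S = (\<Sum>j\<le>6. B j l * x ^ (2 * j + 2))"
      \<comment> \<open>The bound on j makes the natural subtraction exact, so that the exponents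
        add up to 14 for every j.\<close>
      have scale: "l ^ (12 - 2 * j) * B j l * (l ^ 2 * x ^ 2) ^ Suc j = l ^ 14 * (B j l * x ^ (2 * j + 2))" if "j \<le> 6" for j
      proof -
        have "l ^ (12 - 2 * j) * l ^ (2 * j + 2) = l ^ ((12 - 2 * j) + (2 * j + 2))"
          by (rule power_add[symmetric])
        also have "(12 - 2 * j) + (2 * j + 2) = 14" using that by linarith
        finally have l14: "l ^ (12 - 2 * j) * l ^ (2 * j + 2) = l ^ 14" .
        have R': "(l ^ 2 * x ^ 2) ^ Suc j = l ^ (2 * j + 2) * x ^ (2 * j + 2)"
          by (simp add: power_mult_distrib power_mult power_add power2_eq_square mult_ac)
        show ?thesis unfolding l14[symmetric] R' by (simp only: mult_ac)
      qed
      have rad: "(\<Sum>i<6. a l i * ev3 (r l) (X l t x) (Y l t x) (radial (bs ! i))) = l ^ 14 * S"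
      proof -
        have "(\<Sum>i<6. a l i * ev3 (r l) (X l t x) (Y l t x) (radial (bs ! i)))
          = l ^ (12 - 2 * 0) * B 0 l * (l ^ 2 * x ^ 2) ^ Suc 0 + l ^ (12 - 2 * 1) * B 1 l * (l ^ 2 * x ^ 2) ^ Suc 1
            + l ^ (12 - 2 * 2) * B 2 l * (l ^ 2 * x ^ 2) ^ Suc 2
            + (\<Sum>j\<in>{3..6}. l ^ (12 - 2 * j) * B j l * (l ^ 2 * x ^ 2) ^ Suc j)"
          unfolding a_def radial_sum R using bt
          by (simp add: s eval_nat_numeral)
        also have "\<dots> = l ^ 14 * (B 0 l * x ^ (2 * 0 + 2)) + l ^ 14 * (B 1 l * x ^ (2 * 1 + 2))
            + l ^ 14 * (B 2 l * x ^ (2 * 2 + 2)) + (\<Sum>j\<in>{3..6}. l ^ 14 * (B j l * x ^ (2 * j + 2)))"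
          by (intro arg_cong2[where f = "(+)"] sum.cong scale refl) auto
        also have "\<dots> = l ^ 14 * (B 0 l * x ^ (2 * 0 + 2) + B 1 l * x ^ (2 * 1 + 2)
            + B 2 l * x ^ (2 * 2 + 2) + (\<Sum>j\<in>{3..6}. B j l * x ^ (2 * j + 2)))"
          by (simp only: distrib_left sum_distrib_left)
        also have "B 0 l * x ^ (2 * 0 + 2) + B 1 l * x ^ (2 * 1 + 2)
            + B 2 l * x ^ (2 * 2 + 2) + (\<Sum>j\<in>{3..6}. B j l * x ^ (2 * j + 2)) = S"
          unfolding S_def by (simp add: eval_nat_numeral)
        finally show ?thesis .
      qed
      have Dh: "Dhat (d l) (2 * X l t x) (2 * Y l t x) = 2 * (\<Sum>i<6. a l i * G i)"
        unfolding a_def G_def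
        using Dhat_eq[of "d l" "s0 l" "s1 l" "r l" "s2 l" "X l t x" "Y l t x"] by (simp add: d_comp)
      have ax_eq: "axx l t x = ((\<Sum>i<6. a l i * G i) - qq l t x / 2) - (\<Sum>i<6. a l i * Wx i)"
        unfolding axx_def ax_def XY(1,2) qq_def Wx_def by (simp add: XY(3,4) Dh)
      have ay_eq: "ayy l t x = pp l t x / 2 - (\<Sum>i<6. a l i * Wy i)"
        unfolding ayy_def ay_def XY(1,2) pp_def Wy_def ..
      have "Ky * (\<Sum>i<6. a l i * G i) - ((\<Sum>i<6. a l i * Wx i) * Ky - (\<Sum>i<6. a l i * Wy i) * Kx)
        = (\<Sum>i<6. a l i * (Ky * G i - (Wx i * Ky - Wy i * Kx)))"
        unfolding sum_distrib_left sum_distrib_right sum_subtractf[symmetric]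
        by (rule sum.cong) (simp_all add: algebra_simps)
      also have "\<dots> = (\<Sum>i<6. a l i * ev3 (r l) (X l t x) (Y l t x) (resid (Gs ! i) (Ws ! i) (bs ! i))
          + a l i * ev3 (r l) (X l t x) (Y l t x) (radial (bs ! i)))"
        unfolding ev3_resid G_def Wx_def Wy_def Kx_def Ky_def
        by (rule sum.cong) (simp_all add: algebra_simps)
      also have "\<dots> = l ^ 15 * hres l t x + l ^ 14 * S"
        unfolding sum.distrib hres(2) rad ..
      finally have main: "Ky * (\<Sum>i<6. a l i * G i) - ((\<Sum>i<6. a l i * Wx i) * Ky - (\<Sum>i<6. a l i * Wy i) * Kx)
        = l ^ 15 * hres l t x + l ^ 14 * S" .
      have "Vx l (2 * l * x * sin t) (2 * l * x * cos t) * fst (field p q (l ^ 15) (d l) (r l) (2 * l * x * sin t, 2 * l * x * cos t))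
         + Vy l (2 * l * x * sin t) (2 * l * x * cos t) * snd (field p q (l ^ 15) (d l) (r l) (2 * l * x * sin t, 2 * l * x * cos t))
        = (Kx / 2 + l ^ 15 * axx l t x) * (Ky + l ^ 15 * pp l t x) + (Ky / 2 + l ^ 15 * ayy l t x) * (- Kx + l ^ 15 * qq l t x)"
        unfolding F_eq Vx_def Vy_def XY(1,2) axx_def ayy_def Kx_def Ky_def by simp
      \<comment> \<open>The terms free of eps cancel because H is constant along its own Hamiltonian
        field.\<close>
      also have "\<dots> = l ^ 15 * (Kx * pp l t x / 2 + Ky * qq l t x / 2 + axx l t x * Ky - ayy l t x * Kx)
          + l ^ 15 * (l ^ 15 * (axx l t x * pp l t x + ayy l t x * qq l t x))"
        by (simp add: algebra_simps)
      \<comment> \<open>The values of p and q drop out: A / 2 absorbs the divergence-free part of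
        the perturbation, and only the G-terms of Dhat and the corrections W remain.\<close>
      also have "Kx * pp l t x / 2 + Ky * qq l t x / 2 + axx l t x * Ky - ayy l t x * Kx
         = Ky * (\<Sum>i<6. a l i * G i) - ((\<Sum>i<6. a l i * Wx i) * Ky - (\<Sum>i<6. a l i * Wy i) * Kx)"
        unfolding ax_eq ay_eq by (simp add: algebra_simps)
      also have "\<dots> = l ^ 15 * hres l t x + l ^ 14 * S" by (rule main)
      also have "l ^ 15 * (l ^ 15 * hres l t x + l ^ 14 * S)
          + l ^ 15 * (l ^ 15 * (axx l t x * pp l t x + ayy l t x * qq l t x))
        = l ^ 29 * (S + l * (hres l t x + (axx l t x * pp l t x + ayy l t x * qq l t x)))"
      proof -
        have l15: "l ^ 15 = l ^ 14 * l" by (simp add: eval_nat_numeral)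
        have l29: "l ^ 29 = l ^ 15 * l ^ 14" by (simp add: power_add[symmetric])
        show ?thesis unfolding l29 by (subst (2 4) l15) (simp add: algebra_simps)
      qed
      also have "S + l * (hres l t x + (axx l t x * pp l t x + ayy l t x * qq l t x)) = \<phi> x + n l t x"
        unfolding S_def n_def \<phi>_def radial_poly_def
        by (simp add: left_diff_distrib sum_subtractf sum_distrib_left mult.assoc)
      finally show "Vx l (2 * l * x * sin t) (2 * l * x * cos t) * fst (field p q (l ^ 15) (d l) (r l) (2 * l * x * sin t, 2 * l * x * cos t))
         + Vy l (2 * l * x * sin t) (2 * l * x * cos t) * snd (field p q (l ^ 15) (d l) (r l) (2 * l * x * sin t, 2 * l * x * cos t))
       = l ^ 29 * (\<phi> x + n l t x)" .
    qed simp
  qed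
  show ?thesis
  proof (rule that[OF r d])
    fix k :: nat assume k: "1 \<le> k" "k \<le> 6"
    show "\<forall>\<^sub>F l in at_right 0. \<exists>\<Gamma>. limit_cycle (field p q (l ^ 15) (d l) (r l)) \<Gamma> \<and>
        \<Gamma> \<subseteq> {z. 2 * l * (sqrt (real k) - 1/40) < norm z \<and> norm z < 2 * l * (sqrt (real k) + 1/40)}"
    proof (rule eventually_limit_cycle[where V = V and Vx = Vx and Vy = Vy and \<phi> = \<phi>
          and \<phi>' = "\<lambda>x. \<tau> * radial_poly' x", OF _ V_deriv f1 f2 v1 n _ _ _ Vdot])
      show "\<forall>\<^sub>F l in at_right 0. continuous_on UNIV (field p q (l ^ 15) (d l) (r l))"
        unfolding field_def deriv_Ham p_poly q_poly by (intro always_eventually allI continuous_intros) auto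
      show "tame (\<lambda>l t. \<phi>)" unfolding \<phi>_def radial_poly_def by (intro tame_intros)
      show "(\<phi> has_real_derivative \<tau> * radial_poly' x) (at x)" for x
        unfolding \<phi>_def by (rule DERIV_cmult[OF radial_poly_deriv])
      show "isCont (\<lambda>x. \<tau> * radial_poly' x) (sqrt (real k))"
        unfolding radial_poly'_def by (intro continuous_intros)
      show "\<tau> * radial_poly' (sqrt (real k)) \<noteq> 0" "\<phi> (sqrt (real k)) = 0"
        using radial_poly_zero[OF k] \<tau> by (simp_all add: \<phi>_def)
      have "1 \<le> sqrt (real k)" "sqrt (real k) \<le> 5 / 2"
        using k sqrt_le_5_2[OF k(2)] by auto
      then show "1 / 2 < sqrt (real k) - 1/40" "sqrt (real k) + 1/40 < 3" by linarith+
    qed (use F Vr in auto)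
  qed
qed

theorem theorem7:
  fixes p q :: "real \<Rightarrow> real \<Rightarrow> param \<Rightarrow> real"
    and P Q :: "nat \<Rightarrow> nat \<Rightarrow> param \<Rightarrow> real"
    and d0 :: param and r0 :: real
  assumes p_poly: "\<forall>u v d. p u v d = (\<Sum>i\<le>3. \<Sum>j\<le>3 - i. P i j d * u ^ i * v ^ j)"
    and q_poly: "\<forall>u v d. q u v d = (\<Sum>i\<le>3. \<Sum>j\<le>3 - i. Q i j d * u ^ i * v ^ j)"
    and P_lin: "\<forall>i j. linear (P i j)"
    and Q_lin: "\<forall>i j. linear (Q i j)"
    and div: "\<forall>u v d. deriv (\<lambda>u. p u v d) u + deriv (\<lambda>v. q u v d) v =
                c00 d + c10 d * u + c01 d * v + c20 d * u^2 + c11 d * u * v + c02 d * v^2"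
    and f0: "fpoly r0 = 0"
    and h00: "c00 d0 = 0"
    and h02: "c02 d0 = - 3/2 * c10 d0 + 3 * c01 d0 - c20 d0"
    and h01: "c01 d0 \<noteq> 0"
    and h11: "c11 d0 = (12 * r0 - 191/4) * c10 d0 + (40 * r0 + 3) * c01 d0
                       + (8 * r0 - 47/2) * c20 d0"
    and h10: "c10 d0 = 2 / (17680 * r0 - 43347) *
                ((1792 * r0^2 - 17328 * r0 - 696) * c01 d0 + (11107 - 5680 * r0) * c20 d0)"
    and h20: "c20 d0 = (6544683 + 11682846 * r0 + 30378720 * r0^2 - 40278528 * r0^3
                         - 21471232 * r0^4) /
                       (2 * (2770317 - 11417834 * r0 + 11442688 * r0^2 + 442880 * r0^3))
                       * c01 d0"
  shows "\<forall>V \<eta>. open V \<and> (0, 0) \<in> V \<and> \<eta> > 0 \<longrightarrow>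
           (\<exists>eps d r. 0 < \<bar>eps\<bar> \<and> \<bar>eps\<bar> < \<eta> \<and> dist d d0 < \<eta> \<and> \<bar>r - r0\<bar> < \<eta> \<and>
                      has_limit_cycles_in (field p q eps d r) 6 V)"
proof (intro allI impI, elim conjE)
  fix V :: "(real \<times> real) set" and \<eta> :: real
  assume V: "open V" "(0, 0) \<in> V" and \<eta>: "\<eta> > 0"
  have h10': "c10 d0 = 2 / ev1 r0 pM * (ev1 r0 pA * c01 d0 + ev1 r0 pB * c20 d0)"
    using h10 by (simp add: pM_def pA_def pB_def power2_eq_square algebra_simps)
  have h20': "c20 d0 = ev1 r0 pN / (2 * ev1 r0 pD) * c01 d0"
    using h20 by (simp add: pN_def pD_def eval_nat_numeral algebra_simps)
  obtain r d where r: "(r \<longlongrightarrow> r0) (at_right 0)" and d: "(d \<longlongrightarrow> d0) (at_right 0)"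
    and cycles: "\<And>k::nat. 1 \<le> k \<Longrightarrow> k \<le> 6 \<Longrightarrow> \<forall>\<^sub>F l in at_right 0. \<exists>\<Gamma>. limit_cycle (field p q (l ^ 15) (d l) (r l)) \<Gamma> \<and>
        \<Gamma> \<subseteq> {z. 2 * l * (sqrt (real k) - 1/40) < norm z \<and> norm z < 2 * l * (sqrt (real k) + 1/40)}"
    by (rule six_families[OF p_poly[rule_format] q_poly[rule_format] P_lin[rule_format] Q_lin[rule_format]
          div[rule_format] f0 h00 h02 h01 h11 h10' h20']) (rule that)
  obtain \<delta> where \<delta>: "\<delta> > 0" "ball (0, 0) \<delta> \<subseteq> V"
    using V open_contains_ball by blast
  have ev_cycles: "\<forall>\<^sub>F l in at_right 0. \<forall>k\<in>{1..6::nat}. \<exists>\<Gamma>. limit_cycle (field p q (l ^ 15) (d l) (r l)) \<Gamma> \<and>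
        \<Gamma> \<subseteq> {z. 2 * l * (sqrt (real k) - 1/40) < norm z \<and> norm z < 2 * l * (sqrt (real k) + 1/40)}"
    by (intro eventually_ball_finite ballI cycles) auto
  \<comment> \<open>The bound \<delta> / 6 suffices because the cycles lie within 2 * l * 3 of the
    origin.\<close>
  have ev_l: "\<forall>\<^sub>F l in at_right 0. 0 < l \<and> l < min 1 (min \<eta> (\<delta> / 6))"
    using \<eta> \<delta> by (intro eventually_at_rightI[of 0 "min 1 (min \<eta> (\<delta> / 6))"]) auto
  have "\<forall>\<^sub>F l in at_right 0. dist (r l) r0 < \<eta> \<and> dist (d l) d0 < \<eta>"
    by (intro eventually_conj tendstoD[OF r \<eta>] tendstoD[OF d \<eta>])
  from eventually_happens'[OF trivial_limit_at_right_real eventually_conj[OF eventually_conj[OF ev_cycles ev_l] this]]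
  obtain l where l: "0 < l" "l < 1" "l < \<eta>" "l < \<delta> / 6" "dist (r l) r0 < \<eta>" "dist (d l) d0 < \<eta>"
    and ex: "\<forall>k\<in>{1..6::nat}. \<exists>\<Gamma>. limit_cycle (field p q (l ^ 15) (d l) (r l)) \<Gamma> \<and>
        \<Gamma> \<subseteq> {z. 2 * l * (sqrt (real k) - 1/40) < norm z \<and> norm z < 2 * l * (sqrt (real k) + 1/40)}"
    by auto
  from bchoice[OF ex] obtain \<Gamma> where \<Gamma>: "\<And>k. k \<in> {1..6::nat} \<Longrightarrow> limit_cycle (field p q (l ^ 15) (d l) (r l)) (\<Gamma> k)"
    "\<And>k z. k \<in> {1..6::nat} \<Longrightarrow> z \<in> \<Gamma> k \<Longrightarrow> 2 * l * (sqrt (real k) - 1/40) < norm z \<and> norm z < 2 * l * (sqrt (real k) + 1/40)"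
    by blast
  have sqrt_le: "sqrt (real k) \<le> 5 / 2" if "k \<in> {1..6::nat}" for k
    using that by (intro sqrt_le_5_2) auto
  have in_V: "\<Gamma> k \<subseteq> V" if k: "k \<in> {1..6::nat}" for k
  proof
    fix z assume z: "z \<in> \<Gamma> k"
    have "norm z < 2 * l * (sqrt (real k) + 1/40)" using \<Gamma>(2)[OF k z] by blast
    also have "\<dots> \<le> 2 * l * 3" using sqrt_le[OF k] l(1) by (intro mult_left_mono) auto
    also have "\<dots> < \<delta>" using l(4) by simp
    finally have "z \<in> ball (0, 0) \<delta>" by (simp add: zero_prod_def[symmetric])
    then show "z \<in> V" using \<delta>(2) by blast
  qed
  \<comment> \<open>A common point of two cycles forces sqrt k - sqrt j < 1 / 20, twice the
    half-width 1 / 40 of the windows; but multiplied by sqrt k + sqrt j \<le> 5 this difference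
    gives k - j \<ge> 1.\<close>
  have distinct: "\<Gamma> j \<noteq> \<Gamma> k" if jk: "j \<in> {1..6::nat}" "k \<in> {1..6}" "j < k" for j k
  proof
    assume eq: "\<Gamma> j = \<Gamma> k"
    obtain z where z: "z \<in> \<Gamma> j"
      using \<Gamma>(1)[OF jk(1)] unfolding limit_cycle_def periodic_orbit_def by blast
    have "2 * l * (sqrt (real k) - 1/40) < 2 * l * (sqrt (real j) + 1/40)"
      using \<Gamma>(2)[OF jk(1) z] \<Gamma>(2)[OF jk(2) z[unfolded eq]] by linarith
    then have "sqrt (real k) - sqrt (real j) < 1 / 20" using l(1) by simp
    moreover have "0 \<le> sqrt (real k) + sqrt (real j)" "sqrt (real k) + sqrt (real j) \<le> 5"
      using sqrt_le[OF jk(1)] sqrt_le[OF jk(2)] by auto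
    ultimately have "(sqrt (real k) - sqrt (real j)) * (sqrt (real k) + sqrt (real j)) \<le> 1 / 20 * 5"
      using jk(3) by (intro mult_mono) auto
    moreover have "(sqrt (real k) - sqrt (real j)) * (sqrt (real k) + sqrt (real j)) = real k - real j"
      by (simp add: algebra_simps)
    moreover have "real k - real j \<ge> 1" using jk(3) by linarith
    ultimately show False by simp
  qed
  have "inj_on \<Gamma> {1..6}"
    by (rule inj_onI) (metis distinct linorder_neqE_nat)
  then have "card (\<Gamma> ` {1..6}) = 6" by (simp add: card_image)
  then have "has_limit_cycles_in (field p q (l ^ 15) (d l) (r l)) 6 V"
    unfolding has_limit_cycles_in_def using \<Gamma>(1) in_V by (intro exI[of _ "\<Gamma> ` {1..6}"]) blast
  moreover have "l ^ 15 \<le> l" using power_decreasing[of 1 15 l] l by simp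
  ultimately show "\<exists>eps d r. 0 < \<bar>eps\<bar> \<and> \<bar>eps\<bar> < \<eta> \<and> dist d d0 < \<eta> \<and> \<bar>r - r0\<bar> < \<eta> \<and>
                      has_limit_cycles_in (field p q eps d r) 6 V"
    using l by (intro exI[of _ "l ^ 15"] exI[of _ "d l"] exI[of _ "r l"]) (auto simp: dist_real_def)
qed

end
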